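(* Let $n\ge3$, let $W:\mathbf S^{n-1}\to\mathbf R$ be measurable, bounded and non-negative, let $f\in L^2(\mathbf R^n)$, and let $u$ satisfy $$ i\partial_t u-\Delta u+|x|^{-2}W\left(\frac{x}{|x|}\right)u=0,\qquad u(0)=f,\qquad (t,x)\in\mathbf R\times\mathbf R^n. $$ If $$ \liminf_{t\to\infty}\frac1t\int_{\mathbf R^n}|x|\,|u(t,x)|^2\,dx=0, $$ then $u\equiv0$.
   Context: The Cauchy problem is globally well-posed in $L^2(\mathbf R^n)$; $u$ denotes the solution in $\mathcal C(\mathbf R;L^2(\mathbf R^n))$ with initial datum $f$. *)

theory Defs
  imports "HOL-Analysis.Analysis"
begin

section \<open>Test functions, square integrable functions and the Sobolev space of order one\<close>

text \<open>
  Elements of function spaces are represented by functions; equality in these spaces is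
  equality almost everywhere with respect to Lebesgue measure.
\<close>

definition partial_deriv :: "'n::finite \<Rightarrow> (real^'n \<Rightarrow> real) \<Rightarrow> real^'n \<Rightarrow> real" where
  "partial_deriv i \<eta> x = frechet_derivative \<eta> (at x) (axis i 1)"

primrec k_smooth :: "nat \<Rightarrow> (real^'n::finite \<Rightarrow> real) \<Rightarrow> bool" where
  "k_smooth 0 \<eta> \<longleftrightarrow> continuous_on UNIV \<eta>"
| "k_smooth (Suc k) \<eta> \<longleftrightarrow> \<eta> differentiable_on UNIV \<and> (\<forall>i. k_smooth k (partial_deriv i \<eta>))"

definition test_function :: "(real^'n::finite \<Rightarrow> real) \<Rightarrow> bool" where
  "test_function \<eta> \<longleftrightarrow> (\<forall>k. k_smooth k \<eta>) \<and> compact (closure {x. \<eta> x \<noteq> 0})"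

definition L2_function :: "(real^'n::finite \<Rightarrow> complex) \<Rightarrow> bool" where
  "L2_function \<phi> \<longleftrightarrow>
     \<phi> \<in> borel_measurable lebesgue \<and> integrable lebesgue (\<lambda>x. (cmod (\<phi> x))\<^sup>2)"

definition L2_norm :: "(real^'n::finite \<Rightarrow> complex) \<Rightarrow> real" where
  "L2_norm \<phi> = sqrt (LINT x|lebesgue. (cmod (\<phi> x))\<^sup>2)"

definition L2_inner :: "(real^'n::finite \<Rightarrow> complex) \<Rightarrow> (real^'n \<Rightarrow> complex) \<Rightarrow> complex" where
  "L2_inner \<phi> \<psi> = (LINT x|lebesgue. \<phi> x * cnj (\<psi> x))"

text \<open>
  \<open>H1_gradient \<phi> G\<close>: the function \<open>\<phi>\<close> belongs to the Sobolev space
  \<open>H\<^sup>1\<close> and \<open>G\<close> is its weak gradient.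
\<close>

definition H1_gradient ::
    "(real^'n::finite \<Rightarrow> complex) \<Rightarrow> (real^'n \<Rightarrow> complex^'n) \<Rightarrow> bool" where
  "H1_gradient \<phi> G \<longleftrightarrow>
     L2_function \<phi> \<and> (\<forall>i. L2_function (\<lambda>x. G x $ i)) \<and>
     (\<forall>\<eta> i. test_function \<eta> \<longrightarrow>
        (LINT x|lebesgue. of_real (partial_deriv i \<eta> x) * \<phi> x) =
        - (LINT x|lebesgue. of_real (\<eta> x) * G x $ i))"


section \<open>The Schroedinger operator with an inverse square potential\<close>

text \<open>
  Surface measure on the unit sphere, as the cone measure: a set \<open>A\<close> of directions has
  \<open>n\<close> times the volume of the part of the unit ball that is seen from the origin in a
  direction in \<open>A\<close>.
\<close>

definition sphere_measure :: "(real^'n::finite) measure" where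
  "sphere_measure =
     scale_measure (of_nat CARD('n))
       (distr (restrict_space lborel (cball 0 1 - {0})) (restrict_space borel (sphere 0 1))
          (\<lambda>x. x /\<^sub>R norm x))"

definition inverse_square_potential ::
    "(real^'n::finite \<Rightarrow> real) \<Rightarrow> real^'n \<Rightarrow> real" where
  "inverse_square_potential W x = W (x /\<^sub>R norm x) / (norm x)\<^sup>2"

text \<open>
  The sesquilinear form of \<open>- \<Delta> + |x|\<^sup>-\<^sup>2 W (x / |x|)\<close> at \<open>\<phi>\<close>, \<open>\<psi>\<close> with weak gradients
  \<open>G\<close>, \<open>K\<close>. For bounded measurable \<open>W\<close> and \<open>n \<ge> 3\<close>, Hardy's inequality makes both
  integrals absolutely convergent on \<open>H\<^sup>1\<close>.
\<close>

definition schroedinger_form ::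
    "(real^'n::finite \<Rightarrow> real) \<Rightarrow> (real^'n \<Rightarrow> complex) \<Rightarrow> (real^'n \<Rightarrow> complex^'n) \<Rightarrow>
     (real^'n \<Rightarrow> complex) \<Rightarrow> (real^'n \<Rightarrow> complex^'n) \<Rightarrow> complex" where
  "schroedinger_form W \<phi> G \<psi> K =
     (\<Sum>i\<in>UNIV. L2_inner (\<lambda>x. G x $ i) (\<lambda>x. K x $ i)) +
     L2_inner (\<lambda>x. of_real (inverse_square_potential W x) * \<phi> x) \<psi>"

text \<open>
  \<open>schroedinger_operator W \<phi> w\<close> is the graph of the self-adjoint (Friedrichs) realization
  \<open>H\<close> of \<open>- \<Delta> + |x|\<^sup>-\<^sup>2 W (x / |x|)\<close>: it says that \<open>\<phi>\<close> is in the domain of \<open>H\<close> and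
  \<open>H \<phi> = w\<close>.
\<close>

definition schroedinger_operator ::
    "(real^'n::finite \<Rightarrow> real) \<Rightarrow> (real^'n \<Rightarrow> complex) \<Rightarrow> (real^'n \<Rightarrow> complex) \<Rightarrow> bool" where
  "schroedinger_operator W \<phi> w \<longleftrightarrow>
     L2_function w \<and>
     (\<exists>G. H1_gradient \<phi> G \<and>
        (\<forall>\<psi> K. H1_gradient \<psi> K \<longrightarrow> schroedinger_form W \<phi> G \<psi> K = L2_inner w \<psi>))"


section \<open>The Cauchy problem\<close>

definition continuous_into_L2 :: "(real \<Rightarrow> real^'n::finite \<Rightarrow> complex) \<Rightarrow> bool" where
  "continuous_into_L2 u \<longleftrightarrow>
     (\<forall>t. L2_function (u t)) \<and>
     (\<forall>t. ((\<lambda>s. L2_norm (\<lambda>x. u s x - u t x)) \<longlongrightarrow> 0) (at t))"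

text \<open>
  The solution in \<open>C(\<real>; L\<^sup>2)\<close> of \<open>i \<partial>\<^sub>t u + H u = 0\<close>, \<open>u(0) = f\<close>. For \<open>L\<^sup>2\<close> data the
  equation is understood weakly: after pairing with an arbitrary \<open>\<phi>\<close> in the domain of \<open>H\<close>
  it becomes \<open>i d/dt \<langle>u(t), \<phi>\<rangle> + \<langle>u(t), H \<phi>\<rangle> = 0\<close>. As \<open>H\<close> is self-adjoint, the only
  such \<open>u\<close> is \<open>u(t) = exp(i t H) f\<close>. Testing only with smooth functions supported away from
  the origin would not select this solution, because \<open>- \<Delta> + |x|\<^sup>-\<^sup>2 W (x / |x|)\<close> need not be
  essentially self-adjoint on them.
\<close>

definition schroedinger_solution ::
    "(real^'n::finite \<Rightarrow> real) \<Rightarrow> (real^'n \<Rightarrow> complex) \<Rightarrow>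
     (real \<Rightarrow> real^'n \<Rightarrow> complex) \<Rightarrow> bool" where
  "schroedinger_solution W f u \<longleftrightarrow>
     continuous_into_L2 u \<and>
     (\<forall>\<phi> w. schroedinger_operator W \<phi> w \<longrightarrow>
        (\<forall>t. \<exists>d. ((\<lambda>s. L2_inner (u s) \<phi>) has_vector_derivative d) (at t) \<and>
                 \<i> * d + L2_inner (u t) w = 0)) \<and>
     (AE x in lebesgue. u 0 x = f x)"

end

theory Submission
  imports Defs
begin

text \<open>
  Write \<open>H = - \<Delta> + V\<close> with \<open>V x = W (x / |x|) / |x|\<^sup>2\<close>, so that \<open>u(t) = exp (i t H) f\<close>. Because \<open>V\<close> is
  homogeneous of degree \<open>-2\<close>, the equation is invariant under the pseudo-conformal inversion:
  with \<open>\<tau> = 1 / t\<close>, the function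
    \<open>v(\<tau>, y) = t^(n/2) exp (i t |y|\<^sup>2 / 4) u(t, t y)\<close>
  solves \<open>d/d\<tau> v = - i H v\<close> for \<open>\<tau> > 0\<close> and has the constant norm \<open>\<parallel>f\<parallel>\<close>. A solution of this
  equation on \<open>\<tau> > 0\<close> has a limit in \<open>L\<^sup>2\<close> as \<open>\<tau> \<rightarrow> 0\<close>, of the same norm. On the other hand
    \<open>(1/t) \<integral> |x| |u(t, x)|\<^sup>2 dx = \<integral> |y| |v(1/t, y)|\<^sup>2 dy\<close>,
  so along the times provided by the hypothesis \<open>v\<close> concentrates at the origin, and its limit can only
  be \<open>0\<close>. Hence \<open>f = 0\<close>, and \<open>u = 0\<close> by conservation of the norm.

  Three things have to be made precise for data that are merely in \<open>L\<^sup>2\<close>.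

  Weak solutions. The equation is only known after pairing with elements of the domain of \<open>H\<close>. In
  \<open>selfadjoint_graph\<close> an operator is given by its graph, and the resolvent \<open>R\<close> regularizes: \<open>R v\<close> is
  Lipschitz in time and has constant norm (\<open>norm_conserved\<close>). If moreover \<open>v(\<tau>\<^sub>k)\<close> tends weakly
  to \<open>0\<close> on the domain for some \<open>\<tau>\<^sub>k \<rightarrow> 0\<close>, then the Lipschitz bound forces the constant norm of \<open>R v\<close>
  to vanish (\<open>weak_solution_vanishes\<close>).

  The operator. Elements of \<open>L\<^sup>2\<close> form the complete real inner product space \<open>'n l2\<close>. Weak gradients are
  identified with generators of translations, and a weak generator is a strong one
  (\<open>weak_generator_imp_strong\<close>); this gives integration by parts on the Sobolev space without any
  smoothing, then Hardy's inequality (\<open>hardy\<close>), then the resolvent by orthogonal projection in the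
  form space (\<open>\<Gamma>_selfadjoint\<close>).

  The inversion. Since \<open>u\<close> is tested against a fixed domain, the inversion is carried out on test vectors:
  \<open>v(\<tau>)\<close> is paired with \<open>exp (- \<epsilon> |y|\<^sup>2) \<psi>\<close> for \<open>\<psi>\<close> in the domain of \<open>H\<close>. The Gaussian supplies the decay
  that makes \<open>|y|\<^sup>2\<close> and the dilation generator harmless, it preserves the domain (\<open>\<Gamma>_gauss\<close>), and
  all terms of the derivative except \<open>H (exp (- \<epsilon> |y|\<^sup>2) \<psi>)\<close> cancel (\<open>pseudo_conformal_derivative\<close>);
  finally \<open>\<epsilon> \<rightarrow> 0\<close> (\<open>pseudo_conformal_weak_solution\<close>). The weak convergence to \<open>0\<close> is
  \<open>concentration\<close>, where Hardy's inequality is used once more, to divide a form-domain vector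
  by \<open>|y|^(1/2)\<close>.
\<close>

section \<open>Projections, total sets and weak convergence in a Hilbert space\<close>

lemma norm_diff_scaleR_sq:
  fixes a v :: "'a::real_inner"
  shows "(norm (a - t *\<^sub>R v))\<^sup>2 = (norm a)\<^sup>2 - 2 * t * (a \<bullet> v) + t\<^sup>2 * (v \<bullet> v)"
  unfolding power2_norm_eq_inner
  by (simp add: inner_diff_left inner_diff_right inner_commute[of v a] power2_eq_square algebra_simps)

lemma norm_le_cancel:
  assumes "norm x * norm x \<le> C * norm x" "0 \<le> C" shows "norm x \<le> C"
  using assms by (cases "x = 0") (auto dest: mult_right_le_imp_le)

text \<open>
  A minimizing sequence for the distance to \<open>S\<close> is Cauchy by the parallelogram law, because midpoints
  stay in \<open>S\<close>; its limit is the foot of the perpendicular.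
\<close>
lemma orthogonal_projection_exists:
  fixes S :: "'a::{real_inner,complete_space} set"
  assumes S: "subspace S" "closed S"
  shows "\<exists>p\<in>S. \<forall>s\<in>S. (x - p) \<bullet> s = 0"
proof -
  define d where "d = infdist x S"
  have ne: "S \<noteq> {}" using S(1) subspace_0 by blast
  have dle: "d \<le> norm (x - s)" if "s \<in> S" for s
    using infdist_le[OF that, of x] by (simp add: d_def dist_norm)
  have d0: "d \<ge> 0" by (simp add: d_def infdist_nonneg)
  have "\<exists>s\<in>S. norm (x - s) < d + inverse (real (Suc n))" for n
  proof (rule ccontr)
    assume "\<not> ?thesis"
    then have "\<And>s. s \<in> S \<Longrightarrow> d + inverse (real (Suc n)) \<le> dist x s"
      by (force simp: dist_norm)
    then have "d + inverse (real (Suc n)) \<le> infdist x S"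
      unfolding infdist_def using ne by (auto intro!: cINF_greatest)
    then show False by (simp add: d_def[symmetric])
  qed
  then obtain s where s: "\<And>n. s n \<in> S" "\<And>n. norm (x - s n) < d + inverse (real (Suc n))"
    by metis
  have key: "(norm (s m - s n))\<^sup>2 \<le> 4 * ((d + inverse (real (Suc N)))\<^sup>2 - d\<^sup>2)"
    if "N \<le> m" "N \<le> n" for m n N
  proof -
    have mid: "(1/2) *\<^sub>R (s m + s n) \<in> S"
      using s S(1) by (simp add: subspace_add subspace_scale)
    have b: "(norm (x - s k))\<^sup>2 \<le> (d + inverse (real (Suc N)))\<^sup>2" if "N \<le> k" for k
    proof (rule power_mono)
      have "inverse (real (Suc k)) \<le> inverse (real (Suc N))"
        using that by (intro le_imp_inverse_le) auto
      then show "norm (x - s k) \<le> d + inverse (real (Suc N))" using s(2)[of k] by linarith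
    qed simp
    have "(norm (s m - s n))\<^sup>2 = 2 * (norm (x - s m))\<^sup>2 + 2 * (norm (x - s n))\<^sup>2
        - 4 * (norm (x - (1/2) *\<^sub>R (s m + s n)))\<^sup>2"
      by (simp add: power2_norm_eq_inner inner_simps algebra_simps inner_commute)
    also have "\<dots> \<le> 2 * (d + inverse (real (Suc N)))\<^sup>2 + 2 * (d + inverse (real (Suc N)))\<^sup>2 - 4 * d\<^sup>2"
      using b[OF that(1)] b[OF that(2)] power_mono[OF dle[OF mid] d0, of 2] by linarith
    finally show ?thesis by simp
  qed
  have lim0: "(\<lambda>N. 4 * ((d + inverse (real (Suc N)))\<^sup>2 - d\<^sup>2)) \<longlonglongrightarrow> 4 * ((d + 0)\<^sup>2 - d\<^sup>2)"
    by (intro tendsto_intros LIMSEQ_inverse_real_of_nat)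
  have "Cauchy s"
  proof (rule metric_CauchyI)
    fix e :: real assume e: "e > 0"
    have "\<forall>\<^sub>F N in sequentially. 4 * ((d + inverse (real (Suc N)))\<^sup>2 - d\<^sup>2) < e\<^sup>2"
      using order_tendstoD(2)[OF lim0, of "e\<^sup>2"] e by simp
    then obtain N where N: "4 * ((d + inverse (real (Suc N)))\<^sup>2 - d\<^sup>2) < e\<^sup>2"
      by (auto simp: eventually_sequentially)
    have "dist (s m) (s n) < e" if "N \<le> m" "N \<le> n" for m n
    proof -
      have "(norm (s m - s n))\<^sup>2 < e\<^sup>2" using key[OF that] N by linarith
      then show ?thesis using e by (simp add: dist_norm power2_less_imp_less)
    qed
    then show "\<exists>M. \<forall>m\<ge>M. \<forall>n\<ge>M. dist (s m) (s n) < e" by blast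
  qed
  then obtain p where p: "s \<longlonglongrightarrow> p" using Cauchy_convergent convergent_def by blast
  have pS: "p \<in> S" using closed_sequentially[OF S(2) _ p] s by blast
  have "norm (x - p) \<le> d"
  proof (rule LIMSEQ_le)
    show "(\<lambda>n. norm (x - s n)) \<longlonglongrightarrow> norm (x - p)" by (intro tendsto_intros p)
    show "(\<lambda>n. d + inverse (real (Suc n))) \<longlonglongrightarrow> d"
      using tendsto_add[OF tendsto_const LIMSEQ_inverse_real_of_nat, of d] by simp
    show "\<exists>N. \<forall>n\<ge>N. norm (x - s n) \<le> d + inverse (real (Suc n))"
      using s(2) less_imp_le by blast
  qed
  have "(x - p) \<bullet> v = 0" if v: "v \<in> S" for v
  proof (cases "v = 0")
    case False
    define t where "t = ((x - p) \<bullet> v) / (v \<bullet> v)"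
    have vv: "v \<bullet> v > 0" using False by simp
    have "p + t *\<^sub>R v \<in> S" using pS v S(1) by (simp add: subspace_add subspace_scale)
    then have "norm (x - p) \<le> norm (x - (p + t *\<^sub>R v))" using dle \<open>norm (x - p) \<le> d\<close> by force
    then have "(norm (x - p))\<^sup>2 \<le> (norm ((x - p) - t *\<^sub>R v))\<^sup>2"
      by (simp add: diff_diff_eq power_mono)
    also have "\<dots> = (norm (x - p))\<^sup>2 - 2 * t * ((x - p) \<bullet> v) + t\<^sup>2 * (v \<bullet> v)"
      using norm_diff_scaleR_sq .
    also have "\<dots> = (norm (x - p))\<^sup>2 - ((x - p) \<bullet> v)\<^sup>2 / (v \<bullet> v)"
      using vv by (simp add: t_def field_simps power2_eq_square)
    finally have "((x - p) \<bullet> v)\<^sup>2 / (v \<bullet> v) \<le> 0" by simp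
    then show ?thesis using vv by (simp add: divide_le_0_iff)
  qed auto
  then show ?thesis using pS by blast
qed

text \<open>
  For subspaces this is density (\<open>total_imp_dense\<close>). It is the form in which density of test functions
  is proved below, since vanishing of all pairings is what weak formulations give.
\<close>
definition total_set :: "'a::real_inner set \<Rightarrow> bool" where
  "total_set D \<longleftrightarrow> (\<forall>x. (\<forall>d\<in>D. x \<bullet> d = 0) \<longrightarrow> x = 0)"

lemma subspace_closure':
  fixes D :: "'a::real_normed_vector set"
  assumes "subspace D" shows "subspace (closure D)"
proof (rule subspaceI)
  show "0 \<in> closure D" using assms closure_subset subspace_0 by blast
next
  fix x y assume "x \<in> closure D" "y \<in> closure D"
  then obtain a b where "\<And>n. a n \<in> D" "a \<longlonglongrightarrow> x" "\<And>n. b n \<in> D" "b \<longlonglongrightarrow> y"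
    unfolding closure_sequential by metis
  then show "x + y \<in> closure D" unfolding closure_sequential
    by (intro exI[of _ "\<lambda>n. a n + b n"]) (auto intro!: tendsto_intros subspace_add assms)
next
  fix c x assume "x \<in> closure D"
  then obtain a where "\<And>n. a n \<in> D" "a \<longlonglongrightarrow> x"
    unfolding closure_sequential by metis
  then show "c *\<^sub>R x \<in> closure D" unfolding closure_sequential
    by (intro exI[of _ "\<lambda>n. c *\<^sub>R a n"]) (auto intro!: tendsto_intros subspace_scale assms)
qed

lemma total_imp_dense:
  fixes D :: "'a::{real_inner,complete_space} set"
  assumes "subspace D" "total_set D"
  shows "closure D = UNIV"
proof -
  have "x \<in> closure D" for x
  proof -
    obtain p where p: "p \<in> closure D" "\<forall>s\<in>closure D. (x - p) \<bullet> s = 0"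
      using orthogonal_projection_exists[OF subspace_closure'[OF assms(1)]] by auto
    have "x - p = 0" using assms(2) p(2) closure_subset unfolding total_set_def by blast
    then show ?thesis using p(1) by simp
  qed
  then show ?thesis by blast
qed

lemma norm_le_total:
  fixes D :: "'a::{real_inner,complete_space} set"
  assumes "subspace D" "total_set D" "\<And>d. d \<in> D \<Longrightarrow> \<bar>x \<bullet> d\<bar> \<le> C * norm d" "C \<ge> 0"
  shows "norm x \<le> C"
proof -
  have "closed {d. \<bar>x \<bullet> d\<bar> \<le> C * norm d}"
    by (intro closed_Collect_le continuous_intros)
  then have "closure D \<subseteq> {d. \<bar>x \<bullet> d\<bar> \<le> C * norm d}"
    using assms(3) by (intro closure_minimal) auto
  then have "x \<in> {d. \<bar>x \<bullet> d\<bar> \<le> C * norm d}" using total_imp_dense[OF assms(1,2)] by blast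
  then have "\<bar>x \<bullet> x\<bar> \<le> C * norm x" by (rule CollectD)
  then have "norm x * norm x \<le> C * norm x" by (simp add: norm_eq_sqrt_inner)
  then show ?thesis by (cases "norm x = 0") (use assms(4) in \<open>auto simp: mult_le_cancel_right\<close>)
qed

lemma weak_limit_total:
  fixes D :: "'a::{real_inner,complete_space} set"
  assumes D: "subspace D" "total_set D"
    and bd: "\<forall>\<^sub>F s in F. norm (q s) \<le> C"
    and lim: "\<And>d. d \<in> D \<Longrightarrow> ((\<lambda>s. q s \<bullet> d) \<longlongrightarrow> g \<bullet> d) F"
  shows "((\<lambda>s. q s \<bullet> y) \<longlongrightarrow> g \<bullet> y) F"
proof (rule tendstoI)
  fix e :: real assume e: "e > 0"
  define M where "M = \<bar>C\<bar> + norm g + 1"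
  have M: "M > 0" by (simp add: M_def add_nonneg_pos)
  have "y \<in> closure D" using total_imp_dense[OF D] by blast
  then obtain d where d: "d \<in> D" "dist d y < e / (2 * M)"
    using M e by (metis closure_approachable divide_pos_pos mult_pos_pos zero_less_numeral)
  have "\<forall>\<^sub>F s in F. dist (q s \<bullet> d) (g \<bullet> d) < e / 2"
    using lim[OF d(1)] e unfolding tendsto_iff by (meson half_gt_zero)
  with bd show "\<forall>\<^sub>F s in F. dist (q s \<bullet> y) (g \<bullet> y) < e"
  proof eventually_elim
    case (elim s)
    have "norm (q s - g) \<le> M" using elim(1) norm_triangle_ineq4[of "q s" g] by (simp add: M_def)
    moreover have "norm (y - d) \<le> e / (2 * M)" using d(2) by (simp add: dist_norm norm_minus_commute)
    ultimately have "norm (q s - g) * norm (y - d) \<le> M * (e / (2 * M))"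
      using M by (intro mult_mono) auto
    then have "\<bar>(q s - g) \<bullet> (y - d)\<bar> \<le> e / 2"
      using Cauchy_Schwarz_ineq2[of "q s - g" "y - d"] M by (simp add: field_simps)
    moreover have "q s \<bullet> y - g \<bullet> y = (q s - g) \<bullet> (y - d) + (q s \<bullet> d - g \<bullet> d)"
      by (simp add: inner_simps)
    ultimately show ?case using elim(2) unfolding dist_real_def by linarith
  qed
qed

text \<open>
  If norms do not exceed that of the weak limit, then weak convergence is strong:
  \<open>\<parallel>q - g\<parallel>\<^sup>2 \<le> 2 (g \<bullet> g - q \<bullet> g)\<close>. Pairing with the single vector \<open>g\<close> is enough.
\<close>
lemma weak_to_strong:
  fixes q :: "'b \<Rightarrow> 'a::real_inner"
  assumes bd: "\<forall>\<^sub>F s in F. norm (q s) \<le> norm g"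
    and lim: "((\<lambda>s. q s \<bullet> g) \<longlongrightarrow> g \<bullet> g) F"
  shows "(q \<longlongrightarrow> g) F"
proof -
  have "((\<lambda>s. 2 * (g \<bullet> g - q s \<bullet> g)) \<longlongrightarrow> 2 * (g \<bullet> g - g \<bullet> g)) F"
    by (intro tendsto_intros lim)
  then have l0: "((\<lambda>s. 2 * (g \<bullet> g - q s \<bullet> g)) \<longlongrightarrow> 0) F" by simp
  have "((\<lambda>s. (norm (q s - g))\<^sup>2) \<longlongrightarrow> 0) F"
  proof (rule tendsto_sandwich[OF _ _ tendsto_const l0])
    show "\<forall>\<^sub>F s in F. (norm (q s - g))\<^sup>2 \<le> 2 * (g \<bullet> g - q s \<bullet> g)"
      using bd
    proof eventually_elim
      case (elim s)
      have "(norm (q s))\<^sup>2 \<le> (norm g)\<^sup>2" using elim by (intro power_mono) auto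
      then show ?case by (simp add: power2_norm_eq_inner inner_simps inner_commute)
    qed
  qed simp
  then have "((\<lambda>s. sqrt ((norm (q s - g))\<^sup>2)) \<longlongrightarrow> sqrt 0) F" by (intro tendsto_intros)
  then have "((\<lambda>s. norm (q s - g)) \<longlongrightarrow> 0) F" by simp
  then show ?thesis by (rule LIM_zero_cancel[OF tendsto_norm_zero_cancel])
qed

section \<open>One-parameter groups of isometries\<close>

lemma has_vector_derivative_iff_quotient:
  fixes f :: "real \<Rightarrow> 'a::real_normed_vector"
  shows "(f has_vector_derivative g) (at x) \<longleftrightarrow> ((\<lambda>h. (f (x + h) - f x) /\<^sub>R h) \<longlongrightarrow> g) (at 0)"
proof -
  have eq: "norm (f (x + h) - f x - h *\<^sub>R g) / norm h = norm ((f (x + h) - f x) /\<^sub>R h - g)"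
    if "h \<noteq> 0" for h
  proof -
    have "(f (x + h) - f x) /\<^sub>R h - g = (f (x + h) - f x - h *\<^sub>R g) /\<^sub>R h"
      using that by (simp add: scaleR_diff_right)
    then show ?thesis using that by (simp add: divide_inverse_commute)
  qed
  have "(f has_vector_derivative g) (at x) \<longleftrightarrow>
    ((\<lambda>h. norm (f (x + h) - f x - h *\<^sub>R g) / norm h) \<longlongrightarrow> 0) (at 0)"
    by (simp add: has_vector_derivative_def has_derivative_at bounded_linear_scaleR_left)
  also have "\<dots> \<longleftrightarrow> ((\<lambda>h. norm ((f (x + h) - f x) /\<^sub>R h - g)) \<longlongrightarrow> 0) (at 0)"
    by (rule filterlim_cong[OF refl refl], unfold eventually_at_filter)
      (rule always_eventually, use eq in blast)
  also have "\<dots> \<longleftrightarrow> ((\<lambda>h. (f (x + h) - f x) /\<^sub>R h) \<longlongrightarrow> g) (at 0)"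
    by (simp add: tendsto_norm_zero_iff LIM_zero_iff)
  finally show ?thesis .
qed

text \<open>
  \<open>B\<close> is the generator on the invariant total subspace \<open>D\<close>. Strong continuity on the whole space
  is a consequence (\<open>T_tendsto\<close>).
\<close>
locale isometry_group =
  fixes T :: "real \<Rightarrow> 'a::{real_inner,complete_space} \<Rightarrow> 'a"
    and D :: "'a set" and B :: "'a \<Rightarrow> 'a"
  assumes lin: "linear (T s)"
    and iso: "norm (T s x) = norm x"
    and T0: "T 0 x = x"
    and Tadd: "T (s + r) x = T s (T r x)"
    and D: "subspace D" "total_set D" "d \<in> D \<Longrightarrow> T s d \<in> D"
    and gen: "d \<in> D \<Longrightarrow> ((\<lambda>s. T s d) has_vector_derivative B d) (at 0)"
begin

lemma inner_T: "T s x \<bullet> T s y = x \<bullet> y"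
proof -
  have "(norm (T s (x + y)))\<^sup>2 = (norm (x + y))\<^sup>2" by (simp add: iso)
  moreover have "(norm (T s x))\<^sup>2 = (norm x)\<^sup>2" "(norm (T s y))\<^sup>2 = (norm y)\<^sup>2" by (simp_all add: iso)
  ultimately show ?thesis
    by (simp add: linear_add[OF lin] power2_norm_eq_inner inner_simps inner_commute)
qed

lemma T_inverse: "T (- s) (T s x) = x" "T s (T (- s) x) = x"
  using Tadd[of "-s" s x] Tadd[of s "-s" x] T0 by simp_all

lemma T_adjoint: "T s x \<bullet> y = x \<bullet> T (- s) y"
  using inner_T[of s x "T (-s) y"] T_inverse by simp

lemma T_tendsto0: "((\<lambda>s. T s x) \<longlongrightarrow> x) (at 0)"
proof (rule weak_to_strong)
  show "\<forall>\<^sub>F s in at 0. norm (T s x) \<le> norm x" by (simp add: iso)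
  have "((\<lambda>s. T s x \<bullet> d) \<longlongrightarrow> x \<bullet> d) (at 0)" if d: "d \<in> D" for d
  proof -
    have "((\<lambda>s. T s d) \<longlongrightarrow> d) (at 0)"
      using has_vector_derivative_continuous[OF gen[OF d]] by (simp add: continuous_at T0)
    moreover have "filterlim uminus (at (0::real)) (at 0)"
      using filtermap_at_minus[of "0::real"] by (simp add: filterlim_def)
    ultimately have "((\<lambda>s. T (- s) d) \<longlongrightarrow> d) (at 0)"
      using filterlim_compose[of "\<lambda>s. T s d" "nhds d" "at 0" uminus] by simp
    then show ?thesis by (auto simp: T_adjoint intro!: tendsto_intros)
  qed
  note lim = this
  have "\<forall>\<^sub>F s in at 0. norm (T s x) \<le> norm x" by (simp add: iso)
  from weak_limit_total[where q = "\<lambda>s. T s x" and g = x, OF D(1,2) this lim]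
  show "((\<lambda>s. T s x \<bullet> x) \<longlongrightarrow> x \<bullet> x) (at 0)" .
qed

lemma T_tendsto: "((\<lambda>s. T s x) \<longlongrightarrow> T r x) (at r)"
proof -
  have "T (r + h) x = T h (T r x)" for h
    unfolding add.commute[of r h] by (rule Tadd)
  then have "((\<lambda>h. T (r + h) x) \<longlongrightarrow> T r x) (at 0)"
    using T_tendsto0[of "T r x"] by (simp only:)
  then show ?thesis by (rule LIM_offset_zero_cancel)
qed

lemma shift_vector_derivative:
  assumes "((\<lambda>s. T s x) has_vector_derivative g) (at 0)"
  shows "((\<lambda>s. T s x) has_vector_derivative T r g) (at r)"
proof -
  have "((\<lambda>h. (T h x - x) /\<^sub>R h) \<longlongrightarrow> g) (at 0)"
    using assms unfolding has_vector_derivative_iff_quotient T0 add_0 .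
  then have "((\<lambda>h. norm ((T h x - x) /\<^sub>R h - g)) \<longlongrightarrow> 0) (at 0)"
    by (rule tendsto_norm_zero[OF LIM_zero])
  moreover have "norm ((T h x - x) /\<^sub>R h - g) = norm ((T (r + h) x - T r x) /\<^sub>R h - T r g)" for h
    using iso[of r "(T h x - x) /\<^sub>R h - g"]
    by (simp add: linear_diff[OF lin] linear_scale[OF lin] Tadd)
  ultimately have "((\<lambda>h. norm ((T (r + h) x - T r x) /\<^sub>R h - T r g)) \<longlongrightarrow> 0) (at 0)"
    by simp
  then show ?thesis
    unfolding has_vector_derivative_iff_quotient
    by (rule LIM_zero_cancel[OF tendsto_norm_zero_cancel])
qed

lemma inner_T_derivative:
  assumes d: "d \<in> D" and g: "\<And>d. d \<in> D \<Longrightarrow> x \<bullet> B d = - (g \<bullet> d)"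
  shows "((\<lambda>s. T s x \<bullet> d) has_real_derivative T r g \<bullet> d) (at r)"
proof -
  have "((\<lambda>s. T s (T (- r) d)) has_vector_derivative B (T (- r) d)) (at 0)"
    by (rule gen[OF D(3)[OF d]])
  then have "((\<lambda>s. x \<bullet> T s (T (- r) d)) has_real_derivative x \<bullet> B (T (- r) d)) (at 0)"
    unfolding has_real_derivative_iff_has_vector_derivative
    by (rule bounded_linear.has_vector_derivative[OF bounded_linear_inner_right])
  moreover have "x \<bullet> B (T (- r) d) = - (T r g \<bullet> d)" using g[OF D(3)[OF d]] by (simp add: T_adjoint)
  ultimately have "((\<lambda>s. x \<bullet> T s (T (- r) d)) has_real_derivative - (T r g \<bullet> d)) (at (r - r))"
    by simp
  from DERIV_chain2[where g = "\<lambda>s. r - s" and Db = "- 1" and s = UNIV, OF this]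
  have "((\<lambda>s. x \<bullet> T (r - s) (T (- r) d)) has_real_derivative T r g \<bullet> d) (at r)"
    using DERIV_diff[OF DERIV_const DERIV_ident, of r r] by simp
  then show ?thesis by (simp add: T_adjoint Tadd[symmetric])
qed

text \<open>
  If \<open>x\<close> satisfies the adjoint equation \<open>x \<bullet> B d = - (g \<bullet> d)\<close> on \<open>D\<close>, then \<open>x\<close> lies in the domain of the
  closure of \<open>B\<close>. The mean value theorem bounds the difference quotients by \<open>\<parallel>g\<parallel>\<close>, as their
  pairings with \<open>D\<close> are values of \<open>T z g \<bullet> d\<close>; they converge weakly to \<open>g\<close>, hence strongly by
  \<open>weak_to_strong\<close>. For translations this says that weak derivatives are limits of difference quotients.
\<close>
lemma weak_generator_imp_strong:
  assumes g: "\<And>d. d \<in> D \<Longrightarrow> x \<bullet> B d = - (g \<bullet> d)"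
  shows "((\<lambda>s. T s x) has_vector_derivative T r g) (at r)"
proof (rule shift_vector_derivative)
  define q where "q h = (T h x - x) /\<^sub>R h" for h
  have bd: "norm (q h) \<le> norm g" if h: "h \<noteq> 0" for h
  proof (rule norm_le_total[OF D(1,2)])
    fix d assume d: "d \<in> D"
    have "\<exists>z. T h x \<bullet> d - T 0 x \<bullet> d = h * (T z g \<bullet> d)"
    proof (cases "h > 0")
      case True
      show ?thesis
        using MVT2[OF True, of "\<lambda>s. T s x \<bullet> d" "\<lambda>s. T s g \<bullet> d"] inner_T_derivative[OF d g] by auto
    next
      case False
      then have "h < 0" using h by simp
      then have "\<exists>z>h. z < 0 \<and> T 0 x \<bullet> d - T h x \<bullet> d = (0 - h) * (T z g \<bullet> d)"
        by (rule MVT2) (rule inner_T_derivative[OF d g])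
      then obtain z where "T 0 x \<bullet> d - T h x \<bullet> d = (0 - h) * (T z g \<bullet> d)" by blast
      then show ?thesis by (intro exI[of _ z]) (simp add: algebra_simps)
    qed
    then obtain z where "T h x \<bullet> d - T 0 x \<bullet> d = h * (T z g \<bullet> d)" by blast
    then have "q h \<bullet> d = T z g \<bullet> d" using h by (simp add: q_def T0 inner_simps)
    then show "\<bar>q h \<bullet> d\<bar> \<le> norm g * norm d"
      using Cauchy_Schwarz_ineq2[of "T z g" d] by (simp add: iso)
  qed simp
  have lim: "((\<lambda>h. q h \<bullet> d) \<longlongrightarrow> g \<bullet> d) (at 0)" if d: "d \<in> D" for d
    using inner_T_derivative[OF d g, of 0]
    by (simp add: DERIV_def T0 q_def inner_simps divide_inverse_commute)
  have ev: "\<forall>\<^sub>F h in at 0. norm (q h) \<le> norm g"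
    using bd by (auto simp: eventually_at_filter)
  have "(q \<longlongrightarrow> g) (at 0)"
    by (rule weak_to_strong[where q = q, OF ev weak_limit_total[where q = q and g = g, OF D(1,2) ev lim]])
  then show "((\<lambda>s. T s x) has_vector_derivative g) (at 0)"
    unfolding has_vector_derivative_iff_quotient T0 add_0 q_def[abs_def] .
qed

lemma moving_vector_derivative:
  assumes P: "(P has_vector_derivative p) (at t)"
    and T: "((\<lambda>s. T s (P t)) has_vector_derivative g) (at (\<sigma> t))"
    and \<sigma>: "(\<sigma> has_real_derivative \<sigma>') (at t)"
  shows "((\<lambda>t. T (\<sigma> t) (P t)) has_vector_derivative \<sigma>' *\<^sub>R g + T (\<sigma> t) p) (at t)"
proof -
  have sc: "((\<lambda>h. \<sigma> (t + h)) \<longlongrightarrow> \<sigma> t) (at 0)"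
    using DERIV_isCont[OF \<sigma>] by (simp add: isCont_iff)
  have a: "((\<lambda>h. (T (\<sigma> (t + h)) (P t) - T (\<sigma> t) (P t)) /\<^sub>R h) \<longlongrightarrow> \<sigma>' *\<^sub>R g) (at 0)"
    using vector_diff_chain_at[OF \<sigma>[unfolded has_real_derivative_iff_has_vector_derivative] T]
    unfolding has_vector_derivative_iff_quotient o_def .
  have q: "((\<lambda>h. (P (t + h) - P t) /\<^sub>R h) \<longlongrightarrow> p) (at 0)"
    using P unfolding has_vector_derivative_iff_quotient .
  have cont: "isCont (\<lambda>s. T s p) (\<sigma> t)" unfolding isCont_def by (rule T_tendsto)
  have b: "((\<lambda>h. T (\<sigma> (t + h)) ((P (t + h) - P t) /\<^sub>R h)) \<longlongrightarrow> T (\<sigma> t) p) (at 0)"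
  proof -
    have "((\<lambda>h. T (\<sigma> (t + h)) ((P (t + h) - P t) /\<^sub>R h) - T (\<sigma> t) p) \<longlongrightarrow> 0) (at 0)"
    proof (rule Lim_null_comparison)
      show "\<forall>\<^sub>F h in at 0. norm (T (\<sigma> (t + h)) ((P (t + h) - P t) /\<^sub>R h) - T (\<sigma> t) p)
        \<le> norm ((P (t + h) - P t) /\<^sub>R h - p) + norm (T (\<sigma> (t + h)) p - T (\<sigma> t) p)"
      proof (intro always_eventually allI)
        fix h
        have "T (\<sigma> (t + h)) ((P (t + h) - P t) /\<^sub>R h) - T (\<sigma> t) p
          = T (\<sigma> (t + h)) ((P (t + h) - P t) /\<^sub>R h - p) + (T (\<sigma> (t + h)) p - T (\<sigma> t) p)"
          by (simp only: linear_diff[OF lin] add_diff_eq diff_add_cancel)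
        also have "norm \<dots> \<le> norm (T (\<sigma> (t + h)) ((P (t + h) - P t) /\<^sub>R h - p)) + norm (T (\<sigma> (t + h)) p - T (\<sigma> t) p)"
          by (rule norm_triangle_ineq)
        finally show "norm (T (\<sigma> (t + h)) ((P (t + h) - P t) /\<^sub>R h) - T (\<sigma> t) p)
        \<le> norm ((P (t + h) - P t) /\<^sub>R h - p) + norm (T (\<sigma> (t + h)) p - T (\<sigma> t) p)" by (simp only: iso)
      qed
      have "((\<lambda>h. norm ((P (t + h) - P t) /\<^sub>R h - p) + norm (T (\<sigma> (t + h)) p - T (\<sigma> t) p)) \<longlongrightarrow> norm (p - p) + norm (T (\<sigma> t) p - T (\<sigma> t) p)) (at 0)"
        by (intro tendsto_add tendsto_norm tendsto_diff q tendsto_const isCont_tendsto_compose[OF cont sc])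
      then show "((\<lambda>h. norm ((P (t + h) - P t) /\<^sub>R h - p) + norm (T (\<sigma> (t + h)) p - T (\<sigma> t) p)) \<longlongrightarrow> 0) (at 0)" by simp
    qed
    then show ?thesis by (rule LIM_zero_cancel)
  qed
  show ?thesis
    unfolding has_vector_derivative_iff_quotient
  proof (rule Lim_transform_eventually[OF tendsto_add[OF a b]])
    show "\<forall>\<^sub>F h in at 0. (T (\<sigma> (t + h)) (P t) - T (\<sigma> t) (P t)) /\<^sub>R h + T (\<sigma> (t + h)) ((P (t + h) - P t) /\<^sub>R h)
       = (T (\<sigma> (t + h)) (P (t + h)) - T (\<sigma> t) (P t)) /\<^sub>R h"
      by (intro always_eventually allI) (simp add: linear_diff[OF lin] linear_scale[OF lin] scaleR_diff_right)
  qed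
qed

end

text \<open>
  The product rule for a curve \<open>u\<close> that is only norm continuous and whose pairing is differentiable
  only against the one vector \<open>\<Phi> t\<close>: a weak solution can be tested with a moving test vector.
\<close>
lemma inner_moving_derivative:
  fixes u \<Phi> :: "real \<Rightarrow> 'a::real_inner"
  assumes u: "(u \<longlongrightarrow> u t) (at t)" and d: "((\<lambda>s. u s \<bullet> \<Phi> t) has_real_derivative d) (at t)"
    and P: "(\<Phi> has_vector_derivative p) (at t)"
  shows "((\<lambda>s. u s \<bullet> \<Phi> s) has_real_derivative d + u t \<bullet> p) (at t)"
proof -
  have q: "((\<lambda>h. (\<Phi> (t + h) - \<Phi> t) /\<^sub>R h) \<longlongrightarrow> p) (at 0)"
    using P unfolding has_vector_derivative_iff_quotient .
  have u': "((\<lambda>h. u (t + h)) \<longlongrightarrow> u t) (at 0)" using u by (rule LIM_offset_zero)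
  have d': "((\<lambda>h. (u (t + h) \<bullet> \<Phi> t - u t \<bullet> \<Phi> t) / h) \<longlongrightarrow> d) (at 0)" using d by (simp add: DERIV_def)
  show ?thesis
    unfolding DERIV_def
  proof (rule Lim_transform_eventually[OF tendsto_add[OF d' tendsto_inner[OF u' q]]])
    show "\<forall>\<^sub>F h in at 0. (u (t + h) \<bullet> \<Phi> t - u t \<bullet> \<Phi> t) / h + u (t + h) \<bullet> ((\<Phi> (t + h) - \<Phi> t) /\<^sub>R h)
       = (u (t + h) \<bullet> \<Phi> (t + h) - u t \<bullet> \<Phi> t) / h"
      by (intro always_eventually allI) (simp add: inner_diff_right divide_inverse algebra_simps)
  qed
qed

section \<open>Weak solutions for a non-negative self-adjoint operator\<close>

text \<open>
  \<open>\<Gamma>\<close> is the graph of the operator, and \<open>J\<close> plays the role of multiplication by the imaginary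
  unit on a complex Hilbert space regarded as a real one. Symmetry together with the range condition
  \<open>onto\<close> is self-adjointness.
\<close>
locale selfadjoint_graph =
  fixes \<Gamma> :: "('a::{real_inner,complete_space} \<times> 'a) set" and J :: "'a \<Rightarrow> 'a"
  assumes J_linear: "linear J"
    and J_norm: "norm (J x) = norm x"
    and J_anti: "J x \<bullet> y = - (x \<bullet> J y)"
    and sub: "subspace \<Gamma>"
    and J_graph: "(\<phi>, w) \<in> \<Gamma> \<Longrightarrow> (J \<phi>, J w) \<in> \<Gamma>"
    and sym: "(\<phi>, w) \<in> \<Gamma> \<Longrightarrow> (\<phi>', w') \<in> \<Gamma> \<Longrightarrow> w \<bullet> \<phi>' = \<phi> \<bullet> w'"
    and nonneg: "(\<phi>, w) \<in> \<Gamma> \<Longrightarrow> 0 \<le> w \<bullet> \<phi>"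
    and single: "(0, w) \<in> \<Gamma> \<Longrightarrow> w = 0"
    and onto: "\<epsilon> > 0 \<Longrightarrow> \<exists>\<phi> w. (\<phi>, w) \<in> \<Gamma> \<and> \<phi> + \<epsilon> *\<^sub>R w = g"
begin

definition resolvent :: "real \<Rightarrow> 'a \<Rightarrow> 'a" where
  "resolvent \<epsilon> g = (SOME \<phi>. (\<phi>, (g - \<phi>) /\<^sub>R \<epsilon>) \<in> \<Gamma>)"

text \<open>
  The operator applied to the resolvent; a bounded operator that commutes with \<open>J\<close> and with \<open>resolvent \<epsilon>\<close>.
\<close>
definition bdd_op :: "real \<Rightarrow> 'a \<Rightarrow> 'a" where
  "bdd_op \<epsilon> g = (g - resolvent \<epsilon> g) /\<^sub>R \<epsilon>"

lemma resolvent_graph: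
  assumes "\<epsilon> > 0" shows "(resolvent \<epsilon> g, bdd_op \<epsilon> g) \<in> \<Gamma>"
proof -
  obtain \<phi> w where "(\<phi>, w) \<in> \<Gamma>" "\<phi> + \<epsilon> *\<^sub>R w = g" using onto[OF assms] by blast
  moreover from this(2) have "(g - \<phi>) /\<^sub>R \<epsilon> = w" using assms by auto
  ultimately have "(\<phi>, (g - \<phi>) /\<^sub>R \<epsilon>) \<in> \<Gamma>" by simp
  then have "\<exists>\<phi>. (\<phi>, (g - \<phi>) /\<^sub>R \<epsilon>) \<in> \<Gamma>" by blast
  then show ?thesis unfolding bdd_op_def resolvent_def by (rule someI_ex)
qed

lemma resolvent_eq: "\<epsilon> > 0 \<Longrightarrow> resolvent \<epsilon> g + \<epsilon> *\<^sub>R bdd_op \<epsilon> g = g"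
  by (simp add: bdd_op_def)

lemma resolvent_norm: assumes "\<epsilon> > 0" shows "norm (resolvent \<epsilon> g) \<le> norm g"
proof -
  have "(norm (resolvent \<epsilon> g))\<^sup>2 \<le> resolvent \<epsilon> g \<bullet> resolvent \<epsilon> g + \<epsilon> * (bdd_op \<epsilon> g \<bullet> resolvent \<epsilon> g)"
    using nonneg[OF resolvent_graph[OF assms, of g]] assms by (simp add: power2_norm_eq_inner)
  also have "\<dots> = g \<bullet> resolvent \<epsilon> g"
    using resolvent_eq[OF assms, of g] by (metis inner_add_left inner_scaleR_left)
  also have "\<dots> \<le> norm g * norm (resolvent \<epsilon> g)" by (rule norm_cauchy_schwarz)
  finally show ?thesis
    by (cases "resolvent \<epsilon> g = 0") (auto simp: power2_eq_square mult_le_cancel_right)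
qed

lemma resolvent_unique:
  assumes e: "\<epsilon> > 0" and "(\<phi>, w) \<in> \<Gamma>" "\<phi> + \<epsilon> *\<^sub>R w = g"
  shows "resolvent \<epsilon> g = \<phi>"
proof -
  let ?d = "resolvent \<epsilon> g - \<phi>" and ?v = "bdd_op \<epsilon> g - w"
  have "(?d, ?v) \<in> \<Gamma>"
    using subspace_diff[OF sub resolvent_graph[OF e, of g] assms(2)] by simp
  then have "0 \<le> ?v \<bullet> ?d" by (rule nonneg)
  moreover have "?d = - (\<epsilon> *\<^sub>R ?v)"
    using resolvent_eq[OF e, of g] assms(3) by (simp add: algebra_simps)
  then have "?d \<bullet> ?d = - \<epsilon> * (?v \<bullet> ?d)" by (metis inner_minus_left inner_scaleR_left mult_minus_left)
  ultimately have "?d \<bullet> ?d \<le> 0" using e by (simp add: mult_nonneg_nonneg)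
  then have "?d = 0" by (meson inner_gt_zero_iff not_less)
  then show ?thesis by simp
qed

lemma resolvent_sym:
  assumes "\<epsilon> > 0" shows "resolvent \<epsilon> g \<bullet> h = g \<bullet> resolvent \<epsilon> h"
proof -
  have "resolvent \<epsilon> g \<bullet> (resolvent \<epsilon> h + \<epsilon> *\<^sub>R bdd_op \<epsilon> h) = (resolvent \<epsilon> g + \<epsilon> *\<^sub>R bdd_op \<epsilon> g) \<bullet> resolvent \<epsilon> h"
    using sym[OF resolvent_graph[OF assms, of g] resolvent_graph[OF assms, of h]]
    by (simp add: inner_add_left inner_add_right)
  then show ?thesis using assms by (simp add: resolvent_eq)
qed

lemma resolvent_J:
  assumes "\<epsilon> > 0" shows "resolvent \<epsilon> (J g) = J (resolvent \<epsilon> g)"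
proof (rule resolvent_unique[OF assms J_graph[OF resolvent_graph[OF assms]]])
  show "J (resolvent \<epsilon> g) + \<epsilon> *\<^sub>R J (bdd_op \<epsilon> g) = J g"
    using resolvent_eq[OF assms, of g] by (metis J_linear linear_add linear_scale)
qed

lemma bdd_op_sym: "\<epsilon> > 0 \<Longrightarrow> bdd_op \<epsilon> g \<bullet> h = g \<bullet> bdd_op \<epsilon> h"
  by (simp add: bdd_op_def inner_diff_left inner_diff_right resolvent_sym)

lemma bdd_op_J: "\<epsilon> > 0 \<Longrightarrow> bdd_op \<epsilon> (J g) = J (bdd_op \<epsilon> g)"
  by (simp add: bdd_op_def resolvent_J linear_diff[OF J_linear] linear_scale[OF J_linear])

lemma bdd_op_norm: assumes "\<epsilon> > 0" shows "norm (bdd_op \<epsilon> g) \<le> 2 / \<epsilon> * norm g"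
proof -
  have "norm (g - resolvent \<epsilon> g) \<le> 2 * norm g"
    using norm_triangle_ineq4[of g "resolvent \<epsilon> g"] resolvent_norm[OF assms, of g] by linarith
  then show ?thesis using assms by (simp add: bdd_op_def divide_inverse_commute mult.commute mult_left_mono mult.left_commute)
qed

text \<open>
  The operator \<open>bdd_op \<epsilon> \<circ> resolvent \<epsilon>\<close> is symmetric and commutes with \<open>J\<close>, whereas \<open>J\<close> is antisymmetric, so
  the pairing equals its own negative. This is the infinitesimal form of norm conservation.
\<close>
lemma J_orthogonal:
  assumes e: "\<epsilon> > 0" shows "J x \<bullet> bdd_op \<epsilon> (resolvent \<epsilon> x) = 0"
proof -
  have R: "bdd_op \<epsilon> (resolvent \<epsilon> v) = resolvent \<epsilon> (bdd_op \<epsilon> v)" for v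
  proof (rule resolvent_unique[OF e, symmetric])
    show "(bdd_op \<epsilon> (resolvent \<epsilon> v), (bdd_op \<epsilon> v - bdd_op \<epsilon> (resolvent \<epsilon> v)) /\<^sub>R \<epsilon>) \<in> \<Gamma>"
      using subspace_scale[OF sub subspace_diff[OF sub resolvent_graph[OF e, of v] resolvent_graph[OF e, of "resolvent \<epsilon> v"]], of "inverse \<epsilon>"]
      by (simp add: bdd_op_def)
  qed (use e in simp)
  let ?S = "\<lambda>v. bdd_op \<epsilon> (resolvent \<epsilon> v)"
  have "J x \<bullet> ?S x = - (x \<bullet> ?S (J x))" by (simp only: J_anti resolvent_J[OF e] bdd_op_J[OF e])
  also have "\<dots> = - (?S x \<bullet> J x)" by (simp only: bdd_op_sym[OF e] resolvent_sym[OF e] R)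
  finally show ?thesis by (simp add: inner_commute)
qed

lemma domain_total: "total_set (fst ` \<Gamma>)"
  unfolding total_set_def
proof (intro allI impI)
  fix x assume x: "\<forall>d\<in>fst ` \<Gamma>. x \<bullet> d = 0"
  have "x \<bullet> resolvent 1 x = 0" using x resolvent_graph[of 1 x] by force
  moreover have "x \<bullet> resolvent 1 x = resolvent 1 x \<bullet> resolvent 1 x + bdd_op 1 x \<bullet> resolvent 1 x"
    using resolvent_eq[of 1 x] by (metis inner_add_left scaleR_one zero_less_one)
  ultimately have "resolvent 1 x \<bullet> resolvent 1 x \<le> 0"
    using nonneg[OF resolvent_graph[of 1 x]] by simp
  then have "resolvent 1 x = 0" by (meson inner_gt_zero_iff not_less)
  then show "x = 0" using resolvent_graph[of 1 x] single by (simp add: bdd_op_def)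
qed

lemma domain_subspace: "subspace (fst ` \<Gamma>)"
  by (rule linear_subspace_image[OF linear_fst sub])

text \<open>
  Paired with a vector of the domain, \<open>resolvent \<epsilon> g - g\<close> is of order \<open>\<epsilon>\<close>, which gives weak convergence
  as the domain is total; the resolvents are contractions, so the convergence is strong.
\<close>
lemma resolvent_tendsto: "(\<lambda>k. resolvent (inverse (real (Suc k))) g) \<longlonglongrightarrow> g"
proof (rule weak_to_strong)
  show ev: "\<forall>\<^sub>F k in sequentially. norm (resolvent (inverse (real (Suc k))) g) \<le> norm g"
    by (intro always_eventually allI resolvent_norm) simp
  have "(\<lambda>k. resolvent (inverse (real (Suc k))) g \<bullet> d) \<longlonglongrightarrow> g \<bullet> d" if d: "d \<in> fst ` \<Gamma>" for d
  proof -
    obtain w where dw: "(d, w) \<in> \<Gamma>" using d by auto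
    have eq: "resolvent \<epsilon> g \<bullet> d = g \<bullet> d - \<epsilon> * (resolvent \<epsilon> g \<bullet> w)" if "\<epsilon> > 0" for \<epsilon>
    proof -
      have "bdd_op \<epsilon> g \<bullet> d = resolvent \<epsilon> g \<bullet> w" using sym[OF resolvent_graph[OF that] dw] .
      then show ?thesis using resolvent_eq[OF that, of g]
        by (metis add_diff_cancel_right' inner_add_left inner_scaleR_left)
    qed
    have "(\<lambda>k. inverse (real (Suc k)) * (resolvent (inverse (real (Suc k))) g \<bullet> w)) \<longlonglongrightarrow> 0"
    proof (rule Lim_null_comparison)
      show "\<forall>\<^sub>F k in sequentially. norm (inverse (real (Suc k)) * (resolvent (inverse (real (Suc k))) g \<bullet> w))
        \<le> inverse (real (Suc k)) * (norm g * norm w)"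
      proof (intro always_eventually allI)
        fix k
        have "\<bar>resolvent (inverse (real (Suc k))) g \<bullet> w\<bar> \<le> norm (resolvent (inverse (real (Suc k))) g) * norm w"
          by (rule Cauchy_Schwarz_ineq2)
        also have "\<dots> \<le> norm g * norm w" by (intro mult_right_mono resolvent_norm) auto
        finally show "norm (inverse (real (Suc k)) * (resolvent (inverse (real (Suc k))) g \<bullet> w))
          \<le> inverse (real (Suc k)) * (norm g * norm w)" by (simp add: abs_mult mult_left_mono)
      qed
      show "(\<lambda>k. inverse (real (Suc k)) * (norm g * norm w)) \<longlonglongrightarrow> 0"
        using tendsto_mult[OF LIMSEQ_inverse_real_of_nat tendsto_const, of "norm g * norm w"] by simp
    qed
    then have "(\<lambda>k. g \<bullet> d - inverse (real (Suc k)) * (resolvent (inverse (real (Suc k))) g \<bullet> w)) \<longlonglongrightarrow> g \<bullet> d - 0"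
      by (intro tendsto_intros)
    then show ?thesis by (simp add: eq)
  qed
  then show "(\<lambda>k. resolvent (inverse (real (Suc k))) g \<bullet> g) \<longlonglongrightarrow> g \<bullet> g"
    using weak_limit_total[where q = "\<lambda>k. resolvent (inverse (real (Suc k))) g" and g = g,
        OF domain_subspace domain_total ev] by blast
qed

definition weak_solution :: "real set \<Rightarrow> (real \<Rightarrow> 'a) \<Rightarrow> bool" where
  "weak_solution I u \<longleftrightarrow> (\<forall>\<phi> w. (\<phi>, w) \<in> \<Gamma> \<longrightarrow>
     (\<forall>t\<in>I. ((\<lambda>s. u s \<bullet> \<phi>) has_real_derivative J (u t) \<bullet> w) (at t)))"

text \<open>
  The resolvent takes values in the domain, so the equation may be tested with it; the derivative involves
  only the bounded operator \<open>bdd_op \<epsilon>\<close>.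
\<close>
lemma resolvent_lipschitz:
  assumes ws: "weak_solution I u" and e: "\<epsilon> > 0" and I: "{a..b} \<subseteq> I" "a < b"
    and K: "\<And>t. t \<in> {a..b} \<Longrightarrow> norm (u t) \<le> K"
  shows "norm (resolvent \<epsilon> (u b) - resolvent \<epsilon> (u a)) \<le> 2 / \<epsilon> * K * (b - a)"
proof -
  let ?d = "resolvent \<epsilon> (u b) - resolvent \<epsilon> (u a)"
  have "norm (u a) \<le> K" using K[of a] I(2) by simp
  then have K0: "K \<ge> 0" using norm_ge_zero[of "u a"] by linarith
  have D: "((\<lambda>s. u s \<bullet> resolvent \<epsilon> ?d) has_real_derivative J (u t) \<bullet> bdd_op \<epsilon> ?d) (at t)" if "t \<in> {a..b}" for t
    using ws resolvent_graph[OF e] that I unfolding weak_solution_def by blast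
  obtain z where z: "a < z" "z < b"
    "u b \<bullet> resolvent \<epsilon> ?d - u a \<bullet> resolvent \<epsilon> ?d = (b - a) * (J (u z) \<bullet> bdd_op \<epsilon> ?d)"
    using MVT2[OF I(2), of "\<lambda>s. u s \<bullet> resolvent \<epsilon> ?d" "\<lambda>t. J (u t) \<bullet> bdd_op \<epsilon> ?d"] D by auto
  have "?d \<bullet> ?d = (b - a) * (J (u z) \<bullet> bdd_op \<epsilon> ?d)"
    using z(3) by (simp add: resolvent_sym[OF e, symmetric] inner_diff_left)
  also have "\<dots> \<le> (b - a) * (K * (2 / \<epsilon> * norm ?d))"
  proof (intro mult_left_mono)
    have "J (u z) \<bullet> bdd_op \<epsilon> ?d \<le> norm (J (u z)) * norm (bdd_op \<epsilon> ?d)" by (rule norm_cauchy_schwarz)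
    also have "\<dots> \<le> K * (2 / \<epsilon> * norm ?d)"
      using K[of z] z bdd_op_norm[OF e, of ?d] K0 by (intro mult_mono) (auto simp: J_norm)
    finally show "J (u z) \<bullet> bdd_op \<epsilon> ?d \<le> K * (2 / \<epsilon> * norm ?d)" .
  qed (use I in simp)
  finally have "norm ?d * norm ?d \<le> (2 / \<epsilon> * K * (b - a)) * norm ?d"
    by (simp add: power2_norm_eq_inner[symmetric] power2_eq_square algebra_simps)
  moreover have "0 \<le> 2 / \<epsilon> * K * (b - a)" using e K0 I by simp
  ultimately show ?thesis by (rule norm_le_cancel)
qed

text \<open>
  By the Lipschitz bound the squared increment of \<open>y = resolvent \<epsilon> \<circ> u\<close> is negligible, and the linear part
  \<open>2 (y (t + h) - y t) \<bullet> y t\<close> has derivative zero by \<open>J_orthogonal\<close>.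
\<close>
lemma resolvent_norm_derivative:
  assumes ws: "weak_solution I u" and e: "\<epsilon> > 0" and I: "open I" "t \<in> I"
    and K: "\<And>s. s \<in> I \<Longrightarrow> dist s t < \<delta> \<Longrightarrow> norm (u s) \<le> K" and d: "\<delta> > 0"
  shows "((\<lambda>s. (norm (resolvent \<epsilon> (u s)))\<^sup>2) has_real_derivative 0) (at t)"
proof -
  define y where "y s = resolvent \<epsilon> (u s)" for s
  obtain r where r: "r > 0" "ball t r \<subseteq> I" using I open_contains_ball by blast
  define r' where "r' = min r \<delta>"
  have r': "r' > 0" using r d by (simp add: r'_def)
  define L where "L = 2 / \<epsilon> * K"
  have lip: "norm (y (t + h) - y t) \<le> L * \<bar>h\<bar>" if h: "\<bar>h\<bar> < r'" for h
  proof -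
    have sub: "s \<in> I \<and> dist s t < \<delta>" if "\<bar>s - t\<bar> \<le> \<bar>h\<bar>" for s
      using that h r by (auto simp: r'_def dist_real_def abs_minus_commute subset_iff)
    consider "h > 0" | "h = 0" | "h < 0" by linarith
    then show ?thesis
    proof cases
      case 1
      have "{t..t + h} \<subseteq> I" "\<And>s. s \<in> {t..t+h} \<Longrightarrow> norm (u s) \<le> K"
        using sub K 1 by (auto intro!: K simp: abs_le_iff)
      from resolvent_lipschitz[OF ws e this(1) _ this(2)] 1 show ?thesis by (simp add: y_def L_def)
    next
      case 3
      have "{t + h..t} \<subseteq> I" "\<And>s. s \<in> {t+h..t} \<Longrightarrow> norm (u s) \<le> K"
        using sub K 3 by (auto intro!: K simp: abs_le_iff)
      from resolvent_lipschitz[OF ws e this(1) _ this(2)] 3 show ?thesis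
        by (simp add: y_def L_def norm_minus_commute)
    qed simp
  qed
  have "((\<lambda>s. u s \<bullet> resolvent \<epsilon> (y t)) has_real_derivative J (u t) \<bullet> bdd_op \<epsilon> (y t)) (at t)"
    using ws resolvent_graph[OF e] I unfolding weak_solution_def by blast
  moreover have "J (u t) \<bullet> bdd_op \<epsilon> (y t) = 0"
    unfolding y_def by (rule J_orthogonal[OF e])
  ultimately have D: "((\<lambda>s. y s \<bullet> y t) has_real_derivative 0) (at t)"
    by (simp add: y_def resolvent_sym[OF e])
  have "(\<lambda>h. ((norm (y (t + h)))\<^sup>2 - (norm (y t))\<^sup>2) / h) \<midarrow>0\<rightarrow> 2 * 0 + 0"
  proof -
    have eq: "((norm (y (t + h)))\<^sup>2 - (norm (y t))\<^sup>2) / h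
       = 2 * ((y (t + h) \<bullet> y t - y t \<bullet> y t) / h) + (norm (y (t + h) - y t))\<^sup>2 / h" for h
      by (simp add: power2_norm_eq_inner inner_diff_left inner_diff_right inner_commute add_divide_distrib[symmetric]
           diff_divide_distrib[symmetric])
    have "(\<lambda>h. (norm (y (t + h) - y t))\<^sup>2 / h) \<midarrow>0\<rightarrow> 0"
    proof (rule Lim_null_comparison)
      have "norm ((norm (y (t + h) - y t))\<^sup>2 / h) \<le> L\<^sup>2 * \<bar>h\<bar>" if "h \<noteq> 0" "\<bar>h\<bar> < r'" for h
      proof -
        have "(norm (y (t + h) - y t))\<^sup>2 \<le> (L * \<bar>h\<bar>)\<^sup>2" using lip[OF that(2)] by (intro power_mono) auto
        then have "(norm (y (t + h) - y t))\<^sup>2 / \<bar>h\<bar> \<le> (L * \<bar>h\<bar>)\<^sup>2 / \<bar>h\<bar>" by (intro divide_right_mono) auto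
        then show ?thesis using that by (simp add: power_mult_distrib power2_eq_square)
      qed
      then show "\<forall>\<^sub>F h in at 0. norm ((norm (y (t + h) - y t))\<^sup>2 / h) \<le> L\<^sup>2 * \<bar>h\<bar>"
        unfolding eventually_at using r' by (intro exI[of _ r']) (auto simp: dist_real_def)
      have "(\<lambda>h. L\<^sup>2 * \<bar>h\<bar>) \<midarrow>0\<rightarrow> L\<^sup>2 * \<bar>0\<bar>" by (intro tendsto_intros)
      then show "(\<lambda>h. L\<^sup>2 * \<bar>h\<bar>) \<midarrow>0\<rightarrow> 0" by simp
    qed
    moreover have "(\<lambda>h. (y (t + h) \<bullet> y t - y t \<bullet> y t) / h) \<midarrow>0\<rightarrow> 0" using D by (simp add: DERIV_def)
    ultimately show ?thesis unfolding eq by (intro tendsto_intros)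
  qed
  then show ?thesis by (simp add: DERIV_def y_def)
qed

text \<open>
  Only the norm of \<open>resolvent \<epsilon> (u s)\<close> can be differentiated directly; for \<open>u\<close> itself let \<open>\<epsilon>\<close> tend to \<open>0\<close>.
\<close>
lemma norm_conserved:
  assumes ws: "weak_solution I u" and I: "open I" "convex I"
    and loc: "\<And>t. t \<in> I \<Longrightarrow> \<exists>\<delta>>0. \<exists>K. \<forall>s\<in>I. dist s t < \<delta> \<longrightarrow> norm (u s) \<le> K"
    and st: "s \<in> I" "t \<in> I"
  shows "\<epsilon> > 0 \<Longrightarrow> norm (resolvent \<epsilon> (u s)) = norm (resolvent \<epsilon> (u t))" and "norm (u s) = norm (u t)"
proof -
  show R: "norm (resolvent \<epsilon> (u s)) = norm (resolvent \<epsilon> (u t))" if e: "\<epsilon> > 0" for \<epsilon>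
  proof -
    have "((\<lambda>s. (norm (resolvent \<epsilon> (u s)))\<^sup>2) has_real_derivative 0) (at r within I)" if r: "r \<in> I" for r
    proof -
      obtain \<delta> K where "\<delta> > 0" "\<And>s. s \<in> I \<Longrightarrow> dist s r < \<delta> \<Longrightarrow> norm (u s) \<le> K"
        using loc[OF r] by blast
      from resolvent_norm_derivative[OF ws e I(1) r this(2,1)] show ?thesis
        by (rule has_field_derivative_at_within)
    qed
    then obtain c where "\<forall>x\<in>I. (norm (resolvent \<epsilon> (u x)))\<^sup>2 = c"
      using has_field_derivative_zero_constant[OF I(2)] by blast
    then have "(norm (resolvent \<epsilon> (u s)))\<^sup>2 = (norm (resolvent \<epsilon> (u t)))\<^sup>2" using st by simp
    then show ?thesis by simp
  qed
  have inverse_real_of_nat_pos: "inverse (real (Suc k)) > 0" for k by simp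
  have "(\<lambda>k. norm (resolvent (inverse (real (Suc k))) (u s))) \<longlonglongrightarrow> norm (u s)"
    by (intro tendsto_norm resolvent_tendsto)
  moreover have "(\<lambda>k. norm (resolvent (inverse (real (Suc k))) (u s))) \<longlonglongrightarrow> norm (u t)"
    unfolding R[OF inverse_real_of_nat_pos] by (intro tendsto_norm resolvent_tendsto)
  ultimately show "norm (u s) = norm (u t)" by (rule LIMSEQ_unique)
qed

text \<open>
  Let \<open>y\<close> be the resolvent of \<open>v\<close> and \<open>c\<close> its constant norm. For fixed \<open>r\<close> the pairing \<open>y (s k) \<bullet> y r\<close> tends to \<open>0\<close>,
  while it equals \<open>c\<^sup>2 - \<parallel>y r - y (s k)\<parallel>\<^sup>2 / 2\<close>, which by the Lipschitz bound is at least
  \<open>c\<^sup>2 - (2 K r)\<^sup>2 / 2\<close>. Letting \<open>r\<close> tend to \<open>0\<close> gives \<open>c = 0\<close>.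
\<close>
lemma weak_solution_vanishes:
  assumes ws: "weak_solution {0<..} v" and K: "\<And>t. t > 0 \<Longrightarrow> norm (v t) \<le> K"
    and s: "\<And>k. s k > 0" "s \<longlonglongrightarrow> 0"
    and lim: "\<And>\<phi> w. (\<phi>, w) \<in> \<Gamma> \<Longrightarrow> (\<lambda>k. v (s k) \<bullet> \<phi>) \<longlonglongrightarrow> 0"
    and t: "t > 0"
  shows "v t = 0"
proof -
  define y where "y t = resolvent 1 (v t)" for t
  have one: "(0::real) < 1" by simp
  have loc: "\<exists>\<delta>>0. \<exists>K. \<forall>s\<in>{0<..}. dist s t < \<delta> \<longrightarrow> norm (v s) \<le> K" for t
    using K by (intro exI[of _ "1::real"] conjI exI[of _ K]) auto
  have const: "norm (y r) = norm (y t)" if "r > 0" for r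
    unfolding y_def by (rule norm_conserved(1)[OF ws _ _ loc]) (use that t in auto)
  have small: "(norm (y t))\<^sup>2 \<le> 1/2 * (2 * K * r)\<^sup>2" if r: "r > 0" for r
  proof -
    have K0: "K \<ge> 0" using K[OF one] norm_ge_zero[of "v 1"] by linarith
    have "(\<lambda>k. v (s k) \<bullet> resolvent 1 (y r)) \<longlonglongrightarrow> 0" using lim resolvent_graph[OF one] by blast
    then have l: "(\<lambda>k. y (s k) \<bullet> y r) \<longlonglongrightarrow> 0" by (simp add: y_def resolvent_sym)
    have "\<forall>\<^sub>F k in sequentially. (norm (y t))\<^sup>2 \<le> y (s k) \<bullet> y r + 1/2 * (2 * K * r)\<^sup>2"
      using order_tendstoD(2)[OF s(2) r]
    proof eventually_elim
      case (elim k)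
      have "norm (y r - y (s k)) \<le> 2 / 1 * K * (r - s k)"
        unfolding y_def using s(1)[of k] elim
        by (intro resolvent_lipschitz[OF ws one]) (auto intro!: K)
      also have "\<dots> \<le> 2 * K * r" using s(1)[of k] K0 by (simp add: mult_left_mono)
      finally have "(norm (y r - y (s k)))\<^sup>2 \<le> (2 * K * r)\<^sup>2" by (intro power_mono) auto
      moreover have "(norm (y r - y (s k)))\<^sup>2 = (norm (y t))\<^sup>2 + (norm (y t))\<^sup>2 - 2 * (y (s k) \<bullet> y r)"
        using dot_norm_neg[of "y r" "y (s k)"] unfolding const[OF r] const[OF s(1)[of k]]
        by (simp add: inner_commute)
      ultimately show ?case by simp
    qed
    then have "(norm (y t))\<^sup>2 \<le> 0 + 1/2 * (2 * K * r)\<^sup>2"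
      by (intro tendsto_lowerbound[OF tendsto_add[OF l tendsto_const]]) auto
    then show ?thesis by simp
  qed
  have "((\<lambda>r. 1/2 * (2 * K * r)\<^sup>2) \<longlongrightarrow> 1/2 * (2 * K * 0)\<^sup>2) (at_right 0)"
    by (intro tendsto_intros)
  then have "(norm (y t))\<^sup>2 \<le> 1/2 * (2 * K * 0)\<^sup>2"
    by (rule tendsto_lowerbound) (rule eventually_at_rightI[of 0 1], rule small, auto)
  then have "y t = 0" by simp
  then have "(0, v t) \<in> \<Gamma>" using resolvent_graph[OF one, of "v t"] by (simp add: y_def bdd_op_def)
  then show ?thesis by (rule single)
qed

end

section \<open>Square integrable functions\<close>

lemma L2_function_iff_nn:
  "L2_function \<phi> \<longleftrightarrow> \<phi> \<in> borel_measurable lebesgue \<and> (\<integral>\<^sup>+ x. ennreal ((cmod (\<phi> x))\<^sup>2) \<partial>lebesgue) < \<infinity>"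
  unfolding L2_function_def by (auto simp: integrable_iff_bounded)

lemma L2_measurable [measurable_dest]: "L2_function f \<Longrightarrow> f \<in> borel_measurable lebesgue"
  by (simp add: L2_function_def)

lemma L2_sq_integrable: "L2_function f \<Longrightarrow> integrable lebesgue (\<lambda>x. (cmod (f x))\<^sup>2)"
  by (simp add: L2_function_def)

lemma L2_bound:
  assumes "f \<in> borel_measurable lebesgue" "integrable lebesgue g" "AE x in lebesgue. (cmod (f x))\<^sup>2 \<le> g x"
  shows "L2_function f"
  unfolding L2_function_def
  using assms by (auto intro!: Bochner_Integration.integrable_bound[OF assms(2)] elim: eventually_mono)

lemma L2_zero: "L2_function (\<lambda>x. 0)" by (simp add: L2_function_def)

lemma cmod_add_sq: "(cmod (a + b))\<^sup>2 \<le> 2 * (cmod a)\<^sup>2 + 2 * (cmod b)\<^sup>2"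
proof -
  have "(cmod (a + b))\<^sup>2 \<le> (cmod a + cmod b)\<^sup>2" by (intro power_mono norm_triangle_ineq) simp
  also have "\<dots> \<le> 2 * (cmod a)\<^sup>2 + 2 * (cmod b)\<^sup>2"
    using sum_squares_ge_zero[of "cmod a - cmod b" 0] by (simp add: power2_eq_square algebra_simps)
  finally show ?thesis .
qed

lemma L2_add: assumes "L2_function f" "L2_function g" shows "L2_function (\<lambda>x. f x + g x)"
proof (rule L2_bound)
  show "(\<lambda>x. f x + g x) \<in> borel_measurable lebesgue" using assms by measurable
  show "integrable lebesgue (\<lambda>x. 2 * (cmod (f x))\<^sup>2 + 2 * (cmod (g x))\<^sup>2)"
    using assms by (intro Bochner_Integration.integrable_add integrable_mult_right L2_sq_integrable)
qed (simp add: cmod_add_sq)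

lemma L2_mult:
  assumes m: "m \<in> borel_measurable lebesgue" and b: "\<And>x. cmod (m x) \<le> C" and f: "L2_function f"
  shows "L2_function (\<lambda>x. m x * f x)"
proof (rule L2_bound)
  show "(\<lambda>x. m x * f x) \<in> borel_measurable lebesgue" using m f by measurable
  show "integrable lebesgue (\<lambda>x. C\<^sup>2 * (cmod (f x))\<^sup>2)" using f by (intro integrable_mult_right L2_sq_integrable)
  have "(cmod (m x))\<^sup>2 \<le> C\<^sup>2" for x using b by (intro power_mono) auto
  then show "AE x in lebesgue. (cmod (m x * f x))\<^sup>2 \<le> C\<^sup>2 * (cmod (f x))\<^sup>2"
    by (simp add: norm_mult power_mult_distrib mult_right_mono)
qed

lemma L2_scale: "L2_function f \<Longrightarrow> L2_function (\<lambda>x. c * f x)"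
  by (rule L2_mult[where C = "cmod c"]) auto

lemma L2_scaleR: "L2_function f \<Longrightarrow> L2_function (\<lambda>x. c *\<^sub>R f x)"
  using L2_scale[of f "of_real c"] by (simp add: scaleR_conv_of_real)

lemma L2_minus: "L2_function f \<Longrightarrow> L2_function (\<lambda>x. - f x)"
  using L2_scale[of f "- 1"] by simp

lemma L2_diff: "L2_function f \<Longrightarrow> L2_function g \<Longrightarrow> L2_function (\<lambda>x. f x - g x)"
  using L2_add[of f "\<lambda>x. - g x"] L2_minus[of g] by simp

lemma L2_sum: "(\<And>i. i \<in> I \<Longrightarrow> L2_function (f i)) \<Longrightarrow> L2_function (\<lambda>x. \<Sum>i\<in>I. f i x)"
  by (induction I rule: infinite_finite_induct) (auto simp: L2_zero intro: L2_add)

lemma L2_cmod: "L2_function f \<Longrightarrow> L2_function (\<lambda>x. of_real (cmod (f x)))"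
proof (rule L2_bound[where g = "\<lambda>x. (cmod (f x))\<^sup>2"])
  assume f: "L2_function f"
  then have [measurable]: "f \<in> borel_measurable lebesgue" by (simp add: L2_function_def)
  have "(\<lambda>x. cmod (f x)) \<in> borel_measurable lebesgue" by measurable
  then show "(\<lambda>x. complex_of_real (cmod (f x))) \<in> borel_measurable lebesgue"
    by (rule measurable_compose) (intro borel_measurable_continuous_onI continuous_intros)
  show "integrable lebesgue (\<lambda>x. (cmod (f x))\<^sup>2)" using f by (rule L2_sq_integrable)
qed simp

lemma L2_cong_AE:
  assumes "L2_function f" "g \<in> borel_measurable lebesgue" "AE x in lebesgue. f x = g x"
  shows "L2_function g"
  by (rule L2_bound[OF assms(2) L2_sq_integrable[OF assms(1)]]) (use assms(3) in auto)

lemma cmod_mult_le: "cmod a * cmod b \<le> (cmod a)\<^sup>2 + (cmod b)\<^sup>2"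
proof -
  have "0 \<le> (cmod a - cmod b)\<^sup>2" by simp
  moreover have "0 \<le> (cmod a)\<^sup>2 + (cmod b)\<^sup>2" by simp
  ultimately show ?thesis unfolding power2_diff by linarith
qed

lemma L2_prod_integrable:
  assumes "L2_function f" "L2_function g"
  shows "integrable lebesgue (\<lambda>x. f x * cnj (g x))" "integrable lebesgue (\<lambda>x. f x \<bullet> g x)"
proof -
  have i: "integrable lebesgue (\<lambda>x. (cmod (f x))\<^sup>2 + (cmod (g x))\<^sup>2)"
    using assms by (intro Bochner_Integration.integrable_add L2_sq_integrable)
  have [measurable]: "f \<in> borel_measurable lebesgue" "g \<in> borel_measurable lebesgue"
    using assms by (auto simp: L2_function_def)
  have [measurable]: "cnj \<in> borel_measurable borel"
    by (intro borel_measurable_continuous_onI continuous_intros)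
  show "integrable lebesgue (\<lambda>x. f x * cnj (g x))"
    by (rule Bochner_Integration.integrable_bound[OF i]) (auto simp: norm_mult cmod_mult_le)
  show "integrable lebesgue (\<lambda>x. f x \<bullet> g x)"
  proof (rule Bochner_Integration.integrable_bound[OF i])
    show "AE x in lebesgue. norm (f x \<bullet> g x) \<le> norm ((cmod (f x))\<^sup>2 + (cmod (g x))\<^sup>2)"
    proof (intro AE_I2)
      fix x
      have "norm (f x \<bullet> g x) \<le> cmod (f x) * cmod (g x)" by (simp add: Cauchy_Schwarz_ineq2)
      also have "\<dots> \<le> (cmod (f x))\<^sup>2 + (cmod (g x))\<^sup>2" by (rule cmod_mult_le)
      finally show "norm (f x \<bullet> g x) \<le> norm ((cmod (f x))\<^sup>2 + (cmod (g x))\<^sup>2)" by simp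
    qed
  qed measurable
qed

lemma inner_complex_eq: "z \<bullet> w = Re (z * cnj w)"
  by (simp add: inner_complex_def)

section \<open>The Hilbert space of square integrable functions\<close>

definition l2rel :: "(real^'n::finite \<Rightarrow> complex) \<Rightarrow> (real^'n \<Rightarrow> complex) \<Rightarrow> bool" where
  "l2rel f g \<longleftrightarrow> L2_function f \<and> L2_function g \<and> (AE x in lebesgue. f x = g x)"

text \<open>
  Complex functions are used, but the inner product below is the real part of the complex one. The complex
  structure survives as the isometry \<open>imul\<close>.
\<close>
quotient_type (overloaded) 'n l2 = "real^('n::finite) \<Rightarrow> complex" / partial: l2rel
proof (rule part_equivpI)
  show "\<exists>x. l2rel x x" using L2_zero by (auto simp: l2rel_def)
  show "symp l2rel" by (auto simp: symp_def l2rel_def)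
  show "transp l2rel" by (auto simp: transp_def l2rel_def elim: eventually_elim2)
qed

text \<open>
  \<open>fn\<close> chooses a representative and \<open>cls\<close> forms the class. All statements about \<open>fn\<close> hold almost
  everywhere only.
\<close>
definition fn :: "'n::finite l2 \<Rightarrow> real^'n \<Rightarrow> complex" where
  "fn a = rep_l2 a"
definition cls :: "(real^'n::finite \<Rightarrow> complex) \<Rightarrow> 'n l2" where
  "cls f = abs_l2 f"

lemma L2_fn [simp, intro]: "L2_function (fn a)"
  using Quotient_rep_reflp[OF Quotient_l2, of a] by (simp add: fn_def l2rel_def)

lemma cls_fn [simp]: "cls (fn a) = a"
  using Quotient_abs_rep[OF Quotient_l2, of a] by (simp add: fn_def cls_def)

lemma cls_eq_iff:
  assumes "L2_function f" "L2_function g"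
  shows "cls f = cls g \<longleftrightarrow> (AE x in lebesgue. f x = g x)"
  using Quotient_rel[OF Quotient_l2, of f g] assms by (simp add: cls_def l2rel_def)

lemma fn_cls: "L2_function f \<Longrightarrow> AE x in lebesgue. fn (cls f) x = f x"
  using cls_eq_iff[of "fn (cls f)" f] by simp

lemma cls_cong: "L2_function f \<Longrightarrow> L2_function g \<Longrightarrow> AE x in lebesgue. f x = g x \<Longrightarrow> cls f = cls g"
  by (simp add: cls_eq_iff)

lemma fn_eqI: "AE x in lebesgue. fn a x = fn b x \<Longrightarrow> a = b"
  using cls_eq_iff[of "fn a" "fn b"] by simp

instantiation l2 :: (finite) real_inner
begin

definition "0 = cls (\<lambda>x. 0)"
definition "a + b = cls (\<lambda>x. fn a x + fn b x)"
definition "- a = cls (\<lambda>x. - fn a x)"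
definition "a - b = cls (\<lambda>x. fn a x - fn b x)"
definition "c *\<^sub>R a = cls (\<lambda>x. c *\<^sub>R fn a x)"
definition "inner a b = (LINT x|lebesgue. fn a x \<bullet> fn b x)"
definition norm_l2 :: "'a l2 \<Rightarrow> real" where "norm_l2 a = sqrt (inner a a)"
definition dist_l2 :: "'a l2 \<Rightarrow> 'a l2 \<Rightarrow> real" where "dist_l2 a b = norm (a - b)"
definition sgn_l2 :: "'a l2 \<Rightarrow> 'a l2" where "sgn_l2 a = inverse (norm a) *\<^sub>R a"
definition uniformity_l2 :: "('a l2 \<times> 'a l2) filter" where
  "uniformity_l2 = (INF e\<in>{0<..}. principal {(x, y). dist x y < e})"
definition open_l2 :: "'a l2 set \<Rightarrow> bool" where
  "open_l2 U \<longleftrightarrow> (\<forall>x\<in>U. eventually (\<lambda>(x', y). x' = x \<longrightarrow> y \<in> U) uniformity)"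

lemma l2_AE:
  "AE x in lebesgue. fn (0 :: 'a l2) x = 0"
  "AE x in lebesgue. fn (a + b) x = fn a x + fn (b :: 'a l2) x"
  "AE x in lebesgue. fn (- a) x = - fn a x"
  "AE x in lebesgue. fn (a - b) x = fn a x - fn b x"
  "AE x in lebesgue. fn (c *\<^sub>R a) x = c *\<^sub>R fn a x"
  unfolding zero_l2_def plus_l2_def uminus_l2_def minus_l2_def scaleR_l2_def
  by (intro fn_cls L2_zero L2_add L2_minus L2_diff L2_scaleR L2_fn)+

instance
proof
  fix a b c :: "'a l2" and r s :: real
  show "dist a b = norm (a - b)" "sgn a = inverse (norm a) *\<^sub>R a" "norm a = sqrt (inner a a)"
    "(uniformity :: ('a l2 \<times> 'a l2) filter) = (INF e\<in>{0<..}. principal {(x, y). dist x y < e})"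
    by (simp_all add: dist_l2_def sgn_l2_def norm_l2_def uniformity_l2_def)
  show "open U \<longleftrightarrow> (\<forall>x\<in>U. eventually (\<lambda>(x', y). x' = x \<longrightarrow> y \<in> U) uniformity)" for U :: "'a l2 set"
    by (rule open_l2_def)
  show "a + b + c = a + (b + c)"
    by (rule fn_eqI) (use l2_AE(2)[of "a + b" c] l2_AE(2)[of a b] l2_AE(2)[of a "b + c"] l2_AE(2)[of b c] in eventually_elim, simp)
  show "a + b = b + a"
    by (rule fn_eqI) (use l2_AE(2)[of a b] l2_AE(2)[of b a] in eventually_elim, simp)
  show "0 + a = a"
    by (rule fn_eqI) (use l2_AE(2)[of 0 a] l2_AE(1) in eventually_elim, simp)
  show "- a + a = 0"
    by (rule fn_eqI) (use l2_AE(2)[of "- a" a] l2_AE(3)[of a] l2_AE(1) in eventually_elim, simp)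
  show "a - b = a + - b"
    by (rule fn_eqI) (use l2_AE(2)[of a "- b"] l2_AE(3)[of b] l2_AE(4)[of a b] in eventually_elim, simp)
  show "r *\<^sub>R (a + b) = r *\<^sub>R a + r *\<^sub>R b"
    by (rule fn_eqI) (use l2_AE(2)[of a b] l2_AE(2)[of "r *\<^sub>R a" "r *\<^sub>R b"] l2_AE(5)[of r a] l2_AE(5)[of r b] l2_AE(5)[of r "a + b"]
       in eventually_elim, simp add: scaleR_add_right)
  show "(r + s) *\<^sub>R a = r *\<^sub>R a + s *\<^sub>R a"
    by (rule fn_eqI) (use l2_AE(2)[of "r *\<^sub>R a" "s *\<^sub>R a"] l2_AE(5)[of r a] l2_AE(5)[of s a] l2_AE(5)[of "r + s" a]
       in eventually_elim, simp add: scaleR_add_left)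
  show "r *\<^sub>R s *\<^sub>R a = (r * s) *\<^sub>R a"
    by (rule fn_eqI) (use l2_AE(5)[of r "s *\<^sub>R a"] l2_AE(5)[of s a] l2_AE(5)[of "r * s" a] in eventually_elim, simp)
  show "1 *\<^sub>R a = a"
    by (rule fn_eqI) (use l2_AE(5)[of 1 a] in eventually_elim, simp)
  show "inner a b = inner b a" by (simp add: inner_l2_def inner_commute)
  show "inner (a + b) c = inner a c + inner b c"
  proof -
    have "inner (a + b) c = (LINT x|lebesgue. fn a x \<bullet> fn c x + fn b x \<bullet> fn c x)"
      unfolding inner_l2_def
    proof (rule integral_cong_AE)
      show "AE x in lebesgue. fn (a + b) x \<bullet> fn c x = fn a x \<bullet> fn c x + fn b x \<bullet> fn c x"
        using l2_AE(2)[of a b] by eventually_elim (simp add: inner_add_left)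
    qed (auto intro!: borel_measurable_integrable Bochner_Integration.integrable_add L2_prod_integrable)
    then show ?thesis by (simp add: inner_l2_def L2_prod_integrable)
  qed
  show "inner (r *\<^sub>R a) b = r * inner a b"
  proof -
    have "inner (r *\<^sub>R a) b = (LINT x|lebesgue. r * (fn a x \<bullet> fn b x))"
      unfolding inner_l2_def
    proof (rule integral_cong_AE)
      show "AE x in lebesgue. fn (r *\<^sub>R a) x \<bullet> fn b x = r * (fn a x \<bullet> fn b x)"
        using l2_AE(5)[of r a] by eventually_elim simp
    qed (auto intro!: borel_measurable_integrable L2_prod_integrable integrable_mult_right)
    then show ?thesis by (simp add: inner_l2_def)
  qed
  show "0 \<le> inner a a" by (simp add: inner_l2_def)
  show "inner a a = 0 \<longleftrightarrow> a = 0"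
  proof -
    have "inner a a = 0 \<longleftrightarrow> (AE x in lebesgue. fn a x \<bullet> fn a x = 0)"
      unfolding inner_l2_def
      by (rule integral_nonneg_eq_0_iff_AE) (auto intro: L2_prod_integrable)
    also have "\<dots> \<longleftrightarrow> (AE x in lebesgue. fn a x = fn 0 x)"
      using l2_AE(1) by (auto elim: eventually_elim2)
    also have "\<dots> \<longleftrightarrow> a = 0" using fn_eqI by auto
    finally show ?thesis .
  qed
qed

end

lemma fn_add: "AE x in lebesgue. fn (a + b) x = fn a x + fn b x" by (rule l2_AE)
lemma fn_diff: "AE x in lebesgue. fn (a - b) x = fn a x - fn b x" by (rule l2_AE)
lemma fn_scaleR: "AE x in lebesgue. fn (c *\<^sub>R a) x = c *\<^sub>R fn a x" by (rule l2_AE)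
lemma fn_zero: "AE x in lebesgue. fn 0 x = 0" by (rule l2_AE)

lemma cls_add:
  assumes "L2_function f" "L2_function g" shows "cls (\<lambda>x. f x + g x) = cls f + cls g"
proof (rule fn_eqI)
  show "AE x in lebesgue. fn (cls (\<lambda>x. f x + g x)) x = fn (cls f + cls g) x"
    using fn_cls[OF assms(1)] fn_cls[OF assms(2)] fn_cls[OF L2_add[OF assms]] fn_add[of "cls f" "cls g"]
    by eventually_elim simp
qed
lemma cls_diff:
  assumes "L2_function f" "L2_function g" shows "cls (\<lambda>x. f x - g x) = cls f - cls g"
proof (rule fn_eqI)
  show "AE x in lebesgue. fn (cls (\<lambda>x. f x - g x)) x = fn (cls f - cls g) x"
    using fn_cls[OF assms(1)] fn_cls[OF assms(2)] fn_cls[OF L2_diff[OF assms]] fn_diff[of "cls f" "cls g"]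
    by eventually_elim simp
qed
lemma cls_scaleR:
  assumes "L2_function f" shows "cls (\<lambda>x. c *\<^sub>R f x) = c *\<^sub>R cls f"
proof (rule fn_eqI)
  show "AE x in lebesgue. fn (cls (\<lambda>x. c *\<^sub>R f x)) x = fn (c *\<^sub>R cls f) x"
    using fn_cls[OF assms(1)] fn_cls[OF L2_scaleR[OF assms]] fn_scaleR[of c "cls f"]
    by eventually_elim simp
qed
lemma cls_minus: "L2_function f \<Longrightarrow> cls (\<lambda>x. - f x) = - cls f"
  using cls_scaleR[of f "- 1"] by simp
lemma cls_zero: "cls (\<lambda>x. 0) = 0" by (simp add: zero_l2_def)
lemma cls_sum: "(\<And>i. i \<in> I \<Longrightarrow> L2_function (f i)) \<Longrightarrow> cls (\<lambda>x. \<Sum>i\<in>I. f i x) = (\<Sum>i\<in>I. cls (f i))"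
  by (induction I rule: infinite_finite_induct) (auto simp: cls_zero cls_add L2_sum)

lemma inner_cls:
  assumes "L2_function f" "L2_function g"
  shows "cls f \<bullet> cls g = (LINT x|lebesgue. f x \<bullet> g x)"
  unfolding inner_l2_def
proof (rule integral_cong_AE)
  show "AE x in lebesgue. fn (cls f) x \<bullet> fn (cls g) x = f x \<bullet> g x"
    using fn_cls[OF assms(1)] fn_cls[OF assms(2)] by eventually_elim simp
qed (use assms in \<open>auto intro!: borel_measurable_integrable L2_prod_integrable\<close>)

lemma inner_fn: "a \<bullet> b = (LINT x|lebesgue. fn a x \<bullet> fn b x)"
  by (rule inner_l2_def)

lemma norm_cls: "L2_function f \<Longrightarrow> (norm (cls f))\<^sup>2 = (LINT x|lebesgue. (cmod (f x))\<^sup>2)"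
  by (simp add: power2_norm_eq_inner inner_cls)

lemma norm_cls_L2_norm: "L2_function f \<Longrightarrow> norm (cls f) = L2_norm f"
  using norm_cls[of f] by (simp add: L2_norm_def real_sqrt_unique)

lemma L2_inner_Re: "L2_function f \<Longrightarrow> L2_function g \<Longrightarrow> Re (L2_inner f g) = cls f \<bullet> cls g"
  unfolding L2_inner_def
  by (simp add: integral_Re[OF L2_prod_integrable(1), symmetric] inner_cls inner_complex_eq)

lemma nn_norm_cls: "L2_function f \<Longrightarrow> (\<integral>\<^sup>+ x. ennreal ((cmod (f x))\<^sup>2) \<partial>lebesgue) = ennreal ((norm (cls f))\<^sup>2)"
  by (simp add: norm_cls nn_integral_eq_integral L2_sq_integrable)

lemma norm_cls_mono:
  assumes "L2_function f" "L2_function g" "AE x in lebesgue. cmod (f x) \<le> C * cmod (g x)" "C \<ge> 0"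
  shows "norm (cls f) \<le> C * norm (cls g)"
proof (rule power2_le_imp_le)
  have "(norm (cls f))\<^sup>2 \<le> (LINT x|lebesgue. C\<^sup>2 * (cmod (g x))\<^sup>2)"
    unfolding norm_cls[OF assms(1)]
  proof (rule integral_mono_AE)
    show "AE x in lebesgue. (cmod (f x))\<^sup>2 \<le> C\<^sup>2 * (cmod (g x))\<^sup>2"
      using assms(3) by eventually_elim (metis norm_ge_zero power_mono power_mult_distrib)
  qed (use assms in \<open>auto intro: L2_sq_integrable\<close>)
  also have "\<dots> = (C * norm (cls g))\<^sup>2" using assms(2) by (simp add: power_mult_distrib norm_cls)
  finally show "(norm (cls f))\<^sup>2 \<le> (C * norm (cls g))\<^sup>2" .
qed (use assms in simp)

section \<open>Completeness\<close>

text \<open>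
  The weighted sum of the squared increments, with weights \<open>2 ^ k\<close>, has a finite integral. Hence at almost
  every point the increments decay geometrically and the representatives converge; Fatou's lemma
  turns the pointwise limit into a limit in the norm.
\<close>
lemma l2_fast_Cauchy_convergent:
  fixes a :: "nat \<Rightarrow> 'n::finite l2"
  assumes a: "\<And>k. norm (a (Suc k) - a k) \<le> (1/4) ^ k"
  shows "convergent a"
proof -
  let ?d = "\<lambda>k x. fn (a (Suc k)) x - fn (a k) x"
  have m[measurable]: "fn b \<in> borel_measurable lebesgue" for b :: "'n l2"
    using L2_fn L2_function_def by blast
  have nd: "(\<integral>\<^sup>+ x. ennreal ((cmod (fn b x - fn c x))\<^sup>2) \<partial>lebesgue) = ennreal ((norm (b - c))\<^sup>2)" for b c :: "'n l2"
    using nn_norm_cls[of "\<lambda>x. fn b x - fn c x"] L2_diff[OF L2_fn L2_fn, of b c]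
    by (simp add: cls_diff)
  have "(\<integral>\<^sup>+ x. (\<Sum>k. ennreal (2 ^ k * (cmod (?d k x))\<^sup>2)) \<partial>lebesgue)
      = (\<Sum>k. \<integral>\<^sup>+ x. ennreal (2 ^ k * (cmod (?d k x))\<^sup>2) \<partial>lebesgue)"
    by (rule nn_integral_suminf) measurable
  also have "\<dots> = (\<Sum>k. ennreal (2 ^ k) * ennreal ((norm (a (Suc k) - a k))\<^sup>2))"
    by (simp add: ennreal_mult' nn_integral_cmult nd)
  also have "\<dots> \<le> (\<Sum>k. ennreal ((1/2) ^ k))"
  proof (intro suminf_le summableI)
    fix k
    have "(norm (a (Suc k) - a k))\<^sup>2 \<le> ((1/4) ^ k)\<^sup>2" using a by (intro power_mono) auto
    also have "\<dots> \<le> (1/4) ^ k"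
      by (simp add: power2_eq_square mult_left_le_one_le power_le_one)
    finally have "2 ^ k * (norm (a (Suc k) - a k))\<^sup>2 \<le> 2 ^ k * (1/4) ^ k" by simp
    also have "\<dots> = (1/2) ^ k" by (simp add: power_mult_distrib[symmetric])
    finally show "ennreal (2 ^ k) * ennreal ((norm (a (Suc k) - a k))\<^sup>2) \<le> ennreal ((1/2) ^ k)"
      by (simp add: ennreal_mult'[symmetric] ennreal_leI)
  qed
  also have "\<dots> < \<infinity>" by (subst suminf_ennreal2) (auto simp: summable_geometric)
  finally have fin: "(\<integral>\<^sup>+ x. (\<Sum>k. ennreal (2 ^ k * (cmod (?d k x))\<^sup>2)) \<partial>lebesgue) \<noteq> \<infinity>" by simp
  have "AE x in lebesgue. (\<Sum>k. ennreal (2 ^ k * (cmod (?d k x))\<^sup>2)) \<noteq> \<infinity>"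
    by (rule nn_integral_noteq_infinite[OF _ fin]) measurable
  then have conv: "AE x in lebesgue. convergent (\<lambda>k. fn (a k) x)"
  proof eventually_elim
    case (elim x)
    define q where "q = (1 / sqrt 2 :: real)"
    have q: "0 < q" "q < 1" "q\<^sup>2 = 1/2" by (auto simp: q_def power_divide)
    have sm: "summable (\<lambda>k. 2 ^ k * (cmod (?d k x))\<^sup>2)"
      by (rule summable_suminf_not_top) (use elim in auto)
    then have "(\<lambda>k. 2 ^ k * (cmod (?d k x))\<^sup>2) \<longlonglongrightarrow> 0" by (rule summable_LIMSEQ_zero)
    then have "Bseq (\<lambda>k. 2 ^ k * (cmod (?d k x))\<^sup>2)" using convergent_imp_Bseq convergent_def by blast
    then obtain M where M: "M > 0" "\<And>k. norm (2 ^ k * (cmod (?d k x))\<^sup>2) \<le> M"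
      by (auto simp: Bseq_def)
    have b: "cmod (?d k x) \<le> sqrt M * q ^ k" for k
    proof (rule power2_le_imp_le)
      have "2 ^ k * (cmod (?d k x))\<^sup>2 \<le> M" using M(2)[of k] by simp
      then have "(cmod (?d k x))\<^sup>2 \<le> M * (1/2) ^ k" by (simp add: field_simps power_divide)
      also have "(1/2) ^ k = (q ^ k)\<^sup>2" unfolding q(3)[symmetric] by (simp only: power_mult[symmetric] mult.commute)
      also have "M * (q ^ k)\<^sup>2 = (sqrt M * q ^ k)\<^sup>2" using M(1) by (simp add: power_mult_distrib)
      finally show "(cmod (?d k x))\<^sup>2 \<le> (sqrt M * q ^ k)\<^sup>2" .
    qed (use M q in simp)
    have "summable (\<lambda>k. sqrt M * q ^ k)" using q by (intro summable_mult summable_geometric) simp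
    then have "summable (\<lambda>k. ?d k x)" by (rule summable_comparison_test'[where N = 0]) (use b in auto)
    then have "convergent (\<lambda>n. \<Sum>k<n. ?d k x)" by (simp add: summable_iff_convergent)
    then have "convergent (\<lambda>n. fn (a n) x - fn (a 0) x)"
      by (simp add: sum_lessThan_telescope[where f = "\<lambda>k. fn (a k) x"])
    then have "convergent (\<lambda>n. (fn (a n) x - fn (a 0) x) + fn (a 0) x)"
      by (intro convergent_add convergent_const)
    then show ?case by simp
  qed
  define F where "F x = lim (\<lambda>k. fn (a k) x)" for x
  have Fm[measurable]: "F \<in> borel_measurable lebesgue"
    unfolding F_def by (rule borel_measurable_lim_metric) measurable
  have lim: "AE x in lebesgue. (\<lambda>k. fn (a k) x) \<longlonglongrightarrow> F x"
    using conv by eventually_elim (simp add: F_def convergent_LIMSEQ_iff)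
  have dist: "norm (a (j + k) - a k) \<le> 2 * (1/4) ^ k" for j k
  proof -
    have "norm (a (j + k) - a k) \<le> (2 - 2 * (1/4) ^ j) * (1/4) ^ k"
    proof (induction j)
      case (Suc j)
      have "norm (a (Suc j + k) - a k) \<le> norm (a (Suc (j + k)) - a (j + k)) + norm (a (j + k) - a k)"
        using norm_triangle_ineq[of "a (Suc (j + k)) - a (j + k)" "a (j + k) - a k"] by simp
      also have "\<dots> \<le> (1/4) ^ (j + k) + (2 - 2 * (1/4) ^ j) * (1/4) ^ k" using a Suc by (intro add_mono) auto
      also have "\<dots> = (2 - (1/4) ^ j) * (1/4) ^ k" by (simp add: power_add algebra_simps)
      also have "\<dots> \<le> (2 - 2 * (1/4) ^ Suc j) * (1/4) ^ k" by (intro mult_right_mono) auto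
      finally show ?case .
    qed simp
    also have "\<dots> \<le> 2 * (1/4) ^ k" by (simp add: mult_right_mono)
    finally show ?thesis .
  qed
  have nb: "(\<integral>\<^sup>+ x. ennreal ((cmod (F x - fn (a k) x))\<^sup>2) \<partial>lebesgue) \<le> ennreal ((2 * (1/4) ^ k)\<^sup>2)" for k
  proof -
    have "(\<integral>\<^sup>+ x. ennreal ((cmod (F x - fn (a k) x))\<^sup>2) \<partial>lebesgue)
      = (\<integral>\<^sup>+ x. liminf (\<lambda>j. ennreal ((cmod (fn (a (j + k)) x - fn (a k) x))\<^sup>2)) \<partial>lebesgue)"
    proof (rule nn_integral_cong_AE)
      show "AE x in lebesgue. ennreal ((cmod (F x - fn (a k) x))\<^sup>2)
        = liminf (\<lambda>j. ennreal ((cmod (fn (a (j + k)) x - fn (a k) x))\<^sup>2))"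
        using lim
      proof eventually_elim
        case (elim x)
        have "(\<lambda>j. fn (a (j + k)) x) \<longlonglongrightarrow> F x" using elim by (rule LIMSEQ_ignore_initial_segment)
        then have "(\<lambda>j. ennreal ((cmod (fn (a (j + k)) x - fn (a k) x))\<^sup>2)) \<longlonglongrightarrow> ennreal ((cmod (F x - fn (a k) x))\<^sup>2)"
          by (intro tendsto_ennrealI tendsto_intros)
        then show ?case by (rule lim_imp_Liminf[OF trivial_limit_sequentially, symmetric])
      qed
    qed
    also have "\<dots> \<le> liminf (\<lambda>j. \<integral>\<^sup>+ x. ennreal ((cmod (fn (a (j + k)) x - fn (a k) x))\<^sup>2) \<partial>lebesgue)"
      by (rule nn_integral_liminf) measurable
    also have "\<dots> = liminf (\<lambda>j. ennreal ((norm (a (j + k) - a k))\<^sup>2))" by (simp only: nd)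
    also have "\<dots> \<le> ennreal ((2 * (1/4) ^ k)\<^sup>2)"
    proof (rule Liminf_le)
      show "\<forall>\<^sub>F j in sequentially. ennreal ((norm (a (j + k) - a k))\<^sup>2) \<le> ennreal ((2 * (1/4) ^ k)\<^sup>2)"
        by (intro always_eventually allI ennreal_leI power_mono dist) simp
    qed simp
    finally show ?thesis .
  qed
  have FL: "L2_function (\<lambda>x. F x - fn (a k) x)" for k
    unfolding L2_function_iff_nn using nb[of k] by (auto intro: le_less_trans)
  have F: "L2_function F" using L2_add[OF FL[of 0] L2_fn[of "a 0"]] by simp
  have nF: "norm (cls F - a k) \<le> 2 * (1/4) ^ k" for k
  proof -
    have "ennreal ((norm (cls F - a k))\<^sup>2) \<le> ennreal ((2 * (1/4) ^ k)\<^sup>2)"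
      using nb[of k] nn_norm_cls[OF FL[of k]] cls_diff[OF F L2_fn[of "a k"]] by simp
    then have "(norm (cls F - a k))\<^sup>2 \<le> (2 * (1/4) ^ k)\<^sup>2" by (subst (asm) ennreal_le_iff) auto
    then show ?thesis by (rule power2_le_imp_le) simp
  qed
  have "(\<lambda>k. norm (a k - cls F)) \<longlonglongrightarrow> 0"
  proof (rule Lim_null_comparison)
    show "\<forall>\<^sub>F k in sequentially. norm (norm (a k - cls F)) \<le> 2 * (1/4) ^ k"
      using nF by (simp add: norm_minus_commute)
    have "(\<lambda>k. 2 * (1/4::real) ^ k) \<longlonglongrightarrow> 2 * 0" by (intro tendsto_mult tendsto_const LIMSEQ_realpow_zero) auto
    then show "(\<lambda>k. 2 * (1/4::real) ^ k) \<longlonglongrightarrow> 0" by simp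
  qed
  then have "a \<longlonglongrightarrow> cls F" by (rule LIM_zero_cancel[OF tendsto_norm_zero_cancel])
  then show ?thesis by (auto simp: convergent_def)
qed

instance l2 :: (finite) complete_space
proof
  fix X :: "nat \<Rightarrow> 'a l2" assume X: "Cauchy X"
  have "\<exists>N. \<forall>m\<ge>N. \<forall>n\<ge>N. norm (X m - X n) < (1/4) ^ k" for k :: nat
    using X by (simp add: Cauchy_def dist_norm)
  then obtain N where N: "\<And>k m n. N k \<le> m \<Longrightarrow> N k \<le> n \<Longrightarrow> norm (X m - X n) < (1/4) ^ k" by metis
  define s where "s k = (\<Sum>i\<le>k. N i) + k" for k
  have Ns: "N k \<le> s k" for k unfolding s_def by (simp add: member_le_sum trans_le_add1)
  have s: "strict_mono s" by (rule strict_monoI_Suc) (simp add: s_def)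
  have "norm ((X \<circ> s) (Suc k) - (X \<circ> s) k) \<le> (1/4) ^ k" for k
    using N[of k "s (Suc k)" "s k"] Ns[of k] strict_monoD[OF s, of k "Suc k"] by (simp add: less_imp_le)
  then have "convergent (X \<circ> s)" by (rule l2_fast_Cauchy_convergent)
  then obtain l where "(X \<circ> s) \<longlonglongrightarrow> l" by (auto simp: convergent_def)
  with X s have "X \<longlonglongrightarrow> l" by (rule Cauchy_converges_subseq)
  then show "convergent X" by (auto simp: convergent_def)
qed

section \<open>Multiplication operators\<close>

text \<open>
  Bounded multipliers. The bound is required everywhere, which avoids essential suprema.
\<close>
definition bmult :: "(real^'n::finite \<Rightarrow> complex) \<Rightarrow> bool" where
  "bmult m \<longleftrightarrow> m \<in> borel_measurable lebesgue \<and> (\<exists>C. \<forall>x. cmod (m x) \<le> C)"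

definition mult_op :: "(real^'n::finite \<Rightarrow> complex) \<Rightarrow> 'n l2 \<Rightarrow> 'n l2" where
  "mult_op m a = cls (\<lambda>x. m x * fn a x)"

lemma bmultI: "m \<in> borel_measurable lebesgue \<Longrightarrow> (\<And>x. cmod (m x) \<le> C) \<Longrightarrow> bmult m"
  by (auto simp: bmult_def)

lemma bmult_const [simp, intro]: "bmult (\<lambda>x. c)"
  by (rule bmultI[of _ "cmod c"]) auto

lemma bmult_cnj: "bmult m \<Longrightarrow> bmult (\<lambda>x. cnj (m x))"
proof -
  assume m: "bmult m"
  have "cnj \<in> borel_measurable borel"
    by (intro borel_measurable_continuous_onI continuous_intros)
  then show ?thesis using m by (auto simp: bmult_def intro: measurable_compose)
qed

lemma bmult_mult: "bmult m \<Longrightarrow> bmult m' \<Longrightarrow> bmult (\<lambda>x. m x * m' x)"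
proof -
  assume m: "bmult m" "bmult m'"
  then obtain C C' where C: "\<And>x. cmod (m x) \<le> C" "\<And>x. cmod (m' x) \<le> C'" by (auto simp: bmult_def)
  have "cmod (m x * m' x) \<le> C * C'" for x
    using C[of x] norm_ge_zero[of "m x"] by (auto simp: norm_mult intro!: mult_mono order_trans[OF norm_ge_zero C(1)])
  with m show ?thesis by (intro bmultI[where C = "C * C'"]) (auto simp: bmult_def)
qed

lemma bmult_add: "bmult m \<Longrightarrow> bmult m' \<Longrightarrow> bmult (\<lambda>x. m x + m' x)"
proof -
  assume m: "bmult m" "bmult m'"
  then obtain C C' where "\<And>x. cmod (m x) \<le> C" "\<And>x. cmod (m' x) \<le> C'" by (auto simp: bmult_def)
  then have "cmod (m x + m' x) \<le> C + C'" for x by (meson add_mono norm_triangle_le)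
  with m show ?thesis by (intro bmultI[where C = "C + C'"]) (auto simp: bmult_def)
qed

lemma L2_bmult: "bmult m \<Longrightarrow> L2_function f \<Longrightarrow> L2_function (\<lambda>x. m x * f x)"
  by (auto simp: bmult_def intro: L2_mult)

lemma fn_mult: "bmult m \<Longrightarrow> AE x in lebesgue. fn (mult_op m a) x = m x * fn a x"
  unfolding mult_op_def by (intro fn_cls L2_bmult L2_fn)

lemma mult_cls:
  assumes "bmult m" "L2_function f" shows "mult_op m (cls f) = cls (\<lambda>x. m x * f x)"
proof (rule fn_eqI)
  show "AE x in lebesgue. fn (mult_op m (cls f)) x = fn (cls (\<lambda>x. m x * f x)) x"
    using fn_mult[OF assms(1), of "cls f"] fn_cls[OF assms(2)] fn_cls[OF L2_bmult[OF assms]]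
    by eventually_elim simp
qed

lemma mult_linear: assumes "bmult m" shows "linear (mult_op m)"
proof (rule linearI)
  show "mult_op m (a + b) = mult_op m a + mult_op m b" for a b
  proof (rule fn_eqI)
    show "AE x in lebesgue. fn (mult_op m (a + b)) x = fn (mult_op m a + mult_op m b) x"
      using fn_mult[OF assms, of a] fn_mult[OF assms, of b] fn_mult[OF assms, of "a + b"]
        fn_add[of a b] fn_add[of "mult_op m a" "mult_op m b"]
      by eventually_elim (simp add: algebra_simps)
  qed
  show "mult_op m (r *\<^sub>R a) = r *\<^sub>R mult_op m a" for r a
  proof (rule fn_eqI)
    show "AE x in lebesgue. fn (mult_op m (r *\<^sub>R a)) x = fn (r *\<^sub>R mult_op m a) x"
      using fn_mult[OF assms, of a] fn_mult[OF assms, of "r *\<^sub>R a"]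
        fn_scaleR[of r a] fn_scaleR[of r "mult_op m a"]
      by eventually_elim simp
  qed
qed

lemma mult_mult:
  assumes "bmult m" "bmult m'" shows "mult_op m (mult_op m' a) = mult_op (\<lambda>x. m x * m' x) a"
proof (rule fn_eqI)
  show "AE x in lebesgue. fn (mult_op m (mult_op m' a)) x = fn (mult_op (\<lambda>x. m x * m' x) a) x"
    using fn_mult[OF assms(1), of "mult_op m' a"] fn_mult[OF assms(2), of a] fn_mult[OF bmult_mult[OF assms], of a]
    by eventually_elim simp
qed

lemma mult_one [simp]: "mult_op (\<lambda>x. 1) a = a"
  by (simp add: mult_op_def)

lemma mult_adjoint:
  assumes m: "bmult m" shows "mult_op m a \<bullet> b = a \<bullet> mult_op (\<lambda>x. cnj (m x)) b"
  unfolding inner_fn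
proof (rule integral_cong_AE)
  show "AE x in lebesgue. fn (mult_op m a) x \<bullet> fn b x = fn a x \<bullet> fn (mult_op (\<lambda>x. cnj (m x)) b) x"
    using fn_mult[OF m, of a] fn_mult[OF bmult_cnj[OF m], of b]
    by eventually_elim (simp add: inner_complex_eq mult_ac)
qed (auto intro!: borel_measurable_integrable L2_prod_integrable)

lemma norm_mult_le:
  assumes m: "bmult m" and C: "\<And>x. cmod (m x) \<le> C" shows "norm (mult_op m a) \<le> C * norm a"
proof -
  have "norm (cls (\<lambda>x. m x * fn a x)) \<le> C * norm (cls (fn a))"
  proof (rule norm_cls_mono)
    show "L2_function (\<lambda>x. m x * fn a x)" by (intro L2_bmult m L2_fn)
    show "AE x in lebesgue. cmod (m x * fn a x) \<le> C * cmod (fn a x)"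
      using C by (intro AE_I2) (simp add: norm_mult mult_right_mono)
    show "C \<ge> 0" using C[of 0] norm_ge_zero order_trans by blast
  qed simp
  then show ?thesis by (simp add: mult_op_def)
qed

lemma norm_mult_unimodular:
  assumes m: "bmult m" and u: "\<And>x. cmod (m x) = 1" shows "norm (mult_op m a) = norm a"
proof -
  have "mult_op (\<lambda>x. cnj (m x)) (mult_op m a) = a"
    using u by (simp add: mult_mult bmult_cnj m complex_norm_square[symmetric] mult.commute[of "cnj _"])
  then have "norm a = norm (mult_op (\<lambda>x. cnj (m x)) (mult_op m a))" by simp
  also have "\<dots> \<le> 1 * norm (mult_op m a)" by (intro norm_mult_le bmult_cnj m) (simp add: u)
  finally show ?thesis using norm_mult_le[OF m, of 1 a] u by simp
qed

definition imul :: "'n::finite l2 \<Rightarrow> 'n l2" where "imul = mult_op (\<lambda>x. \<i>)"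

lemma imul_linear: "linear imul" unfolding imul_def by (intro mult_linear bmult_const)
lemma imul_norm: "norm (imul a) = norm a" unfolding imul_def by (rule norm_mult_unimodular) auto
lemma imul_anti: "imul a \<bullet> b = - (a \<bullet> imul b)"
proof -
  have "mult_op (\<lambda>x. cnj \<i>) b = - imul b"
    unfolding imul_def mult_op_def by (simp add: cls_minus L2_scale)
  then show ?thesis using mult_adjoint[OF bmult_const, of \<i> a b] by (simp add: imul_def)
qed
lemma imul_mult: "bmult m \<Longrightarrow> imul (mult_op m a) = mult_op m (imul a)"
  unfolding imul_def by (simp add: mult_mult mult.commute)
lemma imul_cls: "L2_function f \<Longrightarrow> imul (cls f) = cls (\<lambda>x. \<i> * f x)"
  unfolding imul_def by (rule mult_cls) auto

lemma L2_inner_Im: "L2_function f \<Longrightarrow> L2_function g \<Longrightarrow> Im (L2_inner f g) = cls f \<bullet> imul (cls g)"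
proof -
  assume f: "L2_function f" "L2_function g"
  have "Im (L2_inner f g) = (LINT x|lebesgue. Im (f x * cnj (g x)))"
    unfolding L2_inner_def by (rule integral_Im[OF L2_prod_integrable(1)[OF f], symmetric])
  also have "\<dots> = (LINT x|lebesgue. f x \<bullet> (\<i> * g x))" by (simp add: inner_complex_eq)
  also have "\<dots> = cls f \<bullet> imul (cls g)"
    using f L2_scale[OF f(2), of \<i>] by (simp add: imul_cls inner_cls)
  finally show ?thesis .
qed

section \<open>Affine changes of variables\<close>

lemma lebesgue_affine:
  fixes v :: "real^'n::finite" assumes c: "c > 0"
  shows "lebesgue = density (distr lebesgue lebesgue (\<lambda>x. v + c *\<^sub>R x)) (\<lambda>_. ennreal (c ^ CARD('n)))"
    and affine_measurable: "(\<lambda>x. v + c *\<^sub>R x) \<in> lebesgue \<rightarrow>\<^sub>M lebesgue"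
proof -
  have eq: "(\<Sum>j\<in>Basis. (c * (x \<bullet> j)) *\<^sub>R j) = c *\<^sub>R x" for x :: "real^'n"
    using euclidean_representation[of x] by (simp add: scaleR_scaleR[symmetric] scaleR_sum_right[symmetric] del: scaleR_scaleR)
  show "lebesgue = density (distr lebesgue lebesgue (\<lambda>x. v + c *\<^sub>R x)) (\<lambda>_. ennreal (c ^ CARD('n)))"
    using lebesgue_affine_euclidean[of "\<lambda>_. c" v] c by (simp add: eq)
  show "(\<lambda>x. v + c *\<^sub>R x) \<in> lebesgue \<rightarrow>\<^sub>M lebesgue"
    using lebesgue_affine_measurable[of "\<lambda>_. c" v] c by (simp add: eq)
qed

lemma AE_affine:
  fixes v :: "real^'n::finite"
  assumes c: "c > 0" and P: "AE x in lebesgue. P x"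
  shows "AE x in lebesgue. P (v + c *\<^sub>R x)"
proof -
  have "AE x in density (distr lebesgue lebesgue (\<lambda>x. v + c *\<^sub>R x)) (\<lambda>_. ennreal (c ^ CARD('n))). P x"
    unfolding lebesgue_affine(1)[OF c, of v, symmetric] by (rule P)
  then have "AE x in distr lebesgue lebesgue (\<lambda>x. v + c *\<^sub>R x). P x"
    using c by (subst (asm) AE_density) auto
  then show ?thesis by (rule AE_distrD[OF affine_measurable[OF c]])
qed

lemma integral_affine:
  fixes v :: "real^'n::finite" and f :: "real^'n \<Rightarrow> real"
  assumes c: "c > 0" and f: "f \<in> borel_measurable lebesgue"
  shows "(LINT x|lebesgue. f x) = (LINT x|lebesgue. c ^ CARD('n) * f (v + c *\<^sub>R x))"
    and "integrable lebesgue f \<longleftrightarrow> integrable lebesgue (\<lambda>x. c ^ CARD('n) * f (v + c *\<^sub>R x))"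
proof -
  let ?D = "distr lebesgue lebesgue (\<lambda>x. v + c *\<^sub>R x)"
  have f': "f \<in> borel_measurable ?D" using f by simp
  have "(LINT x|lebesgue. f x) = (LINT x|density ?D (\<lambda>_. ennreal (c ^ CARD('n))). f x)"
    using lebesgue_affine(1)[OF c, of v] by simp
  also have "\<dots> = (LINT x|?D. c ^ CARD('n) * f x)"
    using c f' by (subst integral_density) auto
  also have "\<dots> = (LINT x|lebesgue. c ^ CARD('n) * f (v + c *\<^sub>R x))"
    using f by (intro integral_distr affine_measurable[OF c]) auto
  finally show "(LINT x|lebesgue. f x) = (LINT x|lebesgue. c ^ CARD('n) * f (v + c *\<^sub>R x))" .
  have "integrable lebesgue f \<longleftrightarrow> integrable (density ?D (\<lambda>_. ennreal (c ^ CARD('n)))) f"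
    using lebesgue_affine(1)[OF c, of v] by simp
  also have "\<dots> \<longleftrightarrow> integrable ?D (\<lambda>x. c ^ CARD('n) * f x)"
    using c f' by (subst integrable_density) auto
  also have "\<dots> \<longleftrightarrow> integrable lebesgue (\<lambda>x. c ^ CARD('n) * f (v + c *\<^sub>R x))"
    using f by (intro integrable_distr_eq affine_measurable[OF c]) auto
  finally show "integrable lebesgue f \<longleftrightarrow> integrable lebesgue (\<lambda>x. c ^ CARD('n) * f (v + c *\<^sub>R x))" .
qed

text \<open>
  The factor makes \<open>aff\<close> an isometry. Translations are the case \<open>c = 1\<close> and dilations the case \<open>v = 0\<close>, so that both
  groups are handled by the same lemmas.
\<close>
definition affn :: "real \<Rightarrow> real^'n::finite \<Rightarrow> (real^'n \<Rightarrow> complex) \<Rightarrow> real^'n \<Rightarrow> complex" where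
  "affn c v f x = (c powr (real CARD('n) / 2)) *\<^sub>R f (v + c *\<^sub>R x)"

definition aff :: "real \<Rightarrow> real^'n::finite \<Rightarrow> 'n l2 \<Rightarrow> 'n l2" where
  "aff c v a = cls (affn c v (fn a))"

lemma powr_half_sq: "c > 0 \<Longrightarrow> (c powr (real n / 2))\<^sup>2 = c ^ n"
  by (simp add: powr_realpow[symmetric] power2_eq_square powr_add[symmetric])

lemma measurable_affn:
  fixes f :: "real^'n::finite \<Rightarrow> complex"
  assumes "c > 0" "f \<in> borel_measurable lebesgue" shows "affn c v f \<in> borel_measurable lebesgue"
proof -
  have "(\<lambda>x. f (v + c *\<^sub>R x)) \<in> borel_measurable lebesgue"
    by (rule measurable_compose[OF affine_measurable[OF assms(1)] assms(2)])
  then show ?thesis unfolding affn_def[abs_def] by measurable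
qed

lemma L2_affn:
  fixes f :: "real^'n::finite \<Rightarrow> complex"
  assumes c: "c > 0" and f: "L2_function f" shows "L2_function (affn c v f)"
  unfolding L2_function_def
proof
  show "affn c v f \<in> borel_measurable lebesgue"
    by (rule measurable_affn[OF c]) (use f in \<open>simp add: L2_function_def\<close>)
  have "integrable lebesgue (\<lambda>x. c ^ CARD('n) * (cmod (f (v + c *\<^sub>R x)))\<^sup>2)"
    using integral_affine(2)[OF c, of "\<lambda>x. (cmod (f x))\<^sup>2" v] L2_sq_integrable[OF f] by simp
  then show "integrable lebesgue (\<lambda>x. (cmod (affn c v f x))\<^sup>2)"
    by (simp add: affn_def power_mult_distrib powr_half_sq[OF c])
qed

lemma aff_cls:
  assumes c: "c > 0" and f: "L2_function f" shows "aff c v (cls f) = cls (affn c v f)"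
proof (rule fn_eqI)
  show "AE x in lebesgue. fn (aff c v (cls f)) x = fn (cls (affn c v f)) x"
    using fn_cls[OF L2_affn[OF c L2_fn[of "cls f"], of v]] fn_cls[OF L2_affn[OF c f, of v]]
      AE_affine[OF c fn_cls[OF f], of v]
    by eventually_elim (simp add: aff_def affn_def)
qed

lemma fn_aff: "c > 0 \<Longrightarrow> AE x in lebesgue. fn (aff c v a) x = affn c v (fn a) x"
  unfolding aff_def by (intro fn_cls L2_affn L2_fn)

lemma aff_linear: assumes c: "c > 0" shows "linear (aff c v)"
proof (rule linearI)
  show "aff c v (a + b) = aff c v a + aff c v b" for a b
  proof (rule fn_eqI)
    show "AE x in lebesgue. fn (aff c v (a + b)) x = fn (aff c v a + aff c v b) x"
      using fn_aff[OF c, of v a] fn_aff[OF c, of v b] fn_aff[OF c, of v "a + b"]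
        AE_affine[OF c fn_add[of a b], of v] fn_add[of "aff c v a" "aff c v b"]
      by eventually_elim (simp add: affn_def algebra_simps)
  qed
  show "aff c v (r *\<^sub>R a) = r *\<^sub>R aff c v a" for r a
  proof (rule fn_eqI)
    show "AE x in lebesgue. fn (aff c v (r *\<^sub>R a)) x = fn (r *\<^sub>R aff c v a) x"
      using fn_aff[OF c, of v a] fn_aff[OF c, of v "r *\<^sub>R a"]
        AE_affine[OF c fn_scaleR[of r a], of v] fn_scaleR[of r "aff c v a"]
      by eventually_elim (simp add: affn_def)
  qed
qed

lemma inner_aff:
  assumes c: "c > 0" shows "aff c v a \<bullet> aff c v b = a \<bullet> b"
proof -
  have "aff c v a \<bullet> aff c v b = (LINT x|lebesgue. affn c v (fn a) x \<bullet> affn c v (fn b) x)"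
    unfolding aff_def by (intro inner_cls L2_affn c L2_fn)
  also have "\<dots> = (LINT x|lebesgue. c ^ CARD('a) * (fn a (v + c *\<^sub>R x) \<bullet> fn b (v + c *\<^sub>R x)))"
    by (simp add: affn_def powr_half_sq[OF c, symmetric] power2_eq_square mult_ac)
  also have "\<dots> = a \<bullet> b"
    unfolding inner_fn
    by (rule integral_affine(1)[OF c, symmetric]) (auto intro!: borel_measurable_integrable L2_prod_integrable)
  finally show ?thesis .
qed

lemma norm_aff: "c > 0 \<Longrightarrow> norm (aff c v a) = norm a"
  by (simp add: norm_eq_sqrt_inner inner_aff)

lemma aff_aff:
  assumes c: "c > 0" "d > 0" shows "aff c v (aff d w a) = aff (c * d) (w + d *\<^sub>R v) a"
proof (rule fn_eqI)
  show "AE x in lebesgue. fn (aff c v (aff d w a)) x = fn (aff (c * d) (w + d *\<^sub>R v) a) x"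
    using fn_aff[OF c(1), of v "aff d w a"] AE_affine[OF c(1) fn_aff[OF c(2), of w a], of v]
      fn_aff[OF mult_pos_pos[OF c], of "w + d *\<^sub>R v" a]
    by eventually_elim (use c in \<open>simp add: affn_def powr_mult algebra_simps\<close>)
qed

lemma aff_one: "aff 1 0 a = a"
  by (simp add: aff_def affn_def[abs_def])

lemma aff_mult:
  assumes c: "c > 0" and m: "bmult m" and m': "bmult (\<lambda>x. m (v + c *\<^sub>R x))"
  shows "aff c v (mult_op m a) = mult_op (\<lambda>x. m (v + c *\<^sub>R x)) (aff c v a)"
proof (rule fn_eqI)
  show "AE x in lebesgue. fn (aff c v (mult_op m a)) x = fn (mult_op (\<lambda>x. m (v + c *\<^sub>R x)) (aff c v a)) x"
    using fn_aff[OF c, of v "mult_op m a"] AE_affine[OF c fn_mult[OF m, of a], of v]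
      fn_aff[OF c, of v a] fn_mult[OF m', of "aff c v a"]
    by eventually_elim (simp add: affn_def)
qed

lemma aff_imul: "c > 0 \<Longrightarrow> aff c v (imul a) = imul (aff c v a)"
  unfolding imul_def by (rule aff_mult) auto

section \<open>Dominated convergence and derivatives in the Hilbert space\<close>

lemma l2_tendsto_dominated:
  fixes F :: "nat \<Rightarrow> real^'n::finite \<Rightarrow> complex"
  assumes F: "\<And>k. L2_function (F k)" and G: "G \<in> borel_measurable lebesgue"
    and b: "integrable lebesgue (\<lambda>x. (b x)\<^sup>2)"
    and bd: "\<And>k. AE x in lebesgue. cmod (F k x) \<le> b x"
    and lim: "AE x in lebesgue. (\<lambda>k. F k x) \<longlonglongrightarrow> G x"
  shows "L2_function G" "(\<lambda>k. cls (F k)) \<longlonglongrightarrow> cls G"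
proof -
  have bd': "AE x in lebesgue. \<forall>k. cmod (F k x) \<le> b x" using bd by (simp add: AE_all_countable)
  have Gb: "AE x in lebesgue. cmod (G x) \<le> b x"
    using bd' lim
  proof eventually_elim
    case (elim x)
    show ?case
      by (rule tendsto_upperbound[OF tendsto_norm[OF elim(2)]]) (use elim(1) in auto)
  qed
  show GL: "L2_function G"
    by (rule L2_bound[OF G b]) (use Gb in eventually_elim, simp add: power_mono)
  have "(\<lambda>k. LINT x|lebesgue. (cmod (F k x - G x))\<^sup>2) \<longlonglongrightarrow> (LINT x|(lebesgue :: (real^'n) measure). (0::real))"
  proof (rule integral_dominated_convergence[where w = "\<lambda>x. 4 * (b x)\<^sup>2"])
    show "AE x in lebesgue. (\<lambda>k. (cmod (F k x - G x))\<^sup>2) \<longlonglongrightarrow> 0"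
      using lim
    proof eventually_elim
      case (elim x)
      have "(\<lambda>k. (cmod (F k x - G x))\<^sup>2) \<longlonglongrightarrow> (cmod (G x - G x))\<^sup>2" by (intro tendsto_intros elim)
      then show ?case by simp
    qed
    show "AE x in lebesgue. norm ((cmod (F k x - G x))\<^sup>2) \<le> 4 * (b x)\<^sup>2" for k
      using bd[of k] Gb
    proof eventually_elim
      case (elim x)
      have "cmod (F k x - G x) \<le> 2 * b x" using elim norm_triangle_ineq4[of "F k x" "G x"] by linarith
      then have "(cmod (F k x - G x))\<^sup>2 \<le> (2 * b x)\<^sup>2" by (intro power_mono) auto
      then show ?case by (simp add: power_mult_distrib)
    qed
    show "(\<lambda>x. (cmod (F k x - G x))\<^sup>2) \<in> borel_measurable lebesgue" for k
      by (intro borel_measurable_integrable L2_sq_integrable L2_diff F GL)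
  qed (use b in auto)
  then have "(\<lambda>k. (norm (cls (F k) - cls G))\<^sup>2) \<longlonglongrightarrow> 0"
    by (simp add: cls_diff[OF F GL, symmetric] norm_cls L2_diff F GL)
  then have "(\<lambda>k. sqrt ((norm (cls (F k) - cls G))\<^sup>2)) \<longlonglongrightarrow> sqrt 0" by (intro tendsto_intros)
  then have "(\<lambda>k. norm (cls (F k) - cls G)) \<longlonglongrightarrow> 0" by simp
  then show "(\<lambda>k. cls (F k)) \<longlonglongrightarrow> cls G" by (rule LIM_zero_cancel[OF tendsto_norm_zero_cancel])
qed

text \<open>
  By the mean value inequality the difference quotients are dominated by \<open>b\<close>.
\<close>
lemma l2_has_vector_derivative:
  fixes F :: "real \<Rightarrow> real^'n::finite \<Rightarrow> complex"
  assumes d: "\<delta> > 0"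
    and F: "\<And>s. \<bar>s - t\<bar> < \<delta> \<Longrightarrow> L2_function (F s)" and G: "F' t \<in> borel_measurable lebesgue"
    and der: "\<And>s x. \<bar>s - t\<bar> < \<delta> \<Longrightarrow> ((\<lambda>s. F s x) has_vector_derivative F' s x) (at s)"
    and bd: "\<And>s x. \<bar>s - t\<bar> < \<delta> \<Longrightarrow> cmod (F' s x) \<le> b x"
    and b: "integrable lebesgue (\<lambda>x. (b x)\<^sup>2)"
  shows "L2_function (F' t)" "((\<lambda>s. cls (F s)) has_vector_derivative cls (F' t)) (at t)"
proof -
  have bound: "cmod ((F (t + h) x - F t x) /\<^sub>R h) \<le> b x" if h: "\<bar>h\<bar> < \<delta>" "h \<noteq> 0" for h x
  proof -
    have "norm (F (t + h) x - F t x) \<le> b x * norm (t + h - t)"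
    proof (rule differentiable_bound[where S = "{s. \<bar>s - t\<bar> < \<delta>}" and f' = "\<lambda>s y. y *\<^sub>R F' s x"])
      have "{s. \<bar>s - t\<bar> < \<delta>} = ball t \<delta>" by (auto simp: dist_real_def)
      then show "convex {s. \<bar>s - t\<bar> < \<delta>}" by simp
      show "((\<lambda>s. F s x) has_derivative (\<lambda>y. y *\<^sub>R F' s x)) (at s within {s. \<bar>s - t\<bar> < \<delta>})"
        if "s \<in> {s. \<bar>s - t\<bar> < \<delta>}" for s
        using der[of s x] that by (auto simp: has_vector_derivative_def intro: has_derivative_at_withinI)
      show "onorm (\<lambda>y. y *\<^sub>R F' s x) \<le> b x" if "s \<in> {s. \<bar>s - t\<bar> < \<delta>}" for s
        using bd[of s x] that by (intro onorm_le) (auto simp: mult.commute[of _ "norm _"] intro!: mult_left_mono mult_right_mono)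
    qed (use d h in auto)
    then have "norm (F (t + h) x - F t x) / \<bar>h\<bar> \<le> b x" using h by (simp add: pos_divide_le_eq)
    then show ?thesis by (simp add: divide_inverse mult.commute)
  qed
  have lim: "((\<lambda>h. (F (t + h) x - F t x) /\<^sub>R h) \<longlongrightarrow> F' t x) (at 0)" for x
    using der[of t x] d unfolding has_vector_derivative_iff_quotient by simp
  have main: "L2_function (F' t) \<and> (\<lambda>k. (cls (F (t + X k)) - cls (F t)) /\<^sub>R X k) \<longlonglongrightarrow> cls (F' t)"
    if X: "\<And>k. X k \<noteq> 0" "X \<longlonglongrightarrow> 0" "\<And>k. \<bar>X k\<bar> < \<delta>" for X :: "nat \<Rightarrow> real"
  proof -
    let ?q = "\<lambda>k x. (F (t + X k) x - F t x) /\<^sub>R X k"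
    have L: "L2_function (?q k)" for k using d X by (intro L2_scaleR L2_diff F) auto
    have "(\<lambda>k. ?q k x) \<longlonglongrightarrow> F' t x" for x
      using lim[of x] X unfolding tendsto_at_iff_sequentially o_def by auto
    then have l: "AE x in lebesgue. (\<lambda>k. ?q k x) \<longlonglongrightarrow> F' t x" by simp
    have bd': "AE x in lebesgue. cmod (?q k x) \<le> b x" for k
      by (intro AE_I2 bound X)
    have "L2_function (F' t)" "(\<lambda>k. cls (?q k)) \<longlonglongrightarrow> cls (F' t)"
      using l2_tendsto_dominated[OF L G b bd' l] .
    moreover have "cls (?q k) = (cls (F (t + X k)) - cls (F t)) /\<^sub>R X k" for k
      using d X by (simp add: cls_scaleR cls_diff L2_diff F)
    ultimately show ?thesis by simp
  qed
  have X0: "(\<lambda>k. \<delta> / 2 * (1 / real (Suc k))) \<longlonglongrightarrow> \<delta> / 2 * 0"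
    using LIMSEQ_inverse_real_of_nat by (intro tendsto_intros) (simp add: inverse_eq_divide)
  have "\<bar>\<delta> / 2 * (1 / real (Suc k))\<bar> < \<delta>" for k
    using d by (simp add: field_simps) (smt (verit) mult_nonneg_nonneg of_nat_0_le_iff)
  then show "L2_function (F' t)" using main[of "\<lambda>k. \<delta> / 2 * (1 / real (Suc k))"] X0 d by auto
  show "((\<lambda>s. cls (F s)) has_vector_derivative cls (F' t)) (at t)"
    unfolding has_vector_derivative_iff_quotient tendsto_at_iff_sequentially o_def
  proof (intro allI impI)
    fix X :: "nat \<Rightarrow> real" assume X: "\<forall>i. X i \<in> UNIV - {0}" "X \<longlonglongrightarrow> 0"
    define Y where "Y k = (if \<bar>X k\<bar> < \<delta> then X k else \<delta> / 2)" for k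
    have ev: "\<forall>\<^sub>F k in sequentially. Y k = X k"
      using tendstoD[OF X(2) d] by eventually_elim (simp add: Y_def)
    have "Y \<longlonglongrightarrow> 0" using X(2) by (subst tendsto_cong[OF ev])
    then have "(\<lambda>k. (cls (F (t + Y k)) - cls (F t)) /\<^sub>R Y k) \<longlonglongrightarrow> cls (F' t)"
      using main[of Y] X d by (auto simp: Y_def)
    then show "(\<lambda>k. (cls (F (t + X k)) - cls (F t)) /\<^sub>R X k) \<longlonglongrightarrow> cls (F' t)"
      by (rule Lim_transform_eventually) (use ev in eventually_elim, simp)
  qed
qed

section \<open>Smooth functions\<close>

lemma partial_deriv_eq: "(f has_derivative f') (at x) \<Longrightarrow> partial_deriv i f x = f' (axis i 1)"
  unfolding partial_deriv_def using frechet_derivative_at by metis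

lemma k_smooth_SucD: "k_smooth (Suc k) f \<Longrightarrow> k_smooth k f"
proof (induction k arbitrary: f)
  case 0 then show ?case by (simp add: differentiable_imp_continuous_on)
next
  case (Suc k)
  then have "f differentiable_on UNIV" "\<And>i. k_smooth (Suc k) (partial_deriv i f)" by auto
  with Suc.IH show ?case by simp
qed

definition smooth :: "(real^'n::finite \<Rightarrow> real) \<Rightarrow> bool" where
  "smooth f \<longleftrightarrow> (\<forall>k. k_smooth k f)"

lemma smooth_k: "smooth f \<Longrightarrow> k_smooth k f" by (simp add: smooth_def)
lemma smooth_pd: "smooth f \<Longrightarrow> smooth (partial_deriv i f)"
  unfolding smooth_def using k_smooth.simps(2) by blast
lemma smooth_diff: "smooth f \<Longrightarrow> f differentiable (at x)"
proof -
  assume "smooth f" then have "k_smooth (Suc 0) f" by (rule smooth_k)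
  then show ?thesis by (simp add: differentiable_on_def)
qed
lemma smooth_has_derivative: "smooth f \<Longrightarrow> (f has_derivative frechet_derivative f (at x)) (at x)"
  using smooth_diff frechet_derivative_works by blast
lemma k_smooth_const: "k_smooth k (\<lambda>x. c)"
proof (induction k arbitrary: c)
  case (Suc k)
  have "partial_deriv i (\<lambda>x::real^'a. c) = (\<lambda>x. 0)" for i by (rule ext) (simp add: partial_deriv_eq[OF has_derivative_const])
  with Suc show ?case by simp
qed simp

lemma k_smooth_component: "k_smooth k (\<lambda>x. x $ j)"
proof (cases k)
  case (Suc k')
  have d: "((\<lambda>x::real^'a. x $ j) has_derivative (\<lambda>h. h $ j)) (at x)" for x
    by (rule bounded_linear.has_derivative[OF bounded_linear_vec_nth has_derivative_ident])
  have "partial_deriv i (\<lambda>x::real^'a. x $ j) = (\<lambda>x. axis i 1 $ j)" for i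
    by (rule ext) (simp add: partial_deriv_eq[OF d])
  moreover have "(\<lambda>x::real^'a. x $ j) differentiable_on UNIV"
    using d by (auto simp: differentiable_on_def differentiable_def)
  ultimately show ?thesis using Suc by (simp add: k_smooth_const)
qed (auto intro!: continuous_intros)

lemma k_smooth_add: "k_smooth k f \<Longrightarrow> k_smooth k g \<Longrightarrow> k_smooth k (\<lambda>x. f x + g x)"
proof (induction k arbitrary: f g)
  case 0 then show ?case by (auto intro: continuous_intros)
next
  case (Suc k)
  then have d: "f differentiable at x" "g differentiable at x" for x by (auto simp: differentiable_on_def)
  have "partial_deriv i (\<lambda>x. f x + g x) = (\<lambda>x. partial_deriv i f x + partial_deriv i g x)" for i
  proof
    fix x
    show "partial_deriv i (\<lambda>x. f x + g x) x = partial_deriv i f x + partial_deriv i g x"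
      using partial_deriv_eq[OF has_derivative_add[OF d(1)[unfolded frechet_derivative_works] d(2)[unfolded frechet_derivative_works]]]
      by (simp add: partial_deriv_def)
  qed
  then show ?case using Suc by (auto intro: differentiable_on_add)
qed

lemma k_smooth_mult: "k_smooth k f \<Longrightarrow> k_smooth k g \<Longrightarrow> k_smooth k (\<lambda>x. f x * g x)"
proof (induction k arbitrary: f g)
  case 0 then show ?case by (auto intro: continuous_intros)
next
  case (Suc k)
  then have d: "f differentiable at x" "g differentiable at x" for x by (auto simp: differentiable_on_def)
  have "partial_deriv i (\<lambda>x. f x * g x) = (\<lambda>x. f x * partial_deriv i g x + partial_deriv i f x * g x)" for i
  proof
    fix x
    show "partial_deriv i (\<lambda>x. f x * g x) x = f x * partial_deriv i g x + partial_deriv i f x * g x"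
      using partial_deriv_eq[OF has_derivative_mult[OF d(1)[unfolded frechet_derivative_works] d(2)[unfolded frechet_derivative_works]]]
      by (simp add: partial_deriv_def)
  qed
  moreover have "k_smooth k f" "k_smooth k g" using Suc.prems k_smooth_SucD by blast+
  moreover have "(\<lambda>x. f x * g x) differentiable_on UNIV"
    using d by (auto simp: differentiable_on_def)
  ultimately show ?case using Suc by (auto intro: k_smooth_add)
qed

lemma smooth_const: "smooth (\<lambda>x. c)" by (simp add: smooth_def k_smooth_const)
lemma smooth_component: "smooth (\<lambda>x. x $ j)" by (simp add: smooth_def k_smooth_component)
lemma smooth_add: "smooth f \<Longrightarrow> smooth g \<Longrightarrow> smooth (\<lambda>x. f x + g x)" by (simp add: smooth_def k_smooth_add)
lemma smooth_mult: "smooth f \<Longrightarrow> smooth g \<Longrightarrow> smooth (\<lambda>x. f x * g x)" by (simp add: smooth_def k_smooth_mult)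
lemma smooth_diff_fun: "smooth f \<Longrightarrow> smooth g \<Longrightarrow> smooth (\<lambda>x. f x - g x)"
  using smooth_add[OF _ smooth_mult[OF smooth_const, of g "-1"], of f] by simp
lemma smooth_prod: "(\<And>i. i \<in> I \<Longrightarrow> smooth (f i)) \<Longrightarrow> smooth (\<lambda>x. \<Prod>i\<in>I. f i x)"
  by (induction I rule: infinite_finite_induct) (auto intro: smooth_const smooth_mult)
lemma smooth_sum: "(\<And>i. i \<in> I \<Longrightarrow> smooth (f i)) \<Longrightarrow> smooth (\<lambda>x. \<Sum>i\<in>I. f i x)"
  by (induction I rule: infinite_finite_induct) (auto intro: smooth_const smooth_add)

text \<open>
  \<open>h\<close> lists the successive derivatives of an outer function. They are needed at values of \<open>f\<close> only, which
  admits functions such as \<open>1 / (|x|\<^sup>2 + e)\<close>.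
\<close>
lemma smooth_compose:
  assumes h: "\<And>j x. (h j has_real_derivative h (Suc j) (f x)) (at (f x))" and f: "smooth f"
  shows "smooth (\<lambda>x. h (j::nat) (f x))"
proof -
  have hd: "((\<lambda>x. h j (f x)) has_derivative (\<lambda>v. frechet_derivative f (at x) v * h (Suc j) (f x))) (at x)" for j x
    using has_derivative_compose[OF smooth_has_derivative[OF f, of x] h[of j x, unfolded has_field_derivative_def]]
    by (simp add: mult.commute)
  have "k_smooth k (\<lambda>x. h j (f x))" for k
  proof (induction k arbitrary: j)
    case 0 then show ?case
      using hd has_derivative_continuous by (fastforce simp: continuous_on_eq_continuous_within)
  next
    case (Suc k)
    have "partial_deriv i (\<lambda>x. h j (f x)) = (\<lambda>x. partial_deriv i f x * h (Suc j) (f x))" for i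
      by (rule ext) (simp add: partial_deriv_eq[OF hd] partial_deriv_def)
    moreover have "(\<lambda>x. h j (f x)) differentiable_on UNIV"
      using hd by (auto simp: differentiable_on_def differentiable_def)
    ultimately show ?case using Suc smooth_k[OF smooth_pd[OF f]] by (auto intro: k_smooth_mult)
  qed
  then show ?thesis by (simp add: smooth_def)
qed

lemma smooth_affine:
  fixes f :: "real^'n::finite \<Rightarrow> real"
  assumes f: "smooth f"
  shows "smooth (\<lambda>x. f (v + c *\<^sub>R x))"
    and "partial_deriv i (\<lambda>x. f (v + c *\<^sub>R x)) x = c * partial_deriv i f (v + c *\<^sub>R x)"
proof -
  have hd: "((\<lambda>x. g (v + c *\<^sub>R x)) has_derivative (\<lambda>h. frechet_derivative g (at (v + c *\<^sub>R x)) (c *\<^sub>R h))) (at x)"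
    if "smooth g" for g :: "real^'n \<Rightarrow> real" and x
  proof (rule has_derivative_compose[OF _ smooth_has_derivative[OF that]])
    show "((\<lambda>x. v + c *\<^sub>R x) has_derivative (\<lambda>h. c *\<^sub>R h)) (at x)"
      by (auto intro!: derivative_eq_intros)
  qed
  have pd: "partial_deriv i (\<lambda>x. g (v + c *\<^sub>R x)) = (\<lambda>x. c * partial_deriv i g (v + c *\<^sub>R x))"
    if g: "smooth g" for g :: "real^'n \<Rightarrow> real" and i
  proof
    fix x
    show "partial_deriv i (\<lambda>x. g (v + c *\<^sub>R x)) x = c * partial_deriv i g (v + c *\<^sub>R x)"
      using linear_scale[OF has_derivative_linear[OF smooth_has_derivative[OF g]], of "v + c *\<^sub>R x" c "axis i 1"]
      by (simp add: partial_deriv_eq[OF hd[OF g]] partial_deriv_def)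
  qed
  then show "partial_deriv i (\<lambda>x. f (v + c *\<^sub>R x)) x = c * partial_deriv i f (v + c *\<^sub>R x)" using f by simp
  have "smooth g \<Longrightarrow> k_smooth k (\<lambda>x. g (v + c *\<^sub>R x))" for k and g :: "real^'n \<Rightarrow> real"
  proof (induction k arbitrary: g)
    case 0
    then show ?case using hd[OF 0] has_derivative_continuous by (fastforce simp: continuous_on_eq_continuous_within)
  next
    case (Suc k)
    then show ?case using hd[OF Suc.prems] pd[OF Suc.prems] Suc.IH[OF smooth_pd[OF Suc.prems]]
      by (auto simp: differentiable_on_def differentiable_def intro!: k_smooth_mult k_smooth_const)
  qed
  then show "smooth (\<lambda>x. f (v + c *\<^sub>R x))" using f by (simp add: smooth_def)
qed

section \<open>Complex-valued smooth functions and test functions\<close>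

text \<open>
  Test functions of the weak formulation are real. Real and imaginary parts are treated together, so that
  complex multipliers act on test functions.
\<close>
definition csmooth :: "(real^'n::finite \<Rightarrow> complex) \<Rightarrow> bool" where
  "csmooth m \<longleftrightarrow> smooth (\<lambda>x. Re (m x)) \<and> smooth (\<lambda>x. Im (m x))"
definition cpd :: "'n::finite \<Rightarrow> (real^'n \<Rightarrow> complex) \<Rightarrow> real^'n \<Rightarrow> complex" where
  "cpd i m x = Complex (partial_deriv i (\<lambda>x. Re (m x)) x) (partial_deriv i (\<lambda>x. Im (m x)) x)"
definition ctest :: "(real^'n::finite \<Rightarrow> complex) \<Rightarrow> bool" where
  "ctest \<theta> \<longleftrightarrow> csmooth \<theta> \<and> (\<exists>R. \<forall>x. \<theta> x \<noteq> 0 \<longrightarrow> norm x \<le> R)"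

lemma test_function_iff: "test_function \<eta> \<longleftrightarrow> smooth \<eta> \<and> (\<exists>R. \<forall>x. \<eta> x \<noteq> 0 \<longrightarrow> norm x \<le> R)"
proof -
  have "compact (closure {x. \<eta> x \<noteq> 0}) \<longleftrightarrow> bounded {x. \<eta> x \<noteq> 0}" by simp
  then show ?thesis unfolding test_function_def smooth_def bounded_iff by auto
qed

lemma ctest_test:
  assumes "ctest \<theta>" shows "test_function (\<lambda>x. Re (\<theta> x))" "test_function (\<lambda>x. Im (\<theta> x))"
proof -
  from assms obtain R where "\<forall>x. \<theta> x \<noteq> 0 \<longrightarrow> norm x \<le> R" by (auto simp: ctest_def)
  then have "\<forall>x. Re (\<theta> x) \<noteq> 0 \<longrightarrow> norm x \<le> R" "\<forall>x. Im (\<theta> x) \<noteq> 0 \<longrightarrow> norm x \<le> R" by (metis zero_complex.sel)+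
  with assms show "test_function (\<lambda>x. Re (\<theta> x))" "test_function (\<lambda>x. Im (\<theta> x))"
    by (auto simp: test_function_iff ctest_def csmooth_def)
qed

lemma test_ctest: "test_function \<eta> \<Longrightarrow> ctest (\<lambda>x. of_real (\<eta> x) * c)"
  unfolding test_function_iff ctest_def csmooth_def
  by (auto intro!: smooth_mult smooth_const exI)

lemma cpd_of_real: "test_function \<eta> \<Longrightarrow> cpd i (\<lambda>x. of_real (\<eta> x) * c) x = of_real (partial_deriv i \<eta> x) * c"
proof -
  assume "test_function \<eta>"
  then have d: "(\<eta> has_derivative frechet_derivative \<eta> (at x)) (at x)" by (intro smooth_has_derivative) (simp add: test_function_iff)
  show ?thesis
    using partial_deriv_eq[OF has_derivative_mult_left[OF d, of "Re c"], of i]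
      partial_deriv_eq[OF has_derivative_mult_left[OF d, of "Im c"], of i]
    by (simp add: cpd_def complex_eq_iff partial_deriv_def)
qed

lemma csmooth_has_derivative:
  assumes "csmooth m"
  obtains D where "(m has_derivative D) (at x)" "\<And>i. cpd i m x = D (axis i 1)"
proof -
  let ?R = "frechet_derivative (\<lambda>x. Re (m x)) (at x)" and ?I = "frechet_derivative (\<lambda>x. Im (m x)) (at x)"
  have "((\<lambda>x. of_real (Re (m x)) + \<i> * of_real (Im (m x))) has_derivative (\<lambda>h. of_real (?R h) + \<i> * of_real (?I h))) (at x)"
    using assms by (intro derivative_intros smooth_has_derivative) (auto simp: csmooth_def)
  then have "(m has_derivative (\<lambda>h. of_real (?R h) + \<i> * of_real (?I h))) (at x)"
    by (simp add: complex_eq[symmetric])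
  moreover have "cpd i m x = of_real (?R (axis i 1)) + \<i> * of_real (?I (axis i 1))" for i
    by (simp add: cpd_def partial_deriv_def Complex_eq)
  ultimately show thesis using that by blast
qed

lemma cpd_eqI:
  assumes m: "csmooth m" and d: "(m has_derivative D) (at x)"
  shows "cpd i m x = D (axis i 1)"
proof -
  obtain D' where D': "(m has_derivative D') (at x)" "\<And>i. cpd i m x = D' (axis i 1)"
    using csmooth_has_derivative[OF m] by blast
  then show ?thesis using has_derivative_unique[OF d D'(1)] by simp
qed

lemma csmooth_cpd: "csmooth m \<Longrightarrow> csmooth (cpd i m)"
  by (simp add: csmooth_def cpd_def smooth_pd)

lemma csmooth_continuous: "csmooth m \<Longrightarrow> continuous_on UNIV m"
  using csmooth_has_derivative has_derivative_continuous
  by (metis continuous_at_imp_continuous_on)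

lemma csmooth_measurable: "csmooth m \<Longrightarrow> m \<in> borel_measurable lebesgue"
  using csmooth_continuous borel_measurable_continuous_onI measurable_completion measurable_lborel1 by (metis measurable_lborel2)

lemma csmooth_mult: "csmooth m \<Longrightarrow> csmooth k \<Longrightarrow> csmooth (\<lambda>x. m x * k x)"
  unfolding csmooth_def by (auto intro!: smooth_mult smooth_add smooth_diff_fun)
lemma csmooth_add: "csmooth m \<Longrightarrow> csmooth k \<Longrightarrow> csmooth (\<lambda>x. m x + k x)"
  unfolding csmooth_def by (auto intro!: smooth_add)
lemma csmooth_const: "csmooth (\<lambda>x. c)" unfolding csmooth_def by (auto intro!: smooth_const)
lemma csmooth_cnj: "csmooth m \<Longrightarrow> csmooth (\<lambda>x. cnj (m x))"
  unfolding csmooth_def using smooth_mult[OF smooth_const, of _ "-1"] by fastforce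
lemma csmooth_of_real: "smooth f \<Longrightarrow> csmooth (\<lambda>x. of_real (f x))"
  unfolding csmooth_def by (auto intro!: smooth_const)
lemma csmooth_affine: "csmooth m \<Longrightarrow> csmooth (\<lambda>x. m (v + c *\<^sub>R x))"
  unfolding csmooth_def using smooth_affine by blast
lemma cpd_affine: "csmooth m \<Longrightarrow> cpd i (\<lambda>x. m (v + c *\<^sub>R x)) x = c *\<^sub>R cpd i m (v + c *\<^sub>R x)"
  using smooth_affine(2)[where f = "\<lambda>x. Re (m x)" and v = v and c = c and i = i and x = x]
    smooth_affine(2)[where f = "\<lambda>x. Im (m x)" and v = v and c = c and i = i and x = x]
  unfolding csmooth_def cpd_def by (simp add: complex_eq_iff)

lemma cpd_mult:
  assumes "csmooth m" "csmooth k"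
  shows "cpd i (\<lambda>x. m x * k x) x = m x * cpd i k x + cpd i m x * k x"
proof -
  obtain D E where "(m has_derivative D) (at x)" "(k has_derivative E) (at x)"
    "cpd i m x = D (axis i 1)" "cpd i k x = E (axis i 1)"
    using csmooth_has_derivative[OF assms(1)] csmooth_has_derivative[OF assms(2)] by metis
  then show ?thesis using cpd_eqI[OF csmooth_mult[OF assms] has_derivative_mult] by simp
qed

lemma cpd_cnj:
  assumes "csmooth m" shows "cpd i (\<lambda>x. cnj (m x)) x = cnj (cpd i m x)"
proof -
  obtain D where "(m has_derivative D) (at x)" "cpd i m x = D (axis i 1)"
    using csmooth_has_derivative[OF assms] by metis
  then show ?thesis
    using cpd_eqI[OF csmooth_cnj[OF assms] bounded_linear.has_derivative[OF bounded_linear_cnj]] by simp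
qed

lemma ctest_csmooth: "ctest \<theta> \<Longrightarrow> csmooth \<theta>" by (simp add: ctest_def)

lemma ctest_mult: "csmooth m \<Longrightarrow> ctest \<theta> \<Longrightarrow> ctest (\<lambda>x. m x * \<theta> x)"
  unfolding ctest_def by (auto intro: csmooth_mult)

lemma ctest_add: "ctest \<theta> \<Longrightarrow> ctest \<eta> \<Longrightarrow> ctest (\<lambda>x. \<theta> x + \<eta> x)"
proof -
  assume a: "ctest \<theta>" "ctest \<eta>"
  then obtain R S where "\<forall>x. \<theta> x \<noteq> 0 \<longrightarrow> norm x \<le> R" "\<forall>x. \<eta> x \<noteq> 0 \<longrightarrow> norm x \<le> S" by (auto simp: ctest_def)
  then have "\<forall>x. \<theta> x + \<eta> x \<noteq> 0 \<longrightarrow> norm x \<le> max R S" by (metis add.right_neutral add.left_neutral le_max_iff_disj)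
  with a show ?thesis unfolding ctest_def by (auto intro: csmooth_add)
qed

lemma ctest_cpd: "ctest \<theta> \<Longrightarrow> ctest (cpd i \<theta>)"
proof -
  assume a: "ctest \<theta>"
  then obtain R where R: "\<forall>x. \<theta> x \<noteq> 0 \<longrightarrow> norm x \<le> R" by (auto simp: ctest_def)
  have "cpd i \<theta> x = 0" if x: "norm x > R" for x
  proof -
    have "open {y::real^'a. norm y > R}" by (intro open_Collect_less continuous_intros)
    then have "\<forall>\<^sub>F y in nhds x. norm y > R" using x eventually_nhds by blast
    then have ev: "\<forall>\<^sub>F y in nhds x. (0::complex) = \<theta> y" by eventually_elim (use R in force)
    then have "(\<theta> has_derivative (\<lambda>h. 0)) (at x)"
      using has_derivative_transform_eventually[OF has_derivative_const, of 0 \<theta> x UNIV] ev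
      by (simp add: eventually_nhds_conv_at)
    then show ?thesis using cpd_eqI[OF ctest_csmooth[OF a]] by blast
  qed
  then have "\<forall>x. cpd i \<theta> x \<noteq> 0 \<longrightarrow> norm x \<le> R" by (meson not_less)
  with a show ?thesis unfolding ctest_def by (auto intro: csmooth_cpd)
qed

lemma ctest_affine:
  assumes c: "c > 0" and t: "ctest \<theta>" shows "ctest (\<lambda>x. \<theta> (v + c *\<^sub>R x))"
proof -
  obtain R where R: "\<forall>x. \<theta> x \<noteq> 0 \<longrightarrow> norm x \<le> R" using t by (auto simp: ctest_def)
  have "norm x \<le> (R + norm v) / c" if "\<theta> (v + c *\<^sub>R x) \<noteq> 0" for x
  proof -
    have "norm (c *\<^sub>R x) \<le> norm (v + c *\<^sub>R x) + norm v"
      using norm_triangle_ineq4[of "v + c *\<^sub>R x" v] by simp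
    also have "\<dots> \<le> R + norm v" using R that by simp
    finally show ?thesis using c by (simp add: field_simps)
  qed
  with t show ?thesis unfolding ctest_def by (auto intro: csmooth_affine)
qed

lemma ctest_bound:
  assumes "ctest \<theta>" obtains R C where "R > 0" "C > 0" "\<And>x. \<theta> x \<noteq> 0 \<Longrightarrow> norm x \<le> R" "\<And>x. cmod (\<theta> x) \<le> C"
proof -
  obtain R where R: "\<forall>x. \<theta> x \<noteq> 0 \<longrightarrow> norm x \<le> R" using assms by (auto simp: ctest_def)
  have "compact (\<theta> ` cball 0 R)"
    using csmooth_continuous[OF ctest_csmooth[OF assms]]
    by (intro compact_continuous_image) (auto intro: continuous_on_subset)
  then obtain C where C: "\<And>x. x \<in> cball 0 R \<Longrightarrow> cmod (\<theta> x) \<le> C"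
    by (meson bounded_iff compact_imp_bounded imageI)
  have "cmod (\<theta> x) \<le> \<bar>C\<bar> + 1" for x
    using C[of x] R by (cases "\<theta> x = 0") force+
  moreover have "norm x \<le> \<bar>R\<bar> + 1" if "\<theta> x \<noteq> 0" for x
    using R that abs_ge_self[of R] by (smt (verit))
  ultimately show thesis by (intro that[of "\<bar>R\<bar> + 1" "\<bar>C\<bar> + 1"]) auto
qed

lemma integrable_ball_indicator: "integrable lebesgue (\<lambda>x::real^'n::finite. (if norm x \<le> R then C else 0 :: real))"
proof -
  have "integrable lebesgue (indicator (cball (0::real^'n) R) :: _ \<Rightarrow> real)"
    using emeasure_bounded_finite[OF bounded_cball, of "0::real^'n" R] by (intro integrable_real_indicator) auto
  then have "integrable lebesgue (\<lambda>x::real^'n. C * indicator (cball 0 R) x)" by (rule integrable_mult_right)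
  moreover have "(\<lambda>x::real^'n. C * indicator (cball 0 R) x) = (\<lambda>x. if norm x \<le> R then C else 0)"
    by (auto simp: indicator_def)
  ultimately show ?thesis by simp
qed

lemma ctest_L2: assumes "ctest \<theta>" shows "L2_function \<theta>"
proof -
  obtain R C where RC: "R > 0" "C > 0" "\<And>x. \<theta> x \<noteq> 0 \<Longrightarrow> norm x \<le> R" "\<And>x. cmod (\<theta> x) \<le> C"
    using ctest_bound[OF assms] by blast
  show ?thesis
  proof (rule L2_bound[OF csmooth_measurable[OF ctest_csmooth[OF assms]] integrable_ball_indicator[of R "C\<^sup>2"]])
    show "AE x in lebesgue. (cmod (\<theta> x))\<^sup>2 \<le> (if norm x \<le> R then C\<^sup>2 else 0)"
    proof (intro AE_I2)
      fix x
      show "(cmod (\<theta> x))\<^sup>2 \<le> (if norm x \<le> R then C\<^sup>2 else 0)"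
        using RC(3)[of x] RC(4)[of x] by (auto intro: power_mono)
    qed
  qed
qed

section \<open>Bump functions and density of test functions\<close>

text \<open>
  These functions contain \<open>exp (- 1 / s)\<close>, extended by \<open>0\<close>, and are closed under differentiation.
\<close>
definition flat :: "real poly \<Rightarrow> real \<Rightarrow> real" where
  "flat p s = (if s > 0 then poly p (1 / s) * exp (- 1 / s) else 0)"

definition flat_step :: "real poly \<Rightarrow> real poly" where
  "flat_step p = [:0, 0, 1:] * (p - pderiv p)"

lemma poly_exp_tendsto_0: "((\<lambda>x::real. poly p x * exp (- x)) \<longlongrightarrow> 0) at_top"
proof -
  have "((\<lambda>x::real. \<Sum>i\<le>degree p. coeff p i * (x ^ i / exp x)) \<longlongrightarrow> (\<Sum>i\<le>degree p. coeff p i * 0)) at_top"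
    by (intro tendsto_intros tendsto_power_div_exp_0)
  moreover have "(\<Sum>i\<le>degree p. coeff p i * (x ^ i / exp x)) = poly p x * exp (- x)" for x :: real
    by (simp add: poly_altdef sum_distrib_right exp_minus divide_inverse mult.assoc)
  ultimately show ?thesis by simp
qed

lemma flat_deriv: "(flat p has_real_derivative flat (flat_step p) s) (at s)"
proof -
  consider "s > 0" | "s < 0" | "s = 0" by linarith
  then show ?thesis
  proof cases
    case 1
    have "((\<lambda>s. poly p (1 / s) * exp (- 1 / s)) has_real_derivative flat (flat_step p) s) (at s)"
    proof -
      have "((\<lambda>s. 1 / s) has_real_derivative - (1 / s\<^sup>2)) (at s)"
        using 1 by (auto intro!: derivative_eq_intros simp: power2_eq_square)
      from DERIV_chain2[OF poly_DERIV this] 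
      have "((\<lambda>s. poly p (1 / s)) has_real_derivative poly (pderiv p) (1 / s) * - (1 / s\<^sup>2)) (at s)" .
      moreover have "((\<lambda>s. exp (- 1 / s)) has_real_derivative exp (- 1 / s) * (1 / s\<^sup>2)) (at s)"
        using 1 by (auto intro!: derivative_eq_intros simp: power2_eq_square)
      ultimately have "((\<lambda>s. poly p (1 / s) * exp (- 1 / s)) has_real_derivative
         poly (pderiv p) (1 / s) * - (1 / s\<^sup>2) * exp (- 1 / s) + exp (- 1 / s) * (1 / s\<^sup>2) * poly p (1 / s)) (at s)"
        by (rule DERIV_mult)
      moreover have "poly (pderiv p) (1 / s) * - (1 / s\<^sup>2) * exp (- 1 / s) + exp (- 1 / s) * (1 / s\<^sup>2) * poly p (1 / s)
        = flat (flat_step p) s"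
        using 1 by (simp add: flat_def flat_step_def power2_eq_square algebra_simps)
      ultimately show ?thesis by simp
    qed
    then show ?thesis
      by (rule has_field_derivative_transform_within_open[of _ _ _ "{0<..}"]) (use 1 in \<open>auto simp: flat_def\<close>)
  next
    case 2
    have "((\<lambda>s. 0) has_real_derivative flat (flat_step p) s) (at s)" using 2 by (simp add: flat_def)
    then show ?thesis
      by (rule has_field_derivative_transform_within_open[of _ _ _ "{..<0}"]) (use 2 in \<open>auto simp: flat_def\<close>)
  next
    case 3
    have "((\<lambda>h. flat p h / h) \<longlongrightarrow> 0) (at_left 0)"
      by (rule tendsto_eventually) (auto simp: eventually_at_filter flat_def)
    moreover have "((\<lambda>h. flat p h / h) \<longlongrightarrow> 0) (at_right 0)"
    proof -
      have "((\<lambda>h::real. poly ([:0, 1:] * p) (inverse h) * exp (- inverse h)) \<longlongrightarrow> 0) (at_right 0)"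
        by (rule filterlim_compose[OF poly_exp_tendsto_0 filterlim_inverse_at_top_right])
      then show ?thesis
        by (rule Lim_transform_eventually)
          (auto simp: eventually_at_filter flat_def field_simps)
    qed
    ultimately have "((\<lambda>h. flat p h / h) \<longlongrightarrow> 0) (at 0)" by (rule filterlim_split_at)
    then show ?thesis using 3 by (simp add: DERIV_def flat_def)
  qed
qed

lemma smooth_flat: "smooth f \<Longrightarrow> smooth (\<lambda>x. flat p (f x))"
  using smooth_compose[of "\<lambda>j. flat ((flat_step ^^ j) p)" f 0] flat_deriv by simp

lemma flat_one: "0 \<le> flat 1 s" "flat 1 s \<le> 1" "s \<le> 0 \<Longrightarrow> flat 1 s = 0"
  by (auto simp: flat_def)

lemma flat_one_tendsto: "(\<lambda>k. flat 1 (real (Suc k) * t)) \<longlonglongrightarrow> (if t > 0 then 1 else 0)"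
proof (cases "t > 0")
  case True
  have "(\<lambda>k. exp (- (inverse t) * inverse (real (Suc k)))) \<longlonglongrightarrow> exp (- (inverse t) * 0)"
    by (intro tendsto_intros LIMSEQ_inverse_real_of_nat)
  moreover have "flat 1 (real (Suc k) * t) = exp (- (inverse t) * inverse (real (Suc k)))" for k
    using True mult_pos_pos[of "real (Suc k)" t] by (simp add: flat_def field_simps del: of_nat_Suc)
  ultimately show ?thesis using True by simp
next
  case False
  then have "flat 1 (real (Suc k) * t) = 0" for k
    by (intro flat_one(3)) (simp add: mult_nonneg_nonpos)
  then show ?thesis using False by simp
qed

text \<open>
  Smooth approximations of the indicator of a box: each factor tends to \<open>1\<close> inside and is \<open>0\<close> outside.
\<close>
definition box_bump :: "real^'n::finite \<Rightarrow> real^'n \<Rightarrow> nat \<Rightarrow> real^'n \<Rightarrow> real" where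
  "box_bump a b k x = (\<Prod>i\<in>UNIV. flat 1 (real (Suc k) * (x $ i - a $ i)) * flat 1 (real (Suc k) * (b $ i - x $ i)))"

lemma box_bump_bounds: "0 \<le> box_bump a b k x" "box_bump a b k x \<le> 1" "x \<notin> box a b \<Longrightarrow> box_bump a b k x = 0"
proof -
  show "0 \<le> box_bump a b k x" unfolding box_bump_def by (intro prod_nonneg) (simp add: flat_one)
  show "box_bump a b k x \<le> 1" unfolding box_bump_def
    by (intro prod_le_1) (simp add: flat_one mult_le_one)
  assume "x \<notin> box a b"
  then obtain i where "\<not> (a $ i < x $ i \<and> x $ i < b $ i)" by (auto simp: mem_box_cart)
  then have "flat 1 (real (Suc k) * (x $ i - a $ i)) = 0 \<or> flat 1 (real (Suc k) * (b $ i - x $ i)) = 0"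
    by (auto intro!: flat_one(3) simp: mult_nonneg_nonpos not_less)
  then show "box_bump a b k x = 0" unfolding box_bump_def by (intro prod_zero) auto
qed

lemma box_bump_test: "test_function (box_bump a b k)"
  unfolding test_function_iff
proof
  show "smooth (box_bump a b k)" unfolding box_bump_def[abs_def]
    by (intro smooth_prod smooth_mult smooth_flat smooth_const smooth_diff_fun smooth_component)
  obtain R where "\<forall>x\<in>box a b. norm x \<le> R" using bounded_box[of a b] bounded_iff by blast
  then show "\<exists>R. \<forall>x. box_bump a b k x \<noteq> 0 \<longrightarrow> norm x \<le> R" using box_bump_bounds(3) by metis
qed

lemma box_bump_tendsto: "(\<lambda>k. box_bump a b k x) \<longlonglongrightarrow> indicator (box a b) x"
proof -
  let ?c = "\<lambda>i. (if x $ i - a $ i > 0 then 1 else 0) * (if b $ i - x $ i > 0 then 1 else (0::real))"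
  have "(\<lambda>k. box_bump a b k x) \<longlonglongrightarrow> (\<Prod>i\<in>UNIV. ?c i)"
    unfolding box_bump_def by (intro tendsto_prod tendsto_mult flat_one_tendsto)
  moreover have "(\<Prod>i\<in>UNIV. ?c i) = indicator (box a b) x"
  proof (cases "x \<in> box a b")
    case False
    then obtain i where "\<not> (a $ i < x $ i \<and> x $ i < b $ i)" by (auto simp: mem_box_cart)
    then have "(\<Prod>i\<in>UNIV. ?c i) = 0" by (intro prod_zero bexI[of _ i]) auto
    then show ?thesis using False by simp
  qed (simp add: mem_box_cart)
  ultimately show ?thesis by simp
qed

definition test_space :: "'n::finite l2 set" where
  "test_space = cls ` {\<theta>. ctest \<theta>}"

lemma test_space_subspace: "subspace (test_space :: 'n::finite l2 set)"
proof (rule subspaceI)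
  have "ctest (\<lambda>x::real^'n. 0)" unfolding ctest_def by (simp add: csmooth_const)
  then show "0 \<in> (test_space :: 'n l2 set)" unfolding test_space_def
    by (intro image_eqI[of _ _ "\<lambda>x. 0"]) (auto simp: cls_zero)
next
  fix a b :: "'n l2" assume "a \<in> test_space" "b \<in> test_space"
  then obtain \<theta> \<eta> where "ctest \<theta>" "ctest \<eta>" "a = cls \<theta>" "b = cls \<eta>" by (auto simp: test_space_def)
  then show "a + b \<in> test_space" unfolding test_space_def
    by (intro image_eqI[of _ _ "\<lambda>x. \<theta> x + \<eta> x"]) (auto simp: cls_add ctest_L2 ctest_add)
next
  fix c and a :: "'n l2" assume "a \<in> test_space"
  then obtain \<theta> where "ctest \<theta>" "a = cls \<theta>" by (auto simp: test_space_def)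
  then show "c *\<^sub>R a \<in> test_space" unfolding test_space_def
    using ctest_mult[OF csmooth_const, of \<theta> "of_real c"]
    by (intro image_eqI[of _ _ "\<lambda>x. of_real c * \<theta> x"]) (auto simp: cls_scaleR[symmetric] ctest_L2 scaleR_conv_of_real)
qed

text \<open>
  A function that is orthogonal to all test functions has vanishing integral over every box, by dominated
  convergence along \<open>box_bump\<close>, and therefore vanishes by Lebesgue's differentiation theorem.
\<close>
lemma test_space_total: "total_set (test_space :: 'n::finite l2 set)"
  unfolding total_set_def
proof (intro allI impI)
  fix a :: "'n l2" assume a: "\<forall>d\<in>test_space. a \<bullet> d = 0"
  have zero: "AE x in lebesgue. fn a x \<bullet> c = 0" for c
  proof -
    let ?I = "\<lambda>l u x. of_real (indicator (box l u) x) * c"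
    define g where "g x = fn a x \<bullet> c" for x
    have lim: "L2_function (?I l u) \<and> (\<lambda>k. cls (\<lambda>x. of_real (box_bump l u k x) * c)) \<longlonglongrightarrow> cls (?I l u)" for l u :: "real^'n"
    proof -
      have ib: "integrable lebesgue (\<lambda>x. (indicator (box l u) x * cmod c)\<^sup>2)"
      proof -
        have "integrable lebesgue (\<lambda>x. indicator (box l u) x * (cmod c)\<^sup>2)"
          using emeasure_bounded_finite[OF bounded_box, of l u]
          by (intro integrable_mult_left integrable_real_indicator) auto
        moreover have "(indicator (box l u) x * cmod c)\<^sup>2 = indicator (box l u) x * (cmod c)\<^sup>2" for x
          by (simp add: indicator_def)
        ultimately show ?thesis by simp
      qed
      have f1: "L2_function (\<lambda>x. of_real (box_bump l u k x) * c)" for k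
        by (intro ctest_L2 test_ctest box_bump_test)
      have f2: "?I l u \<in> borel_measurable lebesgue"
      proof (intro borel_measurable_times borel_measurable_const)
        have "(indicator (box l u) :: _ \<Rightarrow> real) \<in> borel_measurable lebesgue"
          by (intro borel_measurable_indicator) simp
        moreover have "complex_of_real \<in> borel_measurable borel"
          by (intro borel_measurable_continuous_onI continuous_intros)
        ultimately show "(\<lambda>x. complex_of_real (indicator (box l u) x)) \<in> borel_measurable lebesgue"
          by (rule measurable_compose)
      qed
      have f3: "AE x in lebesgue. cmod (of_real (box_bump l u k x) * c) \<le> indicator (box l u) x * cmod c" for k
      proof (intro AE_I2)
        fix x show "cmod (of_real (box_bump l u k x) * c) \<le> indicator (box l u) x * cmod c"
          using box_bump_bounds(1,2)[of l u k x] box_bump_bounds(3)[of x l u k] by (cases "x \<in> box l u") (auto simp: norm_mult mult_left_le_one_le)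
      qed
      have f4: "AE x in lebesgue. (\<lambda>k. of_real (box_bump l u k x) * c) \<longlonglongrightarrow> ?I l u x"
        by (intro AE_I2 tendsto_intros box_bump_tendsto)
      show ?thesis
        using l2_tendsto_dominated[where F = "\<lambda>k x. of_real (box_bump l u k x) * c", OF f1 f2 ib f3 f4] by (rule conjI)
    qed
    have int0: "(LINT x|lebesgue. indicator (box l u) x * g x) = 0" and
      int1: "integrable lebesgue (\<lambda>x. indicator (box l u) x * g x)" for l u :: "real^'n"
    proof -
      have eq: "fn a x \<bullet> ?I l u x = indicator (box l u) x * g x" for x
        by (simp add: g_def indicator_def)
      have "(\<lambda>k. a \<bullet> cls (\<lambda>x. of_real (box_bump l u k x) * c)) \<longlonglongrightarrow> a \<bullet> cls (?I l u)"
        using lim by (intro tendsto_intros) auto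
      moreover have "a \<bullet> cls (\<lambda>x. of_real (box_bump l u k x) * c) = 0" for k
        using a test_ctest[OF box_bump_test] unfolding test_space_def by blast
      ultimately have "a \<bullet> cls (?I l u) = 0" by (simp add: LIMSEQ_const_iff)
      then have "cls (fn a) \<bullet> cls (?I l u) = 0" by simp
      then show "(LINT x|lebesgue. indicator (box l u) x * g x) = 0"
        using inner_cls[OF L2_fn conjunct1[OF lim[of l u]], of a] eq by simp
      show "integrable lebesgue (\<lambda>x. indicator (box l u) x * g x)"
        using L2_prod_integrable(2)[OF L2_fn conjunct1[OF lim[of l u]], of a] eq by simp
    qed
    have si: "set_integrable lebesgue (box l u) g" for l u
      using int1[of l u] by (simp add: set_integrable_def)
    have "g integrable_on box l u" "integral (box l u) g = 0" for l u
      using set_lebesgue_integral_eq_integral[OF si] int0[of l u]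
      by (simp_all add: set_lebesgue_integral_def)
    then have gi: "g integrable_on cbox l u" "integral (cbox l u) g = 0" for l u
      by (simp_all add: integrable_on_open_interval integral_open_interval)
    obtain N where N: "negligible N"
      "\<And>x e. \<lbrakk>x \<notin> N; 0 < e\<rbrakk> \<Longrightarrow> \<exists>d>0. \<forall>h. 0 < h \<and> h < d \<longrightarrow>
                         norm (integral (cbox x (x + h *\<^sub>R One)) g /\<^sub>R h ^ DIM(real^'n) - g x) < e"
      using integrable_ccontinuous_explicit[OF gi(1)] by blast
    have "g x = 0" if x: "x \<notin> N" for x
    proof (rule ccontr)
      assume "g x \<noteq> 0"
      then obtain d where d: "d > 0" "\<forall>h. 0 < h \<and> h < d \<longrightarrow> norm (integral (cbox x (x + h *\<^sub>R One)) g /\<^sub>R h ^ DIM(real^'n) - g x) < norm (g x)"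
        using N(2)[OF x, of "norm (g x)"] by auto
      then have "norm (integral (cbox x (x + (d/2) *\<^sub>R One)) g /\<^sub>R (d/2) ^ DIM(real^'n) - g x) < norm (g x)"
        using d(1) by (intro d(2)[rule_format]) auto
      then show False by (simp add: gi(2))
    qed
    then show ?thesis using N(1) unfolding g_def negligible_iff_null_sets
      by (intro AE_I'[of N]) auto
  qed
  have "AE x in lebesgue. fn a x = fn 0 x"
    using zero[of 1] zero[of \<i>] fn_zero by eventually_elim (simp add: complex_eq_iff inner_complex_def)
  then show "a = 0" by (rule fn_eqI)
qed

section \<open>The groups of translations and of dilations\<close>

lemma csmooth_derivative_ex:
  assumes "csmooth m" shows "\<exists>D. (m has_derivative D) (at x) \<and> (\<forall>i. cpd i m x = D (axis i 1))"
  by (rule csmooth_has_derivative[OF assms, of x]) blast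

lemma affn_eq:
  "affn c v f = (\<lambda>x::real^'n::finite. of_real (c powr (real CARD('n) / 2)) * f (v + c *\<^sub>R x))"
  unfolding affn_def[abs_def] by (rule ext) (rule scaleR_conv_of_real)

lemma affn_ctest: "c > 0 \<Longrightarrow> ctest \<theta> \<Longrightarrow> ctest (affn c v \<theta>)"
  unfolding affn_eq
  by (intro ctest_mult csmooth_const ctest_affine)

lemma cpd_affn:
  fixes \<theta> :: "real^'n::finite \<Rightarrow> complex"
  assumes "ctest \<theta>" shows "cpd i (affn c v \<theta>) x = c *\<^sub>R affn c v (cpd i \<theta>) x"
proof -
  have t: "csmooth \<theta>" using assms by (rule ctest_csmooth)
  have z: "cpd i (\<lambda>x::real^'n. k) x = 0" for k
    using cpd_eqI[OF csmooth_const has_derivative_const] .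
  show ?thesis
    unfolding affn_eq
    by (simp add: cpd_mult[OF csmooth_const csmooth_affine[OF t]] z cpd_affine[OF t])
qed

lemma aff_test_space: "c > 0 \<Longrightarrow> d \<in> test_space \<Longrightarrow> aff c v d \<in> test_space"
  unfolding test_space_def by (auto simp: aff_cls ctest_L2 affn_ctest)

lemma aff_inverse:
  assumes c: "c > 0" shows "aff c 0 a \<bullet> b = a \<bullet> aff (1 / c) 0 b"
proof -
  have "b = aff c 0 (aff (1 / c) 0 b)" using c by (simp add: aff_aff aff_one)
  then have "aff c 0 a \<bullet> b = aff c 0 a \<bullet> aff c 0 (aff (1 / c) 0 b)" by simp
  then show ?thesis by (simp only: inner_aff[OF c])
qed

lemma translation_derivative:
  fixes \<theta> :: "real^'n::finite \<Rightarrow> complex"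
  assumes t: "ctest \<theta>"
  shows "((\<lambda>s. aff 1 (axis i s) (cls \<theta>)) has_vector_derivative cls (cpd i \<theta>)) (at 0)"
proof -
  obtain R C where RC: "R > 0" "C > 0" "\<And>x. cpd i \<theta> x \<noteq> 0 \<Longrightarrow> norm x \<le> R" "\<And>x. cmod (cpd i \<theta> x) \<le> C"
    using ctest_bound[OF ctest_cpd[OF t]] by metis
  define e :: "real^'n" where "e = axis i 1"
  have ax: "axis i s = s *\<^sub>R e" for s by (simp add: axis_def vec_eq_iff e_def)
  have na: "norm (axis i s) = \<bar>s\<bar>" for s unfolding ax by (simp add: e_def norm_axis_1)
  have "((\<lambda>s. cls (\<lambda>x. \<theta> (axis i s + x))) has_vector_derivative cls (\<lambda>x. cpd i \<theta> (axis i 0 + x))) (at 0)"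
  proof (rule l2_has_vector_derivative(2)[where \<delta> = 1 and F' = "\<lambda>s x. cpd i \<theta> (axis i s + x)"
        and b = "\<lambda>x. if norm x \<le> R + 1 then C else 0"])
    fix s x
    show "L2_function (\<lambda>x. \<theta> (axis i s + x))" using ctest_L2[OF ctest_affine[OF zero_less_one t]] by simp
    obtain D where D: "(\<theta> has_derivative D) (at (axis i s + x))" "\<And>j. cpd j \<theta> (axis i s + x) = D (axis j 1)"
      using csmooth_derivative_ex[OF ctest_csmooth[OF t], of "axis i s + x"] by auto
    have "((\<lambda>s. axis i s + x) has_derivative (\<lambda>h. h *\<^sub>R e)) (at s)"
      unfolding ax by (auto intro!: derivative_eq_intros)
    from has_derivative_compose[OF this D(1)]
    show "((\<lambda>s. \<theta> (axis i s + x)) has_vector_derivative cpd i \<theta> (axis i s + x)) (at s)"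
      unfolding has_vector_derivative_def D(2) e_def[symmetric]
      by (simp only: linear_scale[OF has_derivative_linear[OF D(1)]])
    assume s: "\<bar>s - 0\<bar> < 1"
    have "norm x \<le> R + 1" if "norm (axis i s + x) \<le> R"
      using norm_triangle_ineq4[of "axis i s + x" "axis i s"] that s by (simp add: na)
    then show "cmod (cpd i \<theta> (axis i s + x)) \<le> (if norm x \<le> R + 1 then C else 0)"
      using RC(3,4)[of "axis i s + x"] by (cases "cpd i \<theta> (axis i s + x) = 0") (use RC(2) in auto)
  next
    show "(\<lambda>x. cpd i \<theta> (axis i 0 + x)) \<in> borel_measurable lebesgue"
      unfolding ax using csmooth_measurable[OF ctest_csmooth[OF ctest_cpd[OF t]]] by simp
    have "(\<lambda>x::real^'n. (if norm x \<le> R + 1 then C else 0)\<^sup>2) = (\<lambda>x. if norm x \<le> R + 1 then C\<^sup>2 else 0)" by auto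
    then show "integrable lebesgue (\<lambda>x::real^'n. (if norm x \<le> R + 1 then C else 0)\<^sup>2)"
      using integrable_ball_indicator by metis
  qed simp
  then show ?thesis unfolding ax by (simp add: aff_cls ctest_L2[OF t] affn_def[abs_def])
qed

lemma dilation_derivative:
  fixes \<theta> :: "real^'n::finite \<Rightarrow> complex"
  assumes t: "ctest \<theta>"
  shows "((\<lambda>s. aff (exp s) 0 (cls \<theta>)) has_vector_derivative
    cls (\<lambda>x. (\<Sum>j\<in>UNIV. x $ j *\<^sub>R cpd j \<theta> x) + (real CARD('n) / 2) *\<^sub>R \<theta> x)) (at 0)"
proof -
  define N where "N = real CARD('n) / 2"
  define A where "A x = (\<Sum>j\<in>UNIV. x $ j *\<^sub>R cpd j \<theta> x) + N *\<^sub>R \<theta> x" for x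
  have A: "ctest A"
  proof -
    have s: "ctest (\<lambda>x. \<Sum>j\<in>I. x $ j *\<^sub>R cpd j \<theta> x)" if "finite I" for I
      using that
    proof (induction I rule: finite_induct)
      case empty
      then show ?case by (auto simp: ctest_def csmooth_const)
    next
      case (insert j I)
      then show ?case unfolding sum.insert[OF insert.hyps] scaleR_conv_of_real
        by (intro ctest_add ctest_mult csmooth_of_real smooth_component ctest_cpd t) (simp add: scaleR_conv_of_real)
    qed
    show ?thesis unfolding A_def[abs_def]
      by (intro ctest_add s) (use ctest_mult[OF csmooth_const t, of "of_real N"] in \<open>auto simp: scaleR_conv_of_real\<close>)
  qed
  obtain R C where RC: "R > 0" "C > 0" "\<And>x. A x \<noteq> 0 \<Longrightarrow> norm x \<le> R" "\<And>x. cmod (A x) \<le> C"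
    using ctest_bound[OF A] by metis
  have pw: "exp s powr (real CARD('n) / 2) = exp (s * N)" for s by (simp add: powr_def N_def)
  have "((\<lambda>s. cls (\<lambda>x. exp (s * N) *\<^sub>R \<theta> (exp s *\<^sub>R x))) has_vector_derivative
      cls (\<lambda>x. exp (0 * N) *\<^sub>R A (exp 0 *\<^sub>R x))) (at 0)"
  proof (rule l2_has_vector_derivative(2)[where \<delta> = 1 and F' = "\<lambda>s x. exp (s * N) *\<^sub>R A (exp s *\<^sub>R x)"
        and b = "\<lambda>x. if norm x \<le> R * exp 1 then exp N * C else 0"])
    fix s x
    show "L2_function (\<lambda>x. exp (s * N) *\<^sub>R \<theta> (exp s *\<^sub>R x))"
      by (intro L2_scaleR) (use ctest_L2[OF ctest_affine[OF _ t, of "exp s" 0]] in simp)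
    obtain D where D: "(\<theta> has_derivative D) (at (exp s *\<^sub>R x))" "\<And>i. cpd i \<theta> (exp s *\<^sub>R x) = D (axis i 1)"
      using csmooth_derivative_ex[OF ctest_csmooth[OF t], of "exp s *\<^sub>R x"] by auto
    have lD: "linear D" by (rule has_derivative_linear[OF D(1)])
    have "((\<lambda>s. exp s *\<^sub>R x) has_derivative (\<lambda>h. h *\<^sub>R exp s *\<^sub>R x)) (at s)"
      by (auto intro!: derivative_eq_intros)
    from has_derivative_compose[OF this D(1)]
    have 1: "((\<lambda>s. \<theta> (exp s *\<^sub>R x)) has_vector_derivative D (exp s *\<^sub>R x)) (at s)"
      unfolding has_vector_derivative_def by (simp only: linear_scale[OF lD])
    have "D (exp s *\<^sub>R x) = (\<Sum>j\<in>UNIV. (exp s *\<^sub>R x) $ j *\<^sub>R D (axis j 1))"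
    proof -
      have "exp s *\<^sub>R x = (\<Sum>j\<in>UNIV. (exp s *\<^sub>R x) $ j *\<^sub>R axis j 1)"
        using basis_expansion[of "exp s *\<^sub>R x"] by (simp add: scalar_mult_eq_scaleR)
      from arg_cong[OF this, of D] show ?thesis
        by (simp only: linear_sum[OF lD] linear_scale[OF lD])
    qed
    then have AD: "A (exp s *\<^sub>R x) = D (exp s *\<^sub>R x) + N *\<^sub>R \<theta> (exp s *\<^sub>R x)" by (simp add: A_def D(2))
    have 2: "((\<lambda>s. exp (s * N)) has_real_derivative exp (s * N) * N) (at s)"
      by (auto intro!: derivative_eq_intros)
    show "((\<lambda>s. exp (s * N) *\<^sub>R \<theta> (exp s *\<^sub>R x)) has_vector_derivative exp (s * N) *\<^sub>R A (exp s *\<^sub>R x)) (at s)"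
      using has_vector_derivative_scaleR[OF 2 1] by (simp add: AD scaleR_add_right)
    assume s: "\<bar>s - 0\<bar> < 1"
    have "norm x \<le> R * exp 1" if "norm (exp s *\<^sub>R x) \<le> R"
    proof -
      have "norm x = exp (- s) * norm (exp s *\<^sub>R x)" by (simp add: exp_minus)
      also have "\<dots> \<le> exp 1 * R" using that s by (intro mult_mono) auto
      finally show ?thesis by (simp add: mult.commute)
    qed
    moreover have "exp (s * N) * cmod (A (exp s *\<^sub>R x)) \<le> exp N * C"
      using RC s by (intro mult_mono) (auto simp: N_def mult_left_le_one_le abs_le_iff)
    ultimately show "cmod (exp (s * N) *\<^sub>R A (exp s *\<^sub>R x)) \<le> (if norm x \<le> R * exp 1 then exp N * C else 0)"
      using RC(3)[of "exp s *\<^sub>R x"] by (cases "A (exp s *\<^sub>R x) = 0") (use RC(2) in auto)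
  next
    show "(\<lambda>x. exp (0 * N) *\<^sub>R A (exp 0 *\<^sub>R x)) \<in> borel_measurable lebesgue"
      using csmooth_measurable[OF ctest_csmooth[OF A]] by simp
    have "(\<lambda>x::real^'n. (if norm x \<le> R * exp 1 then exp N * C else 0)\<^sup>2) = (\<lambda>x. if norm x \<le> R * exp 1 then (exp N * C)\<^sup>2 else 0)" by auto
    then show "integrable lebesgue (\<lambda>x::real^'n. (if norm x \<le> R * exp 1 then exp N * C else 0)\<^sup>2)"
      using integrable_ball_indicator by metis
  qed simp
  then show ?thesis by (simp add: aff_cls ctest_L2[OF t] affn_def[abs_def] pw A_def N_def)
qed

text \<open>
  Only the values on \<open>test_space\<close> matter, where the derivative exists.
\<close>
definition generator :: "(real \<Rightarrow> 'n::finite l2 \<Rightarrow> 'n l2) \<Rightarrow> 'n l2 \<Rightarrow> 'n l2" where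
  "generator T a = vector_derivative (\<lambda>s. T s a) (at 0)"

lemma generator_works:
  assumes "\<And>\<theta>. ctest \<theta> \<Longrightarrow> \<exists>b. ((\<lambda>s. T s (cls \<theta>)) has_vector_derivative b) (at 0)" "d \<in> test_space"
  shows "((\<lambda>s. T s d) has_vector_derivative generator T d) (at 0)"
  using assms unfolding test_space_def generator_def by (auto dest: vector_derivative_at)

lemma translation_group:
  fixes i :: "'n::finite"
  shows "isometry_group (\<lambda>s. aff 1 (axis i s)) test_space (generator (\<lambda>s. aff 1 (axis i s)))"
proof (rule isometry_group.intro)
  show "linear (aff 1 (axis i s) :: 'n l2 \<Rightarrow> 'n l2)" for s by (rule aff_linear) simp
  have ax: "axis i (s + r) = axis i r + axis i s" "axis i (0::real) = 0" for s r :: real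
    by (simp_all add: axis_def vec_eq_iff)
  show "aff 1 (axis i (s + r)) x = aff 1 (axis i s) (aff 1 (axis i r) x)" for s r and x :: "'n l2"
    by (simp add: aff_aff ax)
  show "aff 1 (axis i 0) x = x" for x :: "'n l2" unfolding ax by (rule aff_one)
  show "d \<in> test_space \<Longrightarrow> ((\<lambda>s. aff 1 (axis i s) d) has_vector_derivative generator (\<lambda>s. aff 1 (axis i s)) d) (at 0)"
    for d :: "'n l2"
    by (rule generator_works) (use translation_derivative in blast)
  show "norm (aff 1 (axis i s) x) = norm x" for s and x :: "'n l2" by (rule norm_aff) simp
  show "subspace (test_space :: 'n l2 set)" by (rule test_space_subspace)
  show "total_set (test_space :: 'n l2 set)" by (rule test_space_total)
  show "d \<in> test_space \<Longrightarrow> aff 1 (axis i s) d \<in> test_space" for s and d :: "'n l2" by (rule aff_test_space) simp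
qed

lemma dilation_group:
  "isometry_group (\<lambda>s. aff (exp s) 0) (test_space :: 'n::finite l2 set) (generator (\<lambda>s. aff (exp s) 0))"
proof (rule isometry_group.intro)
  show "linear (aff (exp s) 0 :: 'n l2 \<Rightarrow> 'n l2)" for s by (rule aff_linear) simp
  show "aff (exp (s + r)) 0 x = aff (exp s) 0 (aff (exp r) 0 x)" for s r and x :: "'n l2"
    by (simp add: aff_aff exp_add)
  show "aff (exp 0) 0 x = x" for x :: "'n l2" by (simp add: aff_one)
  show "d \<in> test_space \<Longrightarrow> ((\<lambda>s. aff (exp s) 0 d) has_vector_derivative generator (\<lambda>s. aff (exp s) 0) d) (at 0)"
    for d :: "'n l2"
    by (rule generator_works) (use dilation_derivative in blast)
  show "norm (aff (exp s) 0 x) = norm x" for s and x :: "'n l2" by (rule norm_aff) simp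
  show "subspace (test_space :: 'n l2 set)" by (rule test_space_subspace)
  show "total_set (test_space :: 'n l2 set)" by (rule test_space_total)
  show "d \<in> test_space \<Longrightarrow> aff (exp s) 0 d \<in> test_space" for s and d :: "'n l2" by (rule aff_test_space) simp
qed

lemma generator_translation: "ctest \<theta> \<Longrightarrow> generator (\<lambda>s. aff 1 (axis i s)) (cls \<theta>) = cls (cpd i \<theta>)"
  unfolding generator_def by (rule vector_derivative_at[OF translation_derivative])

section \<open>The Sobolev space of order one\<close>

text \<open>
  Pairs of a function and its weak gradient. Keeping the gradient as a component makes the space a closed
  subspace of a product of copies of the Hilbert space.
\<close>
definition H1 :: "('n::finite l2 \<times> ('n l2 ^ 'n)) set" where
  "H1 = {(\<phi>, G). \<forall>\<theta> i. ctest \<theta> \<longrightarrow> \<phi> \<bullet> cls (cpd i \<theta>) = - (G $ i \<bullet> cls \<theta>)}"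

lemma H1_test: "(\<phi>, G) \<in> H1 \<Longrightarrow> ctest \<theta> \<Longrightarrow> \<phi> \<bullet> cls (cpd i \<theta>) = - (G $ i \<bullet> cls \<theta>)"
  by (auto simp: H1_def)

lemma H1_translation:
  assumes "(\<phi>, G) \<in> H1"
  shows "((\<lambda>s. aff 1 (axis i s) \<phi>) has_vector_derivative G $ i) (at 0)"
proof -
  have "((\<lambda>s. aff 1 (axis i s) \<phi>) has_vector_derivative aff 1 (axis i 0) (G $ i)) (at 0)"
    by (rule isometry_group.weak_generator_imp_strong[OF translation_group])
      (auto simp: test_space_def generator_translation H1_test[OF assms])
  then show ?thesis unfolding isometry_group.T0[OF translation_group] .
qed

text \<open>
  Translations preserve inner products, so their generators are antisymmetric.
\<close>
lemma translation_skew: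
  assumes f: "((\<lambda>s. aff 1 (axis i s) \<phi>) has_vector_derivative g) (at 0)"
    and h: "((\<lambda>s. aff 1 (axis i s) \<psi>) has_vector_derivative k) (at 0)"
  shows "g \<bullet> \<psi> = - (\<phi> \<bullet> k)"
proof -
  have "((\<lambda>s. aff 1 (axis i s) \<phi> \<bullet> aff 1 (axis i s) \<psi>) has_vector_derivative
     aff 1 (axis i 0) \<phi> \<bullet> k + g \<bullet> aff 1 (axis i 0) \<psi>) (at 0)"
    by (rule bounded_bilinear.has_vector_derivative[OF bounded_bilinear_inner f h])
  then have "((\<lambda>s::real. \<phi> \<bullet> \<psi>) has_vector_derivative \<phi> \<bullet> k + g \<bullet> \<psi>) (at 0)"
    unfolding isometry_group.T0[OF translation_group] isometry_group.inner_T[OF translation_group] .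
  moreover have "((\<lambda>s::real. \<phi> \<bullet> \<psi>) has_vector_derivative 0) (at 0)" by (rule has_vector_derivative_const)
  ultimately have "\<phi> \<bullet> k + g \<bullet> \<psi> = 0" by (rule vector_derivative_unique_at)
  then show ?thesis by simp
qed

text \<open>
  No approximation by smooth functions is involved: both gradients are strong derivatives along translations.
\<close>
lemma integration_by_parts: "(\<phi>, G) \<in> H1 \<Longrightarrow> (\<psi>, K) \<in> H1 \<Longrightarrow> G $ i \<bullet> \<psi> = - (\<phi> \<bullet> K $ i)"
  by (rule translation_skew[OF H1_translation H1_translation])

lemma ctest_H1:
  fixes \<theta> :: "real^'n::finite \<Rightarrow> complex"
  assumes t: "ctest \<theta>" shows "(cls \<theta>, \<chi> i. cls (cpd i \<theta>)) \<in> H1"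
  unfolding H1_def
proof (safe)
  fix \<eta> :: "real^'n \<Rightarrow> complex" and i assume "ctest \<eta>"
  note a = t this
  show "cls \<theta> \<bullet> cls (cpd i \<eta>) = - ((\<chi> i. cls (cpd i \<theta>)) $ i \<bullet> cls \<eta>)"
    using translation_skew[OF translation_derivative[OF a(1)] translation_derivative[OF a(2)]] by simp
qed

lemma H1_subspace: "subspace H1"
  by (rule subspaceI) (auto simp: H1_def inner_add_left zero_prod_def)

lemma H1_closed: "closed H1"
proof -
  have "H1 = (\<Inter>\<theta>\<in>{\<theta>. ctest \<theta>}. \<Inter>i. {p. fst p \<bullet> cls (cpd i \<theta>) = - (snd p $ i \<bullet> cls \<theta>)})"
    by (auto simp: H1_def)
  also have "closed \<dots>"
    by (intro closed_INT ballI closed_Collect_eq continuous_intros)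
  finally show ?thesis .
qed

lemma total_eqI:
  assumes "\<And>\<theta>. ctest \<theta> \<Longrightarrow> a \<bullet> cls \<theta> = b \<bullet> cls \<theta>" shows "a = b"
proof -
  have "\<forall>d\<in>test_space. (a - b) \<bullet> d = 0" using assms by (auto simp: test_space_def inner_diff_left)
  then have "a - b = 0" using test_space_total unfolding total_set_def by blast
  then show ?thesis by simp
qed

lemma H1_zero: assumes "(0, G) \<in> H1" shows "G = 0"
proof -
  have "G $ i = 0" for i
    by (rule total_eqI) (use H1_test[OF assms, of _ i] in auto)
  then show ?thesis by (simp add: vec_eq_iff)
qed

lemma H1_mult:
  fixes m :: "real^'n::finite \<Rightarrow> complex"
  assumes m: "csmooth m" "bmult m" "\<And>i. bmult (cpd i m)" and h: "(\<phi>, G) \<in> H1"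
  shows "(mult_op m \<phi>, \<chi> i. mult_op m (G $ i) + mult_op (cpd i m) \<phi>) \<in> H1"
  unfolding H1_def
proof safe
  fix \<theta> :: "real^'n \<Rightarrow> complex" and i assume t: "ctest \<theta>"
  let ?n = "\<lambda>x. cnj (m x)" and ?k = "\<lambda>x. cnj (cpd i m x)"
  have nt: "ctest (\<lambda>x. ?n x * \<theta> x)" by (intro ctest_mult csmooth_cnj m t)
  have kt: "ctest (\<lambda>x. ?k x * \<theta> x)" by (intro ctest_mult csmooth_cnj csmooth_cpd m t)
  have eq: "(\<lambda>x. ?n x * cpd i \<theta> x) = (\<lambda>x. cpd i (\<lambda>x. ?n x * \<theta> x) x - ?k x * \<theta> x)"
    by (simp add: cpd_mult csmooth_cnj m ctest_csmooth[OF t] cpd_cnj)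
  have "mult_op m \<phi> \<bullet> cls (cpd i \<theta>) = \<phi> \<bullet> cls (\<lambda>x. ?n x * cpd i \<theta> x)"
    by (simp add: mult_adjoint m mult_cls bmult_cnj ctest_L2 ctest_cpd t)
  also have "\<dots> = \<phi> \<bullet> cls (cpd i (\<lambda>x. ?n x * \<theta> x)) - \<phi> \<bullet> cls (\<lambda>x. ?k x * \<theta> x)"
    unfolding eq by (subst cls_diff) (auto simp: ctest_L2 ctest_cpd nt kt inner_diff_right)
  also have "\<dots> = - (G $ i \<bullet> cls (\<lambda>x. ?n x * \<theta> x)) - \<phi> \<bullet> cls (\<lambda>x. ?k x * \<theta> x)"
    by (simp add: H1_test[OF h nt])
  also have "\<dots> = - ((mult_op m (G $ i) + mult_op (cpd i m) \<phi>) \<bullet> cls \<theta>)"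
    by (simp add: mult_adjoint m mult_cls bmult_cnj ctest_L2 t inner_add_left)
  finally show "mult_op m \<phi> \<bullet> cls (cpd i \<theta>) = - ((\<chi> i. mult_op m (G $ i) + mult_op (cpd i m) \<phi>) $ i \<bullet> cls \<theta>)" by simp
qed

lemma cpd_const: "cpd i (\<lambda>x. c) = (\<lambda>x. 0)"
  using cpd_eqI[OF csmooth_const has_derivative_const] by (rule ext)

lemma H1_imul: assumes "(\<phi>, G) \<in> H1" shows "(imul \<phi>, \<chi> i. imul (G $ i)) \<in> H1"
proof -
  have "mult_op (\<lambda>x. 0) \<phi> = 0" by (simp add: mult_op_def cls_zero)
  then show ?thesis using H1_mult[OF csmooth_const _ _ assms, of \<i>] by (simp add: imul_def cpd_const)
qed

lemma H1_dilation:
  fixes \<phi> :: "'n::finite l2"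
  assumes c: "c > 0" and h: "(\<phi>, G) \<in> H1"
  shows "(aff c 0 \<phi>, \<chi> i. c *\<^sub>R aff c 0 (G $ i)) \<in> H1"
  unfolding H1_def
proof safe
  fix \<theta> :: "real^'n \<Rightarrow> complex" and i assume t: "ctest \<theta>"
  have c': "1 / c > 0" using c by simp
  let ?\<eta> = "affn (1 / c) 0 \<theta>"
  have eq: "affn (1 / c) 0 (cpd i \<theta>) = (\<lambda>x. c *\<^sub>R cpd i ?\<eta> x)"
    using c by (simp add: cpd_affn[OF t] fun_eq_iff)
  have "aff c 0 \<phi> \<bullet> cls (cpd i \<theta>) = \<phi> \<bullet> cls (\<lambda>x. c *\<^sub>R cpd i ?\<eta> x)"
    by (simp add: aff_inverse[OF c] aff_cls[OF c'] ctest_L2 ctest_cpd t eq)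
  also have "\<dots> = c * (\<phi> \<bullet> cls (cpd i ?\<eta>))"
    by (simp add: cls_scaleR ctest_L2 ctest_cpd affn_ctest c t)
  also have "\<dots> = - (c * (G $ i \<bullet> cls ?\<eta>))" by (simp add: H1_test[OF h] affn_ctest c t)
  also have "\<dots> = - ((c *\<^sub>R aff c 0 (G $ i)) \<bullet> cls \<theta>)"
    by (simp add: aff_inverse[OF c] aff_cls[OF c'] ctest_L2 t)
  finally show "aff c 0 \<phi> \<bullet> cls (cpd i \<theta>) = - ((\<chi> i. c *\<^sub>R aff c 0 (G $ i)) $ i \<bullet> cls \<theta>)" by simp
qed

text \<open>
  The generator of dilations is \<open>x \<bullet> \<nabla> + n/2\<close>. Testing the weak gradient with \<open>x\<^sub>j \<theta>\<close> shows that it acts weakly in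
  this way, and the assumption \<open>L\<close> makes the result square integrable.
\<close>
lemma H1_dilation_derivative:
  fixes \<phi> :: "'n::finite l2"
  assumes h: "(\<phi>, G) \<in> H1" and L: "\<And>i. L2_function (\<lambda>x. of_real (x $ i) * fn (G $ i) x)"
  shows "((\<lambda>s. aff (exp s) 0 \<phi>) has_vector_derivative
    aff (exp r) 0 ((\<Sum>i\<in>UNIV. cls (\<lambda>x. of_real (x $ i) * fn (G $ i) x)) + (real CARD('n) / 2) *\<^sub>R \<phi>)) (at r)"
proof (rule isometry_group.weak_generator_imp_strong[OF dilation_group])
  fix d :: "'n l2" assume "d \<in> test_space"
  then obtain \<theta> where t: "ctest \<theta>" and d: "d = cls \<theta>" by (auto simp: test_space_def)
  let ?N = "real CARD('n)"
  have xs: "csmooth (\<lambda>x::real^'n. of_real (x $ j))" for j by (intro csmooth_of_real smooth_component)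
  have xt: "ctest (\<lambda>x. of_real (x $ j) * \<theta> x)" for j by (intro ctest_mult xs t)
  have xct: "ctest (\<lambda>x. of_real (x $ j) * cpd j \<theta> x)" for j by (intro ctest_mult xs ctest_cpd t)
  have "cpd j (\<lambda>x::real^'n. of_real (x $ j)) x = 1" for j x
  proof -
    have "((\<lambda>x::real^'n. complex_of_real (x $ j)) has_derivative (\<lambda>h. of_real (h $ j))) (at x)"
      by (intro derivative_intros bounded_linear.has_derivative[OF bounded_linear_vec_nth has_derivative_ident])
    then show ?thesis using cpd_eqI[OF xs] by (simp add: axis_def)
  qed
  then have eq: "(\<lambda>x. of_real (x $ j) * cpd j \<theta> x) = (\<lambda>x. cpd j (\<lambda>x. of_real (x $ j) * \<theta> x) x - \<theta> x)" for j
    by (simp add: cpd_mult xs ctest_csmooth[OF t])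
  have one: "\<phi> \<bullet> cls (\<lambda>x. of_real (x $ j) * cpd j \<theta> x) = - (cls (\<lambda>x. of_real (x $ j) * fn (G $ j) x) \<bullet> d) - \<phi> \<bullet> d" for j
  proof -
    have "\<phi> \<bullet> cls (\<lambda>x. of_real (x $ j) * cpd j \<theta> x) = \<phi> \<bullet> cls (cpd j (\<lambda>x. of_real (x $ j) * \<theta> x)) - \<phi> \<bullet> d"
      unfolding eq d by (subst cls_diff) (auto simp: ctest_L2 ctest_cpd xt t inner_diff_right)
    also have "\<phi> \<bullet> cls (cpd j (\<lambda>x. of_real (x $ j) * \<theta> x)) = - (cls (fn (G $ j)) \<bullet> cls (\<lambda>x. of_real (x $ j) * \<theta> x))"
      by (simp add: H1_test[OF h xt])
    also have "cls (fn (G $ j)) \<bullet> cls (\<lambda>x. of_real (x $ j) * \<theta> x) = cls (\<lambda>x. of_real (x $ j) * fn (G $ j) x) \<bullet> d"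
      unfolding d inner_cls[OF L2_fn ctest_L2[OF xt]] inner_cls[OF L ctest_L2[OF t]]
      by (simp add: inner_complex_eq mult_ac)
    finally show ?thesis .
  qed
  have "\<phi> \<bullet> generator (\<lambda>s. aff (exp s) 0) d = \<phi> \<bullet> cls (\<lambda>x. (\<Sum>j\<in>UNIV. of_real (x $ j) * cpd j \<theta> x) + (?N / 2) *\<^sub>R \<theta> x)"
    using vector_derivative_at[OF dilation_derivative[OF t]] by (simp add: d generator_def scaleR_conv_of_real)
  also have "\<dots> = (\<Sum>j\<in>UNIV. \<phi> \<bullet> cls (\<lambda>x. of_real (x $ j) * cpd j \<theta> x)) + (?N / 2) * (\<phi> \<bullet> d)"
    by (simp add: cls_add L2_sum ctest_L2 xct t L2_scaleR cls_sum cls_scaleR inner_add_right inner_sum_right d)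
  also have "\<dots> = - (((\<Sum>i\<in>UNIV. cls (\<lambda>x. of_real (x $ i) * fn (G $ i) x)) + (?N / 2) *\<^sub>R \<phi>) \<bullet> d)"
    by (simp add: one sum_subtractf sum_negf inner_add_left inner_sum_left)
  finally show "\<phi> \<bullet> generator (\<lambda>s. aff (exp s) 0) d
     = - (((\<Sum>i\<in>UNIV. cls (\<lambda>x. of_real (x $ i) * fn (G $ i) x)) + (?N / 2) *\<^sub>R \<phi>) \<bullet> d)" .
qed

section \<open>Comparison with the pointwise definition of weak gradients\<close>

lemma cpd_of_real_fun:
  "test_function \<eta> \<Longrightarrow> cpd i (\<lambda>x. of_real (\<eta> x) * c) = (\<lambda>x. of_real (partial_deriv i \<eta> x) * c)"
  by (rule ext) (rule cpd_of_real)

lemma H1_gradient_imp_H1: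
  fixes \<phi> :: "real^'n::finite \<Rightarrow> complex"
  assumes g: "H1_gradient \<phi> G" shows "(cls \<phi>, \<chi> i. cls (\<lambda>x. G x $ i)) \<in> H1"
  unfolding H1_def
proof safe
  fix \<theta> :: "real^'n \<Rightarrow> complex" and i assume t: "ctest \<theta>"
  have L: "L2_function \<phi>" "L2_function (\<lambda>x. G x $ i)" using g by (auto simp: H1_gradient_def)
  have main: "cls \<phi> \<bullet> cls (\<lambda>x. of_real (partial_deriv i \<eta> x)) = - (cls (\<lambda>x. G x $ i) \<bullet> cls (\<lambda>x. of_real (\<eta> x)))"
     "cls \<phi> \<bullet> imul (cls (\<lambda>x. of_real (partial_deriv i \<eta> x))) = - (cls (\<lambda>x. G x $ i) \<bullet> imul (cls (\<lambda>x. of_real (\<eta> x))))"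
     "L2_function (\<lambda>x. of_real (\<eta> x))" "L2_function (\<lambda>x. of_real (partial_deriv i \<eta> x))"
    if e: "test_function \<eta>" for \<eta>
  proof -
    have eL: "L2_function (\<lambda>x. of_real (\<eta> x))" using ctest_L2[OF test_ctest[OF e, of 1]] by simp
    have peL: "L2_function (\<lambda>x. of_real (partial_deriv i \<eta> x))"
      using ctest_L2[OF ctest_cpd[OF test_ctest[OF e, of 1]], of i] cpd_of_real_fun[OF e, of i 1] by simp
    have "(LINT x|lebesgue. of_real (partial_deriv i \<eta> x) * \<phi> x) = - (LINT x|lebesgue. of_real (\<eta> x) * G x $ i)"
      using g e by (auto simp: H1_gradient_def)
    then have eq: "L2_inner \<phi> (\<lambda>x. of_real (partial_deriv i \<eta> x)) = - L2_inner (\<lambda>x. G x $ i) (\<lambda>x. of_real (\<eta> x))"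
      by (simp add: L2_inner_def mult.commute)
    show "cls \<phi> \<bullet> cls (\<lambda>x. of_real (partial_deriv i \<eta> x)) = - (cls (\<lambda>x. G x $ i) \<bullet> cls (\<lambda>x. of_real (\<eta> x)))"
      using arg_cong[OF eq, of Re] by (simp add: L2_inner_Re L eL peL)
    show "cls \<phi> \<bullet> imul (cls (\<lambda>x. of_real (partial_deriv i \<eta> x))) = - (cls (\<lambda>x. G x $ i) \<bullet> imul (cls (\<lambda>x. of_real (\<eta> x))))"
      using arg_cong[OF eq, of Im] by (simp add: L2_inner_Im L eL peL)
    show "L2_function (\<lambda>x. of_real (\<eta> x))" by (rule eL)
    show "L2_function (\<lambda>x. of_real (partial_deriv i \<eta> x))" by (rule peL)
  qed
  let ?a = "\<lambda>x. Re (\<theta> x)" and ?b = "\<lambda>x. Im (\<theta> x)"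
  note A = main[OF ctest_test(1)[OF t]] and B = main[OF ctest_test(2)[OF t]]
  have 1: "cls \<theta> = cls (\<lambda>x. of_real (?a x)) + imul (cls (\<lambda>x. of_real (?b x)))"
    by (simp add: imul_cls A B L2_scale cls_add[symmetric] complex_eq[symmetric])
  have 2: "cls (cpd i \<theta>) = cls (\<lambda>x. of_real (partial_deriv i ?a x)) + imul (cls (\<lambda>x. of_real (partial_deriv i ?b x)))"
    by (simp add: imul_cls A B L2_scale cls_add[symmetric] cpd_def[abs_def] Complex_eq)
  show "cls \<phi> \<bullet> cls (cpd i \<theta>) = - ((\<chi> i. cls (\<lambda>x. G x $ i)) $ i \<bullet> cls \<theta>)"
    unfolding 1 2 by (simp add: inner_add_right A B)
qed

lemma H1_imp_H1_gradient:
  fixes \<phi> :: "'n::finite l2"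
  assumes h: "(\<phi>, G) \<in> H1" shows "H1_gradient (fn \<phi>) (\<lambda>x. \<chi> i. fn (G $ i) x)"
  unfolding H1_gradient_def
proof (intro conjI allI impI)
  fix \<eta> :: "real^'n \<Rightarrow> real" and i assume e: "test_function \<eta>"
  have eL: "L2_function (\<lambda>x. of_real (\<eta> x))" using ctest_L2[OF test_ctest[OF e, of 1]] by simp
  have peL: "L2_function (\<lambda>x. of_real (partial_deriv i \<eta> x))"
    using ctest_L2[OF ctest_cpd[OF test_ctest[OF e, of 1]], of i] cpd_of_real_fun[OF e, of i 1] by simp
  have 1: "\<phi> \<bullet> cls (\<lambda>x. of_real (partial_deriv i \<eta> x)) = - (G $ i \<bullet> cls (\<lambda>x. of_real (\<eta> x)))"
    using H1_test[OF h test_ctest[OF e, of 1], of i] cpd_of_real_fun[OF e, of i 1] by simp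
  have 2: "\<phi> \<bullet> imul (cls (\<lambda>x. of_real (partial_deriv i \<eta> x))) = - (G $ i \<bullet> imul (cls (\<lambda>x. of_real (\<eta> x))))"
    using H1_test[OF h test_ctest[OF e, of \<i>], of i] cpd_of_real_fun[OF e, of i \<i>]
    by (simp add: imul_cls eL peL mult.commute)
  have "L2_inner (fn \<phi>) (\<lambda>x. of_real (partial_deriv i \<eta> x)) = - L2_inner (fn (G $ i)) (\<lambda>x. of_real (\<eta> x))"
    using 1 2 by (simp add: complex_eq_iff L2_inner_Re L2_inner_Im eL peL)
  then show "(LINT x|lebesgue. of_real (partial_deriv i \<eta> x) * fn \<phi> x) =
        - (LINT x|lebesgue. of_real (\<eta> x) * (\<chi> i. fn (G $ i) x) $ i)"
    by (simp add: L2_inner_def mult.commute)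
qed simp_all

section \<open>Hardy's inequality\<close>

text \<open>
  The components of the vector field \<open>x / (|x|\<^sup>2 + e)\<close>, a bounded regularization of \<open>x / |x|\<^sup>2\<close>.
\<close>
lemma hardy_field:
  fixes e :: real and i :: "'n::finite" assumes e: "e > 0"
  defines "F \<equiv> \<lambda>x::real^'n. complex_of_real (x $ i / (x \<bullet> x + e))"
  shows "csmooth F" "bmult F" "\<And>j. bmult (cpd j F)"
    and "cpd i F x = of_real (1 / (x \<bullet> x + e) - 2 * (x $ i)\<^sup>2 / (x \<bullet> x + e)\<^sup>2)"
proof -
  have sq: "smooth (\<lambda>x::real^'n. x \<bullet> x)" unfolding inner_vec_def by (auto intro!: smooth_sum smooth_mult smooth_component)
  define h where "h k s = (-1) ^ k * fact k * inverse (s + e) ^ Suc k" for k :: nat and s :: real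
  have hd: "(h k has_real_derivative h (Suc k) s) (at s)" if s: "s \<ge> 0" for k s
  proof -
    have "((\<lambda>s. inverse (s + e)) has_real_derivative - (inverse (s + e) * inverse (s + e))) (at s)"
      using s e by (auto intro!: derivative_eq_intros)
    from DERIV_cmult[OF DERIV_power[OF this, of "Suc k"], of "(-1) ^ k * fact k"]
    have "(h k has_real_derivative (-1) ^ k * fact k *
       (real (Suc k) * (- (inverse (s + e) * inverse (s + e)) * inverse (s + e) ^ (Suc k - Suc 0)))) (at s)"
      unfolding h_def[abs_def] .
    moreover have "(-1) ^ k * fact k *
       (real (Suc k) * (- (inverse (s + e) * inverse (s + e)) * inverse (s + e) ^ (Suc k - Suc 0))) = h (Suc k) s"
      by (simp add: h_def)
    ultimately show ?thesis by simp
  qed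
  have "smooth (\<lambda>x::real^'n. h 0 (x \<bullet> x))"
    by (rule smooth_compose[where h = h and f = "\<lambda>x. x \<bullet> x" and j = 0]) (auto intro: hd sq)
  then have "smooth (\<lambda>x::real^'n. x $ i * (1 / (x \<bullet> x + e)))"
    by (intro smooth_mult smooth_component) (simp add: h_def divide_inverse)
  then show cs: "csmooth F" unfolding F_def by (intro csmooth_of_real) simp
  have pos: "x \<bullet> x + e > 0" for x :: "real^'n" using e by (simp add: add_nonneg_pos)
  have cmp: "(x $ j)\<^sup>2 \<le> x \<bullet> x" for x :: "real^'n" and j
  proof -
    have "x $ j * x $ j \<le> (\<Sum>i\<in>UNIV. x $ i * x $ i)" by (rule member_le_sum) auto
    then show ?thesis unfolding inner_vec_def by (simp add: power2_eq_square)
  qed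
  have der: "cpd j F x = of_real (axis j 1 $ i / (x \<bullet> x + e) - x $ i * (2 * x $ j) / (x \<bullet> x + e)\<^sup>2)" for j x
  proof -
    have "((\<lambda>x::real^'n. x $ i / (x \<bullet> x + e)) has_derivative
       (\<lambda>k. (k $ i * (x \<bullet> x + e) - x $ i * (x \<bullet> k + k \<bullet> x)) / ((x \<bullet> x + e) * (x \<bullet> x + e)))) (at x)"
      using pos[of x]
      by (auto intro!: derivative_eq_intros bounded_linear.has_derivative[OF bounded_linear_vec_nth])
    then have d: "(F has_derivative (\<lambda>k. of_real ((k $ i * (x \<bullet> x + e) - x $ i * (x \<bullet> k + k \<bullet> x)) / ((x \<bullet> x + e) * (x \<bullet> x + e))))) (at x)"
      unfolding F_def by (rule has_derivative_of_real)
    show ?thesis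
      unfolding cpd_eqI[OF cs d] using pos[of x]
      by (simp add: inner_axis inner_axis' power2_eq_square diff_divide_distrib)
  qed
  show "cpd i F x = of_real (1 / (x \<bullet> x + e) - 2 * (x $ i)\<^sup>2 / (x \<bullet> x + e)\<^sup>2)"
    unfolding der by (simp add: power2_eq_square mult_ac)
  have b1: "\<bar>x $ j\<bar> \<le> (x \<bullet> x + 1)" for x :: "real^'n" and j
  proof -
    have "\<bar>x $ j\<bar> \<le> (x $ j)\<^sup>2 + 1"
      using sum_squares_bound[of "\<bar>x $ j\<bar>" 1] by simp
    then show ?thesis using cmp[of x j] by linarith
  qed
  show "bmult F"
  proof (rule bmultI[OF csmooth_measurable[OF cs]])
    fix x :: "real^'n"
    have "(1 + 1 / e) * (x \<bullet> x + e) = x \<bullet> x + 1 + e + (x \<bullet> x) / e" using e by (simp add: field_simps)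
    moreover have "0 \<le> (x \<bullet> x) / e" using e by simp
    ultimately have "\<bar>x $ i\<bar> \<le> (1 + 1 / e) * (x \<bullet> x + e)" using b1[of x i] e by linarith
    then have "\<bar>x $ i\<bar> / (x \<bullet> x + e) \<le> 1 + 1 / e" using pos[of x] by (simp add: pos_divide_le_eq)
    then show "cmod (F x) \<le> 1 + 1 / e" using pos[of x] unfolding F_def norm_of_real by simp
  qed
  show "bmult (cpd j F)" for j
  proof (rule bmultI[OF csmooth_measurable[OF csmooth_cpd[OF cs]]])
    fix x :: "real^'n"
    let ?q = "x \<bullet> x + e"
    have 1: "\<bar>axis j 1 $ i / ?q\<bar> \<le> 1 / e"
      using pos[of x] e by (auto simp: axis_def frac_le)
    have "\<bar>x $ i * (2 * x $ j)\<bar> \<le> (x $ i)\<^sup>2 + (x $ j)\<^sup>2"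
      using sum_squares_bound[of "\<bar>x $ i\<bar>" "\<bar>x $ j\<bar>"] by (simp add: abs_mult mult_ac)
    also have "\<dots> \<le> x \<bullet> x + x \<bullet> x" by (rule add_mono[OF cmp cmp])
    also have "\<dots> \<le> 2 * ?q" using e by simp
    finally have "\<bar>x $ i * (2 * x $ j)\<bar> / ?q\<^sup>2 \<le> 2 * ?q / ?q\<^sup>2" by (intro divide_right_mono) auto
    also have "\<dots> = 2 / ?q"
    proof -
      have "2 * q / q\<^sup>2 = 2 / q" if "q > 0" for q :: real using that by (simp add: power2_eq_square)
      then show ?thesis using pos[of x] .
    qed
    also have "\<dots> \<le> 2 / e" using pos[of x] e by (intro divide_left_mono mult_pos_pos) auto
    finally have 2: "\<bar>x $ i * (2 * x $ j) / ?q\<^sup>2\<bar> \<le> 2 / e" by simp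
    show "cmod (cpd j F x) \<le> 1 / e + 2 / e"
      unfolding der norm_of_real by (rule order_trans[OF abs_triangle_ineq4 add_mono[OF 1 2]])
  qed
qed

text \<open>
  Let \<open>F = x / (|x|\<^sup>2 + e)\<close>. Integration by parts gives \<open>2 Re \<langle>\<nabla>\<phi>, F \<phi>\<rangle> = - \<integral> (div F) |\<phi>|\<^sup>2\<close>, and expanding
  \<open>0 \<le> \<parallel>2 \<nabla>\<phi> + F \<phi>\<parallel>\<^sup>2\<close> yields \<open>\<integral> (2 div F - |F|\<^sup>2) |\<phi>|\<^sup>2 \<le> 4 \<parallel>\<nabla>\<phi>\<parallel>\<^sup>2\<close>. With \<open>q = |x|\<^sup>2 + e\<close>,
  \<open>2 div F - |F|\<^sup>2 = 2 n / q - 5 |x|\<^sup>2 / q\<^sup>2 \<ge> (2 n - 5) / q\<close>, and \<open>2 n - 5 \<ge> 1\<close> for \<open>n \<ge> 3\<close>.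
\<close>
lemma hardy_eps:
  fixes \<phi> :: "'n::finite l2"
  assumes n: "CARD('n) \<ge> 3" and h: "(\<phi>, G) \<in> H1" and e: "e > 0"
  shows "(LINT x|lebesgue. (cmod (fn \<phi> x))\<^sup>2 / (x \<bullet> x + e)) \<le> 4 * (norm G)\<^sup>2"
    and "integrable lebesgue (\<lambda>x. (cmod (fn \<phi> x))\<^sup>2 / (x \<bullet> x + e))"
proof -
  define F where "F i = (\<lambda>x::real^'n. complex_of_real (x $ i / (x \<bullet> x + e)))" for i
  have Fp: "csmooth (F i)" "bmult (F i)" "bmult (cpd j (F i))"
    "cpd i (F i) x = of_real (1 / (x \<bullet> x + e) - 2 * (x $ i)\<^sup>2 / (x \<bullet> x + e)\<^sup>2)" for i j x
    unfolding F_def by (rule hardy_field[OF e])+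
  have pos: "x \<bullet> x + e > 0" for x :: "real^'n" using e by (simp add: add_nonneg_pos)
  have F_cnj: "(\<lambda>x. cnj (F i x)) = F i" for i by (simp add: F_def)
  \<comment> \<open>integrate by parts against the field times \<open>\<phi>\<close>, whose gradient contains the divergence\<close>
  have ibp: "2 * (G $ i \<bullet> mult_op (F i) \<phi>) + mult_op (cpd i (F i)) \<phi> \<bullet> \<phi> = 0" for i
  proof -
    have "G $ i \<bullet> mult_op (F i) \<phi> = - (\<phi> \<bullet> (mult_op (F i) (G $ i) + mult_op (cpd i (F i)) \<phi>))"
      using integration_by_parts[OF h H1_mult[OF Fp(1,2,3) h], of i] by simp
    moreover have "mult_op (F i) (G $ i) \<bullet> \<phi> = G $ i \<bullet> mult_op (F i) \<phi>"
      using mult_adjoint[OF Fp(2)] by (simp add: F_cnj)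
    ultimately show ?thesis by (simp add: inner_add_right inner_commute)
  qed
  let ?q = "\<lambda>x::real^'n. x \<bullet> x + e"
  let ?D = "\<lambda>i x. (1 / ?q x - 2 * (x $ i)\<^sup>2 / (?q x)\<^sup>2) * (cmod (fn \<phi> x))\<^sup>2"
  let ?P = "\<lambda>i x. (cmod (fn (mult_op (F i) \<phi>) x))\<^sup>2"
  have Dint: "integrable lebesgue (?D i)" and Dval: "mult_op (cpd i (F i)) \<phi> \<bullet> \<phi> = (LINT x|lebesgue. ?D i x)" for i
  proof -
    have L: "L2_function (\<lambda>x. cpd i (F i) x * fn \<phi> x)" by (intro L2_bmult Fp L2_fn)
    have eq: "(cpd i (F i) x * fn \<phi> x) \<bullet> fn \<phi> x = ?D i x" for x
      unfolding Fp(4) by (simp add: inner_complex_eq mult.assoc complex_norm_square[symmetric])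
    show "integrable lebesgue (?D i)" using L2_prod_integrable(2)[OF L L2_fn[of \<phi>]] unfolding eq .
    show "mult_op (cpd i (F i)) \<phi> \<bullet> \<phi> = (LINT x|lebesgue. ?D i x)"
      using inner_cls[OF L L2_fn[of \<phi>]] unfolding eq by (simp add: mult_op_def)
  qed
  show int: "integrable lebesgue (\<lambda>x. (cmod (fn \<phi> x))\<^sup>2 / ?q x)"
  proof (rule Bochner_Integration.integrable_bound[OF integrable_mult_right[OF L2_sq_integrable[OF L2_fn[of \<phi>]], of "1 / e"]])
    show "(\<lambda>x. (cmod (fn \<phi> x))\<^sup>2 / ?q x) \<in> borel_measurable lebesgue"
    proof -
      have "(\<lambda>x::real^'n. 1 / ?q x) \<in> borel_measurable borel"
        using pos by (intro borel_measurable_continuous_onI continuous_intros) (simp add: less_imp_neq[OF pos, symmetric])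
      then have "(\<lambda>x::real^'n. 1 / ?q x) \<in> borel_measurable lebesgue" by (simp add: measurable_completion)
      then have "(\<lambda>x. (cmod (fn \<phi> x))\<^sup>2 * (1 / ?q x)) \<in> borel_measurable lebesgue"
        by (rule borel_measurable_times[OF borel_measurable_integrable[OF L2_sq_integrable[OF L2_fn]]])
      then show ?thesis by simp
    qed
    show "AE x in lebesgue. norm ((cmod (fn \<phi> x))\<^sup>2 / ?q x) \<le> norm (1 / e * (cmod (fn \<phi> x))\<^sup>2)"
      using e pos by (intro AE_I2) (simp add: frac_le divide_right_mono abs_of_pos)
  qed
  \<comment> \<open>the square \<open>\<parallel>2 \<nabla>\<phi> + F \<phi>\<parallel>\<^sup>2\<close>, component by component\<close>
  have "0 \<le> (norm (2 *\<^sub>R G $ i + mult_op (F i) \<phi>))\<^sup>2" for i by simp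
  moreover have "(norm (2 *\<^sub>R G $ i + mult_op (F i) \<phi>))\<^sup>2 = 4 * (norm (G $ i))\<^sup>2 + 4 * (G $ i \<bullet> mult_op (F i) \<phi>) + (norm (mult_op (F i) \<phi>))\<^sup>2" for i
    unfolding power2_norm_eq_inner by (simp add: inner_add_left inner_add_right inner_commute)
  ultimately have "2 * (mult_op (cpd i (F i)) \<phi> \<bullet> \<phi>) - (norm (mult_op (F i) \<phi>))\<^sup>2 \<le> 4 * (norm (G $ i))\<^sup>2" for i
    using ibp[of i] by (smt (verit))
  then have "(\<Sum>i\<in>UNIV. 2 * (mult_op (cpd i (F i)) \<phi> \<bullet> \<phi>) - (norm (mult_op (F i) \<phi>))\<^sup>2) \<le> (\<Sum>i\<in>UNIV. 4 * (norm (G $ i))\<^sup>2)"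
    by (intro sum_mono) auto
  also have "\<dots> = 4 * (norm G)\<^sup>2"
    by (simp add: norm_vec_def L2_set_def sum_nonneg sum_distrib_left)
  finally have up: "(\<Sum>i\<in>UNIV. 2 * (mult_op (cpd i (F i)) \<phi> \<bullet> \<phi>) - (norm (mult_op (F i) \<phi>))\<^sup>2) \<le> 4 * (norm G)\<^sup>2" .
  have Fint: "integrable lebesgue (\<lambda>x. (x $ i)\<^sup>2 / (?q x)\<^sup>2 * (cmod (fn \<phi> x))\<^sup>2)" and
    Fval: "(norm (mult_op (F i) \<phi>))\<^sup>2 = (LINT x|lebesgue. (x $ i)\<^sup>2 / (?q x)\<^sup>2 * (cmod (fn \<phi> x))\<^sup>2)" for i
  proof -
    have L: "L2_function (\<lambda>x. F i x * fn \<phi> x)" by (intro L2_bmult Fp L2_fn)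
    have eq: "(cmod (F i x * fn \<phi> x))\<^sup>2 = (x $ i)\<^sup>2 / (?q x)\<^sup>2 * (cmod (fn \<phi> x))\<^sup>2" for x
      unfolding F_def norm_mult norm_of_real by (simp add: power_mult_distrib power_divide)
    show "integrable lebesgue (\<lambda>x. (x $ i)\<^sup>2 / (?q x)\<^sup>2 * (cmod (fn \<phi> x))\<^sup>2)" using L2_sq_integrable[OF L] unfolding eq .
    show "(norm (mult_op (F i) \<phi>))\<^sup>2 = (LINT x|lebesgue. (x $ i)\<^sup>2 / (?q x)\<^sup>2 * (cmod (fn \<phi> x))\<^sup>2)"
      using norm_cls[OF L] unfolding eq by (simp add: mult_op_def)
  qed
  have "(LINT x|lebesgue. (cmod (fn \<phi> x))\<^sup>2 / ?q x) \<le>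
     (LINT x|lebesgue. (\<Sum>i\<in>UNIV. 2 * ?D i x - (x $ i)\<^sup>2 / (?q x)\<^sup>2 * (cmod (fn \<phi> x))\<^sup>2))"
  proof (rule integral_mono[OF int])
    show "integrable lebesgue (\<lambda>x. \<Sum>i\<in>UNIV. 2 * ?D i x - (x $ i)\<^sup>2 / (?q x)\<^sup>2 * (cmod (fn \<phi> x))\<^sup>2)"
      by (intro Bochner_Integration.integrable_sum Bochner_Integration.integrable_diff integrable_mult_right Dint Fint)
    fix x :: "real^'n"
    let ?c = "(cmod (fn \<phi> x))\<^sup>2"
    have sq: "(\<Sum>i\<in>UNIV. (x $ i)\<^sup>2) = x \<bullet> x" by (simp add: inner_vec_def power2_eq_square)
    have "(\<Sum>i\<in>UNIV. 2 * ?D i x - (x $ i)\<^sup>2 / (?q x)\<^sup>2 * ?c) = (\<Sum>i\<in>UNIV. 2 * ?c / ?q x - (5 * ?c / (?q x)\<^sup>2) * (x $ i)\<^sup>2)"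
      by (intro sum.cong refl) (simp add: algebra_simps)
    also have "\<dots> = real CARD('n) * (2 * ?c / ?q x) - (5 * ?c / (?q x)\<^sup>2) * (x \<bullet> x)"
      unfolding sum_subtractf sum_distrib_left[symmetric] sq by simp
    also have "\<dots> \<ge> 3 * (2 * ?c / ?q x) - 5 * ?c / ?q x"
    proof -
      have "(5 * ?c / (?q x)\<^sup>2) * (x \<bullet> x) \<le> (5 * ?c / (?q x)\<^sup>2) * ?q x" using e by (intro mult_left_mono) auto
      also have "\<dots> = 5 * ?c / ?q x" using pos[of x] by (simp add: power2_eq_square)
      finally have "(5 * ?c / (?q x)\<^sup>2) * (x \<bullet> x) \<le> 5 * ?c / ?q x" .
      moreover have "3 * (2 * ?c / ?q x) \<le> real CARD('n) * (2 * ?c / ?q x)"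
        using n pos[of x] by (intro mult_right_mono) auto
      ultimately show ?thesis by linarith
    qed
    also have "3 * (2 * ?c / ?q x) - 5 * ?c / ?q x = ?c / ?q x" by (simp add: diff_divide_distrib[symmetric])
    finally show "?c / ?q x \<le> (\<Sum>i\<in>UNIV. 2 * ?D i x - (x $ i)\<^sup>2 / (?q x)\<^sup>2 * ?c)" .
  qed
  also have "\<dots> = (\<Sum>i\<in>UNIV. LINT x|lebesgue. 2 * ?D i x - (x $ i)\<^sup>2 / (?q x)\<^sup>2 * (cmod (fn \<phi> x))\<^sup>2)"
    by (rule Bochner_Integration.integral_sum)
      (intro Bochner_Integration.integrable_diff integrable_mult_right Dint Fint)
  also have "\<dots> = (\<Sum>i\<in>UNIV. 2 * (mult_op (cpd i (F i)) \<phi> \<bullet> \<phi>) - (norm (mult_op (F i) \<phi>))\<^sup>2)"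
    by (intro sum.cong refl, subst Bochner_Integration.integral_diff[OF integrable_mult_right[OF Dint] Fint])
      (simp only: integral_mult_right_zero Dval Fval)
  finally show "(LINT x|lebesgue. (cmod (fn \<phi> x))\<^sup>2 / ?q x) \<le> 4 * (norm G)\<^sup>2" using up by linarith
qed

text \<open>
  The case \<open>e \<rightarrow> 0\<close> of \<open>hardy_eps\<close>, by Fatou's lemma.
\<close>
lemma hardy:
  fixes \<phi> :: "'n::finite l2"
  assumes n: "CARD('n) \<ge> 3" and h: "(\<phi>, G) \<in> H1"
  shows "(\<integral>\<^sup>+ x. ennreal ((cmod (fn \<phi> x))\<^sup>2 / (norm x)\<^sup>2) \<partial>lebesgue) \<le> ennreal (4 * (norm G)\<^sup>2)"
proof -
  define e where "e k = inverse (real (Suc k))" for k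
  have e: "e k > 0" for k by (simp add: e_def)
  have e_lim: "e \<longlonglongrightarrow> 0" unfolding e_def[abs_def] by (rule LIMSEQ_inverse_real_of_nat)
  have nz: "AE x in lebesgue. x \<noteq> (0::real^'n)"
    by (rule AE_completion) (rule AE_lborel_singleton)
  have "(\<integral>\<^sup>+ x. ennreal ((cmod (fn \<phi> x))\<^sup>2 / (norm x)\<^sup>2) \<partial>lebesgue)
    = (\<integral>\<^sup>+ x. liminf (\<lambda>k. ennreal ((cmod (fn \<phi> x))\<^sup>2 / (x \<bullet> x + e k))) \<partial>lebesgue)"
  proof (rule nn_integral_cong_AE)
    show "AE x in lebesgue. ennreal ((cmod (fn \<phi> x))\<^sup>2 / (norm x)\<^sup>2) = liminf (\<lambda>k. ennreal ((cmod (fn \<phi> x))\<^sup>2 / (x \<bullet> x + e k)))"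
      using nz
    proof eventually_elim
      case (elim x)
      have "(\<lambda>k. (cmod (fn \<phi> x))\<^sup>2 / (x \<bullet> x + e k)) \<longlonglongrightarrow> (cmod (fn \<phi> x))\<^sup>2 / (x \<bullet> x + 0)"
        using elim by (intro tendsto_intros e_lim) auto
      then have "(\<lambda>k. ennreal ((cmod (fn \<phi> x))\<^sup>2 / (x \<bullet> x + e k))) \<longlonglongrightarrow> ennreal ((cmod (fn \<phi> x))\<^sup>2 / (norm x)\<^sup>2)"
        by (intro tendsto_ennrealI) (simp add: power2_norm_eq_inner)
      then show ?case by (rule lim_imp_Liminf[OF trivial_limit_sequentially, symmetric])
    qed
  qed
  also have "\<dots> \<le> liminf (\<lambda>k. \<integral>\<^sup>+ x. ennreal ((cmod (fn \<phi> x))\<^sup>2 / (x \<bullet> x + e k)) \<partial>lebesgue)"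
    using hardy_eps(2)[OF n h e] by (intro nn_integral_liminf) (auto intro!: measurable_compose[OF borel_measurable_integrable])
  also have "\<dots> = liminf (\<lambda>k. ennreal (LINT x|lebesgue. (cmod (fn \<phi> x))\<^sup>2 / (x \<bullet> x + e k)))"
    using hardy_eps(2)[OF n h e] e by (subst nn_integral_eq_integral) (auto simp: add_nonneg_nonneg less_imp_le)
  also have "\<dots> \<le> ennreal (4 * (norm G)\<^sup>2)"
    by (rule Liminf_le) (auto intro!: always_eventually ennreal_leI hardy_eps(1)[OF n h e])
  finally show ?thesis .
qed

section \<open>The potential\<close>

locale potential =
  fixes W :: "real^'n::finite \<Rightarrow> real"
  assumes n3: "CARD('n) \<ge> 3"
    and W_meas: "W \<in> borel_measurable (completion sphere_measure)"
    and W_bdd: "bounded (W ` sphere 0 1)"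
    and W_nonneg: "\<And>\<theta>. \<theta> \<in> sphere 0 1 \<Longrightarrow> W \<theta> \<ge> 0"
begin

definition V :: "real^'n \<Rightarrow> real" where "V = inverse_square_potential W"

lemma V_eq: "V x = W (x /\<^sub>R norm x) / (norm x)\<^sup>2"
  by (simp add: V_def inverse_square_potential_def)

lemma direction_in_sphere: "x \<noteq> 0 \<Longrightarrow> x /\<^sub>R norm x \<in> sphere (0::real^'n) 1"
  by (simp add: dist_norm)

lemma V_nonneg: "0 \<le> V x"
  using W_nonneg[OF direction_in_sphere[of x]] by (cases "x = 0") (auto simp: V_eq)

lemma V_scale:
  assumes c: "c > 0" shows "V x = c\<^sup>2 * V (c *\<^sub>R x)"
proof -
  have "inverse (c * norm x) * c = inverse (norm x)" using c by simp
  then have eq: "(c *\<^sub>R x) /\<^sub>R norm (c *\<^sub>R x) = x /\<^sub>R norm x" using c by (simp only: norm_scaleR scaleR_scaleR abs_of_pos)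
  show ?thesis using c unfolding V_eq eq by (simp add: power_mult_distrib)
qed

lemma V_bound: "\<exists>B>0. \<forall>x. V x \<le> B / (norm x)\<^sup>2"
proof -
  obtain B where "\<forall>y\<in>W ` sphere 0 1. norm y \<le> B" using W_bdd unfolding bounded_iff by blast
  then have B: "\<bar>W \<theta>\<bar> \<le> B" if "\<theta> \<in> sphere 0 1" for \<theta> using that by auto
  have "V x \<le> (\<bar>B\<bar> + 1) / (norm x)\<^sup>2" for x
  proof (cases "x = 0")
    case False
    have "W (x /\<^sub>R norm x) \<le> \<bar>B\<bar> + 1" using B[OF direction_in_sphere[OF False]] by linarith
    then show ?thesis unfolding V_eq by (rule divide_right_mono) simp
  qed (simp add: V_eq)
  then show ?thesis by (intro exI[of _ "\<bar>B\<bar> + 1"]) auto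
qed

text \<open>
  By definition of the cone measure, the part of the cone over \<open>N\<close> in the unit ball is a null set; the whole
  cone is a countable union of dilates of it.
\<close>
lemma sphere_null_cone_null:
  assumes N: "N \<in> null_sets (sphere_measure :: (real^'n) measure)"
  shows "AE x in lebesgue. x /\<^sub>R norm x \<notin> N"
proof -
  let ?p = "\<lambda>x::real^'n. x /\<^sub>R norm x"
  let ?B = "restrict_space lborel (cball (0::real^'n) 1 - {0})"
  let ?S = "restrict_space borel (sphere (0::real^'n) 1)"
  have Ns: "N \<in> sets ?S" using N by (auto simp: sphere_measure_def)
  then have N_sub: "N \<subseteq> sphere 0 1" and Nb: "N \<in> sets borel"
    by (auto simp: sets_restrict_space)
  have p: "?p \<in> measurable ?B ?S"
  proof (rule measurable_restrict_space2)
    show "?p \<in> space ?B \<rightarrow> sphere 0 1" by (auto simp: space_restrict_space dist_norm)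
    have "?p \<in> borel_measurable borel" by measurable
    then show "?p \<in> measurable ?B borel" by (intro measurable_restrict_space1) simp
  qed
  have "of_nat CARD('n) * emeasure (distr ?B ?S ?p) N = (0::ennreal)"
    using N by (auto simp: sphere_measure_def null_sets_def)
  then have "emeasure (distr ?B ?S ?p) N = 0" by simp
  then have "emeasure ?B (?p -` N \<inter> space ?B) = 0" by (simp add: emeasure_distr[OF p Ns])
  then have e0: "emeasure lborel (?p -` N \<inter> (cball 0 1 - {0})) = 0"
    by (subst (asm) emeasure_restrict_space) (auto simp: space_restrict_space)
  have "?p -` N \<inter> (cball 0 1 - {0}) \<in> sets lborel"
  proof -
    have "?p -` N \<inter> space borel \<in> sets borel" using Nb by (intro measurable_sets[of _ borel borel]) auto
    then show ?thesis by auto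
  qed
  with e0 have "AE x in lborel. x \<notin> ?p -` N \<inter> (cball 0 1 - {0})"
    by (intro AE_not_in) (auto simp: null_sets_def)
  then have ae: "AE x in lebesgue. x \<notin> ?p -` N \<inter> (cball 0 1 - {0})" by (rule AE_completion)
  have "AE x in lebesgue. (0 + (1 / real (Suc k)) *\<^sub>R x) \<notin> ?p -` N \<inter> (cball 0 1 - {0})" for k
    by (rule AE_affine[OF _ ae]) simp
  then have "AE x in lebesgue. \<forall>k. (0 + (1 / real (Suc k)) *\<^sub>R x) \<notin> ?p -` N \<inter> (cball 0 1 - {0})"
    unfolding AE_all_countable by blast
  then show ?thesis
  proof eventually_elim
    case (elim x)
    show ?case
    proof
      assume a: "?p x \<in> N"
      then have x: "x \<noteq> 0" using N_sub by auto
      obtain k where k: "norm x \<le> real (Suc k)" using real_arch_simple by (metis le_Suc_eq of_nat_le_iff order_trans le_refl)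
      have "?p ((1 / real (Suc k)) *\<^sub>R x) = ?p x" using x by (simp add: inverse_eq_divide)
      moreover have "(1 / real (Suc k)) *\<^sub>R x \<in> cball 0 1 - {0}"
        using x k by (auto simp: dist_norm field_simps)
      ultimately show False using elim[rule_format, of k] a by auto
    qed
  qed
qed

text \<open>
  \<open>W\<close> agrees with a Borel function outside a null set of directions, and the cone over that set is null.
\<close>
lemma V_measurable: "V \<in> borel_measurable lebesgue"
proof -
  let ?p = "\<lambda>x::real^'n. x /\<^sub>R norm x"
  obtain W' where W': "W' \<in> borel_measurable sphere_measure" "AE \<theta> in sphere_measure. W \<theta> = W' \<theta>"
    using completion_ex_borel_measurable_real[OF W_meas] by blast
  then obtain N where N: "N \<in> null_sets sphere_measure" "{\<theta> \<in> space sphere_measure. W \<theta> \<noteq> W' \<theta>} \<subseteq> N"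
    by (auto elim!: AE_E simp: null_sets_def)
  have sp: "space (sphere_measure :: (real^'n) measure) = sphere 0 1"
    by (simp add: sphere_measure_def space_restrict_space space_scale_measure)
  define V' where "V' x = indicator (- {0}) x *\<^sub>R (W' (?p x) / (norm x)\<^sup>2)" for x
  have p: "?p \<in> measurable (restrict_space borel (- {0})) (restrict_space borel (sphere 0 1))"
  proof (rule measurable_restrict_space2)
    show "?p \<in> space (restrict_space borel (- {0})) \<rightarrow> sphere 0 1" by (auto simp: space_restrict_space dist_norm)
    have "?p \<in> borel_measurable borel" by measurable
    then show "?p \<in> measurable (restrict_space borel (- {0})) borel" by (rule measurable_restrict_space1)
  qed
  have "W' \<in> borel_measurable (restrict_space borel (sphere 0 1))"
    using W'(1) by (simp add: sphere_measure_def cong: measurable_cong_sets)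
  then have "(\<lambda>x. W' (?p x)) \<in> borel_measurable (restrict_space borel (- {0}))"
    by (rule measurable_compose[OF p])
  moreover have "(\<lambda>x::real^'n. (norm x)\<^sup>2) \<in> borel_measurable (restrict_space borel (- {0}))"
    by (intro measurable_restrict_space1) measurable
  ultimately have "(\<lambda>x. W' (?p x) / (norm x)\<^sup>2) \<in> borel_measurable (restrict_space borel (- {0}))"
    by (rule borel_measurable_divide)
  then have "V' \<in> borel_measurable borel"
    unfolding V'_def by (subst (asm) borel_measurable_restrict_space_iff) auto
  then have "V' \<in> borel_measurable lborel" by simp
  moreover have "AE x in lebesgue. V x = V' x"
    using sphere_null_cone_null[OF N(1)]
  proof eventually_elim
    case (elim x)
    show ?case
    proof (cases "x = 0")
      case False
      have "W (?p x) = W' (?p x)"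
      proof (rule ccontr)
        assume "W (?p x) \<noteq> W' (?p x)"
        then have "?p x \<in> {\<theta> \<in> space sphere_measure. W \<theta> \<noteq> W' \<theta>}"
          unfolding mem_Collect_eq sp using direction_in_sphere[OF False] by blast
        then show False using N(2) elim by blast
      qed
      then show ?thesis using False by (simp add: V'_def V_eq)
    qed (simp add: V'_def V_eq)
  qed
  ultimately show ?thesis
    by (intro borel_measurable_AE[of V' V]) (auto intro: measurable_completion elim: eventually_mono)
qed

definition vfun :: "'n l2 \<Rightarrow> real^'n \<Rightarrow> complex" where
  "vfun \<phi> x = of_real (sqrt (V x)) * fn \<phi> x"

text \<open>
  Multiplication by the square root of \<open>V\<close>, so that the potential energy is \<open>vroot \<phi> \<bullet> vroot \<psi>\<close>, an inner product of
  elements of the Hilbert space. On functions outside \<open>vdom\<close> the value is a default without meaning.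
\<close>
definition vroot :: "'n l2 \<Rightarrow> 'n l2" where
  "vroot \<phi> = cls (vfun \<phi>)"

definition vdom :: "'n l2 set" where "vdom = {\<phi>. L2_function (vfun \<phi>)}"

lemma vfun_measurable: "vfun \<phi> \<in> borel_measurable lebesgue"
proof -
  have "(\<lambda>x. complex_of_real (sqrt (V x))) \<in> borel_measurable lebesgue"
    by (rule measurable_compose[OF V_measurable])
      (intro borel_measurable_continuous_onI continuous_intros)
  then show ?thesis unfolding vfun_def[abs_def]
    by (rule borel_measurable_times) (use L2_fn[of \<phi>] in \<open>simp add: L2_function_def\<close>)
qed

text \<open>
  This is Hardy's inequality for \<open>V \<le> B / |x|\<^sup>2\<close>: the Sobolev space is the form domain.
\<close>
lemma H1_vdom: "\<exists>C\<ge>0. \<forall>\<phi> G. (\<phi>, G) \<in> H1 \<longrightarrow> \<phi> \<in> vdom \<and> norm (vroot \<phi>) \<le> C * norm G"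
proof -
  obtain B where B: "B > 0" "\<And>x. V x \<le> B / (norm x)\<^sup>2" using V_bound by blast
  have "\<phi> \<in> vdom \<and> norm (vroot \<phi>) \<le> sqrt (4 * B) * norm G" if h: "(\<phi>, G) \<in> H1" for \<phi> G
  proof -
    have "(\<integral>\<^sup>+ x. ennreal ((cmod (vfun \<phi> x))\<^sup>2) \<partial>lebesgue)
      \<le> (\<integral>\<^sup>+ x. ennreal B * ennreal ((cmod (fn \<phi> x))\<^sup>2 / (norm x)\<^sup>2) \<partial>lebesgue)"
    proof (rule nn_integral_mono)
      fix x
      have "(cmod (vfun \<phi> x))\<^sup>2 = V x * (cmod (fn \<phi> x))\<^sup>2"
        by (simp add: vfun_def norm_mult power_mult_distrib V_nonneg)
      also have "\<dots> \<le> B / (norm x)\<^sup>2 * (cmod (fn \<phi> x))\<^sup>2" by (intro mult_right_mono B) simp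
      finally have "(cmod (vfun \<phi> x))\<^sup>2 \<le> B * ((cmod (fn \<phi> x))\<^sup>2 / (norm x)\<^sup>2)" by simp
      then show "ennreal ((cmod (vfun \<phi> x))\<^sup>2) \<le> ennreal B * ennreal ((cmod (fn \<phi> x))\<^sup>2 / (norm x)\<^sup>2)"
        using B(1) by (simp add: ennreal_mult'[symmetric] ennreal_leI)
    qed
    also have "\<dots> = ennreal B * (\<integral>\<^sup>+ x. ennreal ((cmod (fn \<phi> x))\<^sup>2 / (norm x)\<^sup>2) \<partial>lebesgue)"
    proof (rule nn_integral_cmult)
      have "(\<lambda>x::real^'n. (norm x)\<^sup>2) \<in> borel_measurable lebesgue"
        by (intro measurable_completion) measurable
      then have "(\<lambda>x. (cmod (fn \<phi> x))\<^sup>2 / (norm x)\<^sup>2) \<in> borel_measurable lebesgue"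
        by (rule borel_measurable_divide[OF borel_measurable_integrable[OF L2_sq_integrable[OF L2_fn]]])
      then show "(\<lambda>x. ennreal ((cmod (fn \<phi> x))\<^sup>2 / (norm x)\<^sup>2)) \<in> borel_measurable lebesgue" by simp
    qed
    also have "\<dots> \<le> ennreal B * ennreal (4 * (norm G)\<^sup>2)" by (intro mult_left_mono hardy[OF n3 h]) simp
    also have "\<dots> = ennreal (4 * B * (norm G)\<^sup>2)" using B(1) by (simp add: ennreal_mult'[symmetric] mult_ac)
    finally have le: "(\<integral>\<^sup>+ x. ennreal ((cmod (vfun \<phi> x))\<^sup>2) \<partial>lebesgue) \<le> ennreal (4 * B * (norm G)\<^sup>2)" .
    then have L: "L2_function (vfun \<phi>)" unfolding L2_function_iff_nn by (auto intro: le_less_trans vfun_measurable)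
    from le have "(norm (vroot \<phi>))\<^sup>2 \<le> 4 * B * (norm G)\<^sup>2"
      using B(1) unfolding nn_norm_cls[OF L] vroot_def[symmetric] by (subst (asm) ennreal_le_iff) auto
    also have "\<dots> = (sqrt (4 * B) * norm G)\<^sup>2" using B(1) by (simp add: power_mult_distrib)
    finally have "norm (vroot \<phi>) \<le> sqrt (4 * B) * norm G" by (rule power2_le_imp_le) (use B in simp)
    with L show ?thesis by (simp add: vdom_def)
  qed
  then show ?thesis using B(1) by (intro exI[of _ "sqrt (4 * B)"]) auto
qed

lemma H1_in_vdom: "(\<phi>, G) \<in> H1 \<Longrightarrow> \<phi> \<in> vdom" using H1_vdom by blast

lemma vroot_AE: "\<phi> \<in> vdom \<Longrightarrow> AE x in lebesgue. fn (vroot \<phi>) x = of_real (sqrt (V x)) * fn \<phi> x"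
  using fn_cls[of "vfun \<phi>"] by (simp add: vdom_def vroot_def vfun_def)

lemma vroot_eqI:
  assumes "\<phi> \<in> vdom" "AE x in lebesgue. fn a x = of_real (sqrt (V x)) * fn \<phi> x"
  shows "vroot \<phi> = a"
proof (rule fn_eqI)
  show "AE x in lebesgue. fn (vroot \<phi>) x = fn a x"
    using vroot_AE[OF assms(1)] assms(2) by eventually_elim simp
qed

lemma vdomI:
  assumes "AE x in lebesgue. fn a x = of_real (sqrt (V x)) * fn \<phi> x" shows "\<phi> \<in> vdom"
  unfolding vdom_def mem_Collect_eq
  by (rule L2_cong_AE[OF L2_fn[of a] vfun_measurable]) (use assms in \<open>simp add: vfun_def\<close>)

lemma vroot_add:
  assumes "\<phi> \<in> vdom" "\<psi> \<in> vdom" shows "\<phi> + \<psi> \<in> vdom" "vroot (\<phi> + \<psi>) = vroot \<phi> + vroot \<psi>"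
proof -
  have ae: "AE x in lebesgue. fn (vroot \<phi> + vroot \<psi>) x = of_real (sqrt (V x)) * fn (\<phi> + \<psi>) x"
    using vroot_AE[OF assms(1)] vroot_AE[OF assms(2)] fn_add[of \<phi> \<psi>] fn_add[of "vroot \<phi>" "vroot \<psi>"]
    by eventually_elim (simp add: algebra_simps)
  show d: "\<phi> + \<psi> \<in> vdom" by (rule vdomI[OF ae])
  show "vroot (\<phi> + \<psi>) = vroot \<phi> + vroot \<psi>" by (rule vroot_eqI[OF d ae])
qed

lemma vroot_mult:
  assumes "\<phi> \<in> vdom" "bmult m" shows "mult_op m \<phi> \<in> vdom" "vroot (mult_op m \<phi>) = mult_op m (vroot \<phi>)"
proof -
  have ae: "AE x in lebesgue. fn (mult_op m (vroot \<phi>)) x = of_real (sqrt (V x)) * fn (mult_op m \<phi>) x"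
    using vroot_AE[OF assms(1)] fn_mult[OF assms(2), of \<phi>] fn_mult[OF assms(2), of "vroot \<phi>"]
    by eventually_elim simp
  show d: "mult_op m \<phi> \<in> vdom" by (rule vdomI[OF ae])
  show "vroot (mult_op m \<phi>) = mult_op m (vroot \<phi>)" by (rule vroot_eqI[OF d ae])
qed

lemma scaleR_mult: "r *\<^sub>R a = mult_op (\<lambda>x. of_real r) a"
  by (rule fn_eqI, use fn_scaleR[of r a] fn_mult[OF bmult_const, of "of_real r" a] in eventually_elim)
    (simp add: scaleR_conv_of_real)

lemma vroot_scaleR: "\<phi> \<in> vdom \<Longrightarrow> vroot (r *\<^sub>R \<phi>) = r *\<^sub>R vroot \<phi>"
  by (simp add: scaleR_mult vroot_mult)

lemma vroot_imul: "\<phi> \<in> vdom \<Longrightarrow> vroot (imul \<phi>) = imul (vroot \<phi>)"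
  by (simp add: imul_def vroot_mult)

lemma vroot_diff:
  assumes "\<phi> \<in> vdom" "\<psi> \<in> vdom" shows "vroot (\<phi> - \<psi>) = vroot \<phi> - vroot \<psi>"
proof -
  have "(- 1) *\<^sub>R \<psi> \<in> vdom" unfolding scaleR_mult by (rule vroot_mult(1)[OF assms(2)]) simp
  from vroot_add(2)[OF assms(1) this] vroot_scaleR[OF assms(2), of "- 1"] show ?thesis by simp
qed

lemma vroot_zero: "0 \<in> vdom" "vroot 0 = 0"
proof -
  show d: "0 \<in> vdom" using H1_in_vdom[of 0 0] subspace_0[OF H1_subspace] by (simp add: zero_prod_def)
  show "vroot 0 = 0" using vroot_scaleR[OF d, of 0] by simp
qed

lemma vroot_dilation:
  assumes "\<phi> \<in> vdom" "c > 0" shows "vroot (aff c 0 \<phi>) = c *\<^sub>R aff c 0 (vroot \<phi>)"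
proof -
  have sV: "sqrt (V x) = c * sqrt (V (c *\<^sub>R x))" for x
    using V_scale[OF assms(2), of x] assms(2) by (simp add: real_sqrt_mult)
  have ae: "AE x in lebesgue. fn (c *\<^sub>R aff c 0 (vroot \<phi>)) x = of_real (sqrt (V x)) * fn (aff c 0 \<phi>) x"
    using fn_scaleR[of c "aff c 0 (vroot \<phi>)"] fn_aff[OF assms(2), of 0 "vroot \<phi>"]
      AE_affine[OF assms(2) vroot_AE[OF assms(1)], of 0] fn_aff[OF assms(2), of 0 \<phi>]
  proof eventually_elim
    case (elim x)
    then show ?case using sV[of x] by (simp add: affn_def scaleR_conv_of_real mult_ac)
  qed
  show ?thesis by (rule vroot_eqI[OF vdomI[OF ae] ae])
qed

section \<open>The operator and its resolvent\<close>

text \<open>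
  The graph of \<open>H\<close>, defined through its quadratic form. The real parts of the sesquilinear identities
  suffice, as the test space is invariant under \<open>imul\<close>.
\<close>
definition \<Gamma> :: "('n l2 \<times> 'n l2) set" where
  "\<Gamma> = {(\<phi>, w). \<exists>G. (\<phi>, G) \<in> H1 \<and> (\<forall>\<psi> K. (\<psi>, K) \<in> H1 \<longrightarrow> G \<bullet> K + vroot \<phi> \<bullet> vroot \<psi> = w \<bullet> \<psi>)}"

text \<open>
  The triples \<open>(\<phi>, r \<nabla>\<phi>, r vroot \<phi>)\<close> with \<open>r\<^sup>2 = \<epsilon>\<close> form a closed subspace on which the ambient inner product is
  \<open>\<langle>\<phi>, \<psi>\<rangle> + \<epsilon> a(\<phi>, \<psi>)\<close>, where \<open>a\<close> is the form of \<open>H\<close>. The projection of \<open>(g, 0, 0)\<close> onto it solves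
  \<open>\<phi> + \<epsilon> H \<phi> = g\<close>.
\<close>
lemma form_onto:
  assumes e: "\<epsilon> > 0" shows "\<exists>\<phi> w. (\<phi>, w) \<in> \<Gamma> \<and> \<phi> + \<epsilon> *\<^sub>R w = g"
proof -
  obtain C where C: "C \<ge> 0" "\<And>\<phi> G. (\<phi>, G) \<in> H1 \<Longrightarrow> norm (vroot \<phi>) \<le> C * norm G" using H1_vdom by blast
  define r where "r = sqrt \<epsilon>"
  have r: "r > 0" "r * r = \<epsilon>" using e by (auto simp: r_def)
  define S where "S = (\<lambda>(\<phi>, G). (\<phi>, r *\<^sub>R G, r *\<^sub>R vroot \<phi>)) ` H1"
  have S: "subspace S"
  proof (rule subspaceI)
    show "0 \<in> S" unfolding S_def
      using subspace_0[OF H1_subspace] by (intro image_eqI[of _ _ "(0, 0)"]) (auto simp: zero_prod_def vroot_zero)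
  next
    fix a b assume "a \<in> S" "b \<in> S"
    then obtain \<phi> G \<psi> K where h: "(\<phi>, G) \<in> H1" "(\<psi>, K) \<in> H1"
      "a = (\<phi>, r *\<^sub>R G, r *\<^sub>R vroot \<phi>)" "b = (\<psi>, r *\<^sub>R K, r *\<^sub>R vroot \<psi>)"
      by (auto simp: S_def)
    then show "a + b \<in> S" unfolding S_def
      using subspace_add[OF H1_subspace h(1,2)] H1_in_vdom[OF h(1)] H1_in_vdom[OF h(2)]
      by (intro image_eqI[of _ _ "(\<phi> + \<psi>, G + K)"]) (auto simp: vroot_add scaleR_add_right)
  next
    fix c a assume "a \<in> S"
    then obtain \<phi> G where h: "(\<phi>, G) \<in> H1" "a = (\<phi>, r *\<^sub>R G, r *\<^sub>R vroot \<phi>)" by (auto simp: S_def)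
    then show "c *\<^sub>R a \<in> S" unfolding S_def
      using subspace_scale[OF H1_subspace h(1), of c] H1_in_vdom[OF h(1)]
      by (intro image_eqI[of _ _ "(c *\<^sub>R \<phi>, c *\<^sub>R G)"]) (auto simp: vroot_scaleR)
  qed
  have cl: "closed S"
    unfolding closed_sequential_limits
  proof (intro allI impI, elim conjE)
    fix x l assume x: "\<forall>k. x k \<in> S" and l: "x \<longlonglongrightarrow> l"
    then obtain h where h: "\<And>k. h k \<in> H1" "\<And>k. x k = (\<lambda>(\<phi>, G). (\<phi>, r *\<^sub>R G, r *\<^sub>R vroot \<phi>)) (h k)"
      using choice[of "\<lambda>k h. h \<in> H1 \<and> x k = (\<lambda>(\<phi>, G). (\<phi>, r *\<^sub>R G, r *\<^sub>R vroot \<phi>)) h"]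
      unfolding S_def image_iff by blast
    define \<phi> where "\<phi> k = fst (h k)" for k
    define G where "G k = snd (h k)" for k
    have H: "(\<phi> k, G k) \<in> H1" "x k = (\<phi> k, r *\<^sub>R G k, r *\<^sub>R vroot (\<phi> k))" for k
      using h[of k] by (auto simp: \<phi>_def G_def split: prod.splits)
    have l1: "\<phi> \<longlonglongrightarrow> fst l" using tendsto_fst[OF l] by (simp add: H(2))
    have l2: "(\<lambda>k. r *\<^sub>R G k) \<longlonglongrightarrow> fst (snd l)" using tendsto_fst[OF tendsto_snd[OF l]] by (simp add: H(2))
    have l3: "(\<lambda>k. r *\<^sub>R vroot (\<phi> k)) \<longlonglongrightarrow> snd (snd l)" using tendsto_snd[OF tendsto_snd[OF l]] by (simp add: H(2))
    have l2': "G \<longlonglongrightarrow> inverse r *\<^sub>R fst (snd l)"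
      using tendsto_scaleR[OF tendsto_const l2, of "inverse r"] r by simp
    have lh: "(\<lambda>k. (\<phi> k, G k)) \<longlonglongrightarrow> (fst l, inverse r *\<^sub>R fst (snd l))" by (intro tendsto_Pair l1 l2')
    have hl: "(fst l, inverse r *\<^sub>R fst (snd l)) \<in> H1"
      by (rule closed_sequentially[OF H1_closed H(1) lh])
    have "(\<lambda>k. vroot (\<phi> k) - vroot (fst l)) \<longlonglongrightarrow> 0"
    proof (rule Lim_null_comparison)
      show "\<forall>\<^sub>F k in sequentially. norm (vroot (\<phi> k) - vroot (fst l)) \<le> C * norm (G k - inverse r *\<^sub>R fst (snd l))"
      proof (intro always_eventually allI)
        fix k
        have "(\<phi> k - fst l, G k - inverse r *\<^sub>R fst (snd l)) \<in> H1"
          using subspace_diff[OF H1_subspace H(1)[of k] hl] by simp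
        from C(2)[OF this] show "norm (vroot (\<phi> k) - vroot (fst l)) \<le> C * norm (G k - inverse r *\<^sub>R fst (snd l))"
          by (simp add: vroot_diff H1_in_vdom[OF H(1)] H1_in_vdom[OF hl])
      qed
      have "(\<lambda>k. C * norm (G k - inverse r *\<^sub>R fst (snd l))) \<longlonglongrightarrow> C * norm (inverse r *\<^sub>R fst (snd l) - inverse r *\<^sub>R fst (snd l))"
        by (intro tendsto_intros l2')
      then show "(\<lambda>k. C * norm (G k - inverse r *\<^sub>R fst (snd l))) \<longlonglongrightarrow> 0" by simp
    qed
    from tendsto_scaleR[OF tendsto_const LIM_zero_cancel[OF this]]
    have "(\<lambda>k. r *\<^sub>R vroot (\<phi> k)) \<longlonglongrightarrow> r *\<^sub>R vroot (fst l)" .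
    from LIMSEQ_unique[OF l3 this] have "snd (snd l) = r *\<^sub>R vroot (fst l)" .
    then show "l \<in> S" unfolding S_def
      using r by (intro image_eqI[OF _ hl]) (auto simp: prod_eq_iff)
  qed
  obtain p where p: "p \<in> S" "\<And>s. s \<in> S \<Longrightarrow> ((g, 0, 0) - p) \<bullet> s = 0"
    using orthogonal_projection_exists[OF S cl, of "(g, 0, 0)"] by blast
  obtain \<phi> G where h: "(\<phi>, G) \<in> H1" "p = (\<phi>, r *\<^sub>R G, r *\<^sub>R vroot \<phi>)" using p(1) by (auto simp: S_def)
  have "G \<bullet> K + vroot \<phi> \<bullet> vroot \<psi> = ((g - \<phi>) /\<^sub>R \<epsilon>) \<bullet> \<psi>" if k: "(\<psi>, K) \<in> H1" for \<psi> K
  proof -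
    have "(\<psi>, r *\<^sub>R K, r *\<^sub>R vroot \<psi>) \<in> S" unfolding S_def using k by (intro image_eqI[of _ _ "(\<psi>, K)"]) auto
    from p(2)[OF this] have "(g - \<phi>) \<bullet> \<psi> = (r * r) * (G \<bullet> K + vroot \<phi> \<bullet> vroot \<psi>)"
      by (simp add: h(2) algebra_simps)
    then show ?thesis using e unfolding inner_scaleR_left r(2) by simp
  qed
  then have "(\<phi>, (g - \<phi>) /\<^sub>R \<epsilon>) \<in> \<Gamma>" using h(1) unfolding \<Gamma>_def by blast
  then show ?thesis using e by (intro exI[of _ \<phi>] exI[of _ "(g - \<phi>) /\<^sub>R \<epsilon>"]) simp
qed

lemma graphE:
  assumes "(\<phi>, w) \<in> \<Gamma>"
  obtains G where "(\<phi>, G) \<in> H1" "\<And>\<psi> K. (\<psi>, K) \<in> H1 \<Longrightarrow> G \<bullet> K + vroot \<phi> \<bullet> vroot \<psi> = w \<bullet> \<psi>"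
  using assms unfolding \<Gamma>_def by blast

lemma graphI: "(\<phi>, G) \<in> H1 \<Longrightarrow> (\<And>\<psi> K. (\<psi>, K) \<in> H1 \<Longrightarrow> G \<bullet> K + vroot \<phi> \<bullet> vroot \<psi> = w \<bullet> \<psi>) \<Longrightarrow> (\<phi>, w) \<in> \<Gamma>"
  unfolding \<Gamma>_def by blast

lemma \<Gamma>_selfadjoint: "selfadjoint_graph \<Gamma> imul"
proof (rule selfadjoint_graph.intro)
  show "linear (imul :: 'n l2 \<Rightarrow> 'n l2)" by (rule imul_linear)
  show "norm (imul x) = norm x" for x :: "'n l2" by (rule imul_norm)
  show "imul x \<bullet> y = - (x \<bullet> imul y)" for x y :: "'n l2" by (rule imul_anti)
  show "subspace \<Gamma>"
  proof (rule subspaceI)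
    have "((0 :: 'n l2), (0 :: ('n l2) ^ 'n)) \<in> H1" using subspace_0[OF H1_subspace] by (simp add: zero_prod_def)
    then have "(0, 0) \<in> \<Gamma>" by (rule graphI) (simp add: vroot_zero)
    then show "0 \<in> \<Gamma>" by (simp add: zero_prod_def)
  next
    fix a b assume ab: "a \<in> \<Gamma>" "b \<in> \<Gamma>"
    obtain \<phi> w \<psi> v where e: "a = (\<phi>, w)" "b = (\<psi>, v)" by fastforce
    obtain G where G: "(\<phi>, G) \<in> H1" "\<And>\<psi> K. (\<psi>, K) \<in> H1 \<Longrightarrow> G \<bullet> K + vroot \<phi> \<bullet> vroot \<psi> = w \<bullet> \<psi>"
      using ab(1) e by (auto elim!: graphE)
    obtain G' where G': "(\<psi>, G') \<in> H1" "\<And>\<xi> K. (\<xi>, K) \<in> H1 \<Longrightarrow> G' \<bullet> K + vroot \<psi> \<bullet> vroot \<xi> = v \<bullet> \<xi>"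
      using ab(2) e by (auto elim!: graphE)
    have "(\<phi> + \<psi>, G + G') \<in> H1" using subspace_add[OF H1_subspace G(1) G'(1)] by simp
    then have "(\<phi> + \<psi>, w + v) \<in> \<Gamma>"
    proof (rule graphI)
      fix \<xi> :: "'n l2" and K assume k: "(\<xi>, K) \<in> H1"
      show "(G + G') \<bullet> K + vroot (\<phi> + \<psi>) \<bullet> vroot \<xi> = (w + v) \<bullet> \<xi>"
        using G(2)[OF k] G'(2)[OF k] H1_in_vdom[OF G(1)] H1_in_vdom[OF G'(1)]
        by (simp add: vroot_add inner_add_left)
    qed
    then show "a + b \<in> \<Gamma>" by (simp add: e)
  next
    fix c a assume a: "a \<in> \<Gamma>"
    obtain \<phi> w where e: "a = (\<phi>, w)" by fastforce
    obtain G where G: "(\<phi>, G) \<in> H1" "\<And>\<psi> K. (\<psi>, K) \<in> H1 \<Longrightarrow> G \<bullet> K + vroot \<phi> \<bullet> vroot \<psi> = w \<bullet> \<psi>"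
      using a e by (auto elim!: graphE)
    have "(c *\<^sub>R \<phi>, c *\<^sub>R G) \<in> H1" using subspace_scale[OF H1_subspace G(1), of c] by simp
    then have "(c *\<^sub>R \<phi>, c *\<^sub>R w) \<in> \<Gamma>"
    proof (rule graphI)
      fix \<xi> :: "'n l2" and K assume k: "(\<xi>, K) \<in> H1"
      show "(c *\<^sub>R G) \<bullet> K + vroot (c *\<^sub>R \<phi>) \<bullet> vroot \<xi> = (c *\<^sub>R w) \<bullet> \<xi>"
        using G(2)[OF k, symmetric] H1_in_vdom[OF G(1)] by (simp add: vroot_scaleR distrib_left)
    qed
    then show "c *\<^sub>R a \<in> \<Gamma>" by (simp add: e)
  qed
  show "(imul \<phi>, imul w) \<in> \<Gamma>" if a: "(\<phi>, w) \<in> \<Gamma>" for \<phi> w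
  proof -
    obtain G where G: "(\<phi>, G) \<in> H1" "\<And>\<psi> K. (\<psi>, K) \<in> H1 \<Longrightarrow> G \<bullet> K + vroot \<phi> \<bullet> vroot \<psi> = w \<bullet> \<psi>"
      using a by (auto elim!: graphE)
    show ?thesis
    proof (rule graphI[OF H1_imul[OF G(1)]])
      fix \<xi> :: "'n l2" and K assume k: "(\<xi>, K) \<in> H1"
      have "(\<chi> i. imul (G $ i)) \<bullet> K + vroot (imul \<phi>) \<bullet> vroot \<xi> = - (G \<bullet> (\<chi> i. imul (K $ i)) + vroot \<phi> \<bullet> vroot (imul \<xi>))"
        using H1_in_vdom[OF G(1)] H1_in_vdom[OF k]
        by (simp add: vroot_imul inner_vec_def imul_anti sum_negf)
      also have "\<dots> = - (w \<bullet> imul \<xi>)" by (simp only: G(2)[OF H1_imul[OF k]])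
      finally show "(\<chi> i. imul (G $ i)) \<bullet> K + vroot (imul \<phi>) \<bullet> vroot \<xi> = imul w \<bullet> \<xi>" by (simp add: imul_anti)
    qed
  qed
  show "w \<bullet> \<phi>' = \<phi> \<bullet> w'" if a: "(\<phi>, w) \<in> \<Gamma>" "(\<phi>', w') \<in> \<Gamma>" for \<phi> w \<phi>' w'
  proof -
    obtain G where G: "(\<phi>, G) \<in> H1" "\<And>\<psi> K. (\<psi>, K) \<in> H1 \<Longrightarrow> G \<bullet> K + vroot \<phi> \<bullet> vroot \<psi> = w \<bullet> \<psi>"
      using a by (auto elim!: graphE)
    obtain G' where G': "(\<phi>', G') \<in> H1" "\<And>\<xi> K. (\<xi>, K) \<in> H1 \<Longrightarrow> G' \<bullet> K + vroot \<phi>' \<bullet> vroot \<xi> = w' \<bullet> \<xi>"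
      using a by (auto elim!: graphE)
    show ?thesis using G(2)[OF G'(1)] G'(2)[OF G(1)] by (simp add: inner_commute)
  qed
  show "0 \<le> w \<bullet> \<phi>" if a: "(\<phi>, w) \<in> \<Gamma>" for \<phi> w
  proof -
    obtain G where G: "(\<phi>, G) \<in> H1" "\<And>\<psi> K. (\<psi>, K) \<in> H1 \<Longrightarrow> G \<bullet> K + vroot \<phi> \<bullet> vroot \<psi> = w \<bullet> \<psi>"
      using a by (auto elim!: graphE)
    show ?thesis using G(2)[OF G(1)] inner_ge_zero[of G] inner_ge_zero[of "vroot \<phi>"] by linarith
  qed
  show "w = 0" if a: "(0, w) \<in> \<Gamma>" for w
  proof -
    obtain G where G: "(0, G) \<in> H1" "\<And>\<psi> K. (\<psi>, K) \<in> H1 \<Longrightarrow> G \<bullet> K + vroot 0 \<bullet> vroot \<psi> = w \<bullet> \<psi>"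
      using a by (auto elim!: graphE)
    show ?thesis
    proof (rule total_eqI)
      fix \<theta> :: "real^'n \<Rightarrow> complex" assume t: "ctest \<theta>"
      show "w \<bullet> cls \<theta> = 0 \<bullet> cls \<theta>" using G(2)[OF ctest_H1[OF t]] by (simp add: H1_zero[OF G(1)] vroot_zero)
    qed
  qed
  show "\<epsilon> > 0 \<Longrightarrow> \<exists>\<phi> w. (\<phi>, w) \<in> \<Gamma> \<and> \<phi> + \<epsilon> *\<^sub>R w = g" for \<epsilon> g by (rule form_onto)
qed

text \<open>
  Gradient and \<open>vroot\<close> scale alike under dilations, so \<open>H\<close> is homogeneous of degree \<open>-2\<close>.
\<close>
lemma \<Gamma>_dilation:
  assumes c: "c > 0" and a: "(\<phi>, w) \<in> \<Gamma>" shows "(aff c 0 \<phi>, c\<^sup>2 *\<^sub>R aff c 0 w) \<in> \<Gamma>"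
proof -
  obtain G where G: "(\<phi>, G) \<in> H1" "\<And>\<psi> K. (\<psi>, K) \<in> H1 \<Longrightarrow> G \<bullet> K + vroot \<phi> \<bullet> vroot \<psi> = w \<bullet> \<psi>"
    using a by (auto elim!: graphE)
  have c': "1 / c > 0" using c by simp
  show ?thesis
  proof (rule graphI[OF H1_dilation[OF c G(1)]])
    fix \<psi> :: "'n l2" and K assume k: "(\<psi>, K) \<in> H1"
    have "(\<chi> i. c *\<^sub>R aff c 0 (G $ i)) \<bullet> K + vroot (aff c 0 \<phi>) \<bullet> vroot \<psi>
      = c\<^sup>2 * (G \<bullet> (\<chi> i. (1 / c) *\<^sub>R aff (1 / c) 0 (K $ i)) + vroot \<phi> \<bullet> vroot (aff (1 / c) 0 \<psi>))"
      using c H1_in_vdom[OF G(1)] H1_in_vdom[OF k]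
      by (simp add: vroot_dilation inner_vec_def aff_inverse[OF c] sum_distrib_left power2_eq_square distrib_left)
    also have "\<dots> = (c\<^sup>2 *\<^sub>R aff c 0 w) \<bullet> \<psi>"
      unfolding G(2)[OF H1_dilation[OF c' k]] by (simp add: aff_inverse[OF c])
    finally show "(\<chi> i. c *\<^sub>R aff c 0 (G $ i)) \<bullet> K + vroot (aff c 0 \<phi>) \<bullet> vroot \<psi> = (c\<^sup>2 *\<^sub>R aff c 0 w) \<bullet> \<psi>" .
  qed
qed

end

section \<open>Gaussian multipliers\<close>

definition gauss :: "complex \<Rightarrow> real^'n::finite \<Rightarrow> complex" where
  "gauss z x = exp (- (z * of_real (x \<bullet> x)))"

lemma smooth_norm_sq: "smooth (\<lambda>x::real^'n::finite. x \<bullet> x)"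
  unfolding inner_vec_def by (auto intro!: smooth_sum smooth_mult smooth_component)

lemma gauss_csmooth: "csmooth (gauss z :: real^'n::finite \<Rightarrow> complex)"
proof -
  define h where "h k s = (- z) ^ k * exp (- (z * complex_of_real s))" for k :: nat and s :: real
  have d: "(h k has_vector_derivative h (Suc k) s) (at s)" for k s
  proof -
    have "((\<lambda>w. (- z) ^ k * exp (- (z * w))) has_field_derivative (- z) ^ k * (exp (- (z * of_real s)) * - z)) (at (complex_of_real s))"
      by (auto intro!: derivative_eq_intros)
    from has_vector_derivative_real_field[OF this] show ?thesis
      by (simp add: h_def[abs_def] mult_ac)
  qed
  have "((\<lambda>s. Re (h k s)) has_real_derivative Re (h (Suc k) s)) (at s)"
    and "((\<lambda>s. Im (h k s)) has_real_derivative Im (h (Suc k) s)) (at s)" for k s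
    using bounded_linear.has_vector_derivative[OF bounded_linear_Re d]
      bounded_linear.has_vector_derivative[OF bounded_linear_Im d]
    by (simp_all add: has_real_derivative_iff_has_vector_derivative)
  then have "smooth (\<lambda>x::real^'n. Re (h 0 (x \<bullet> x)))" "smooth (\<lambda>x::real^'n. Im (h 0 (x \<bullet> x)))"
    using smooth_compose[where h = "\<lambda>k s. Re (h k s)" and j = 0, OF _ smooth_norm_sq]
      smooth_compose[where h = "\<lambda>k s. Im (h k s)" and j = 0, OF _ smooth_norm_sq] by blast+
  then show ?thesis unfolding csmooth_def gauss_def h_def by simp
qed

lemma gauss_has_derivative:
  "(gauss z has_derivative (\<lambda>h. gauss z x * - (z * of_real (2 * (x \<bullet> h))))) (at x)"
proof -
  have "((\<lambda>x. x \<bullet> x) has_derivative (\<lambda>h. 2 * (x \<bullet> h))) (at x)"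
    by (auto intro!: derivative_eq_intros simp: inner_commute)
  then have "((\<lambda>x. - (z * complex_of_real (x \<bullet> x))) has_derivative (\<lambda>h. - (z * of_real (2 * (x \<bullet> h))))) (at x)"
    by (intro derivative_intros)
  from has_derivative_compose[OF this DERIV_exp[unfolded has_field_derivative_def]]
  show ?thesis unfolding gauss_def[abs_def] .
qed

lemma cpd_gauss: "cpd i (gauss z) x = - 2 * z * (of_real (x $ i) * gauss z x)"
  unfolding cpd_eqI[OF gauss_csmooth gauss_has_derivative] by (simp add: inner_axis mult_ac)

lemma coord_csmooth: "csmooth (\<lambda>x::real^'n::finite. complex_of_real (x $ i))"
  by (intro csmooth_of_real smooth_component)

lemma cpd_coord: "cpd j (\<lambda>x::real^'n::finite. complex_of_real (x $ i)) x = of_real (axis j 1 $ i)"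
proof -
  have "((\<lambda>x::real^'n. complex_of_real (x $ i)) has_derivative (\<lambda>h. of_real (h $ i))) (at x)"
    by (intro derivative_intros bounded_linear.has_derivative[OF bounded_linear_vec_nth has_derivative_ident])
  then show ?thesis by (rule cpd_eqI[OF coord_csmooth])
qed

lemma cpd_gauss_fun: "cpd i (gauss z) = (\<lambda>x. - 2 * z * (of_real (x $ i) * gauss z x))"
  by (rule ext) (rule cpd_gauss)

lemma cpd2_gauss:
  "cpd j (cpd i (gauss z)) x = - 2 * z * (of_real (axis j 1 $ i) * gauss z x) + 4 * z\<^sup>2 * (of_real (x $ i * x $ j) * gauss z x)"
  unfolding cpd_gauss_fun cpd_mult[OF csmooth_const csmooth_mult[OF coord_csmooth gauss_csmooth]]
    cpd_mult[OF coord_csmooth gauss_csmooth] cpd_const cpd_coord cpd_gauss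
  by (simp add: power2_eq_square algebra_simps)

lemma cmod_gauss: "cmod (gauss z x) = exp (- (Re z * (x \<bullet> x)))"
  by (simp add: gauss_def)

lemma gauss_bounds:
  assumes z: "Re z > 0"
  shows "cmod (gauss z x) \<le> 1" "(x \<bullet> x) * cmod (gauss z x) \<le> 1 / Re z"
    "\<bar>x $ i\<bar> * cmod (gauss z x) \<le> 1 + 1 / Re z" "\<bar>x $ i * x $ j\<bar> * cmod (gauss z x) \<le> 1 / Re z"
proof -
  let ?q = "x \<bullet> x" and ?g = "cmod (gauss z x)"
  have q0: "0 \<le> ?q" by simp
  show g1: "?g \<le> 1" using z by (simp add: cmod_gauss)
  have "Re z * ?q \<le> exp (Re z * ?q)" using exp_ge_add_one_self[of "Re z * ?q"] by linarith
  then have "Re z * ?q * ?g \<le> 1" by (simp add: cmod_gauss exp_minus field_simps)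
  then show g2: "?q * ?g \<le> 1 / Re z" using z by (simp add: field_simps)
  have c: "(x $ j)\<^sup>2 \<le> ?q" for j
  proof -
    have "x $ j * x $ j \<le> (\<Sum>i\<in>UNIV. x $ i * x $ i)" by (rule member_le_sum) auto
    then show ?thesis unfolding inner_vec_def by (simp add: power2_eq_square)
  qed
  have "\<bar>x $ i * x $ j\<bar> \<le> ?q"
  proof -
    have "2 * \<bar>x $ i * x $ j\<bar> \<le> (x $ i)\<^sup>2 + (x $ j)\<^sup>2"
      using sum_squares_bound[of "\<bar>x $ i\<bar>" "\<bar>x $ j\<bar>"] by (simp add: abs_mult)
    also have "\<dots> \<le> ?q + ?q" by (rule add_mono[OF c c])
    finally show ?thesis by simp
  qed
  then show "\<bar>x $ i * x $ j\<bar> * ?g \<le> 1 / Re z" by (rule order_trans[OF mult_right_mono g2]) simp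
  have "2 * \<bar>x $ i\<bar> \<le> (x $ i)\<^sup>2 + 1" using sum_squares_bound[of "\<bar>x $ i\<bar>" 1] by simp
  then have "\<bar>x $ i\<bar> \<le> 1 + ?q" using c[of i] by (simp add: abs_if split: if_splits)
  then have "\<bar>x $ i\<bar> * ?g \<le> (1 + ?q) * ?g" by (rule mult_right_mono) simp
  also have "\<dots> \<le> 1 + 1 / Re z" using g1 g2 by (simp add: distrib_right)
  finally show "\<bar>x $ i\<bar> * ?g \<le> 1 + 1 / Re z" .
qed

lemma gauss_measurable: "gauss z \<in> borel_measurable lebesgue"
  by (rule csmooth_measurable[OF gauss_csmooth])

lemma bmult_gauss:
  assumes z: "Re z > 0"
  shows "bmult (gauss z :: real^'n::finite \<Rightarrow> complex)" "bmult (\<lambda>x::real^'n::finite. of_real (x $ i) * gauss z x)"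
    "bmult (\<lambda>x::real^'n::finite. of_real (x $ i * x $ j) * gauss z x)"
    "bmult (\<lambda>x::real^'n::finite. of_real (x \<bullet> x) * gauss z x)"
proof -
  show "bmult (gauss z :: real^'n \<Rightarrow> complex)" by (rule bmultI[OF gauss_measurable gauss_bounds(1)[OF z]])
  have m: "csmooth (\<lambda>x::real^'n. of_real (x $ i) * gauss z x)" "csmooth (\<lambda>x::real^'n. of_real (x $ i * x $ j) * gauss z x)"
    "csmooth (\<lambda>x::real^'n. of_real (x \<bullet> x) * gauss z x)"
    by (intro csmooth_mult gauss_csmooth csmooth_of_real smooth_mult smooth_component smooth_norm_sq)+
  show "bmult (\<lambda>x::real^'n. of_real (x $ i) * gauss z x)"
    by (rule bmultI[OF csmooth_measurable[OF m(1)], where C = "1 + 1 / Re z"])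
      (use gauss_bounds(3)[OF z] in \<open>simp add: norm_mult\<close>)
  show "bmult (\<lambda>x::real^'n. of_real (x $ i * x $ j) * gauss z x)"
    by (rule bmultI[OF csmooth_measurable[OF m(2)], where C = "1 / Re z"])
      (use gauss_bounds(4)[OF z] in \<open>simp only: norm_mult norm_of_real\<close>)
  show "bmult (\<lambda>x::real^'n. of_real (x \<bullet> x) * gauss z x)"
  proof (rule bmultI[OF csmooth_measurable[OF m(3)], where C = "1 / Re z"])
    fix x :: "real^'n"
    show "cmod (of_real (x \<bullet> x) * gauss z x) \<le> 1 / Re z"
      using gauss_bounds(2)[OF z, of x] by (simp only: norm_mult norm_of_real abs_of_nonneg[OF inner_ge_zero])
  qed
qed

lemma bmult_cpd_gauss:
  assumes z: "Re z > 0" shows "bmult (cpd i (gauss z :: real^'n::finite \<Rightarrow> complex))" "bmult (cpd j (cpd i (gauss z :: real^'n \<Rightarrow> complex)))"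
proof -
  show "bmult (cpd i (gauss z :: real^'n \<Rightarrow> complex))"
    unfolding cpd_gauss_fun by (intro bmult_mult[OF bmult_const] bmult_gauss z)
  have "bmult (\<lambda>x::real^'n. - 2 * z * (of_real (axis j 1 $ i) * gauss z x) + 4 * z\<^sup>2 * (of_real (x $ i * x $ j) * gauss z x))"
    by (intro bmult_add bmult_mult[OF bmult_const] bmult_gauss z)
  then show "bmult (cpd j (cpd i (gauss z :: real^'n \<Rightarrow> complex)))"
    by (simp add: cpd2_gauss[abs_def] bmult_def)
qed

context potential
begin

text \<open>
  \<open>H (m \<psi>) = m H \<psi> - 2 \<nabla>m \<bullet> \<nabla>\<psi> - (\<Delta>m) \<psi>\<close>. The form is tested with the conjugate of \<open>m\<close> times \<open>\<xi>\<close>, and the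
  remaining gradient of \<open>\<xi>\<close> is removed by an integration by parts.
\<close>
lemma \<Gamma>_mult:
  assumes m: "csmooth m" "bmult m" "\<And>i. bmult (cpd i m)" "\<And>i j. bmult (cpd j (cpd i m))"
    and h: "(\<psi>, G) \<in> H1" and eq: "\<And>\<xi> K. (\<xi>, K) \<in> H1 \<Longrightarrow> G \<bullet> K + vroot \<psi> \<bullet> vroot \<xi> = w \<bullet> \<xi>"
  shows "(mult_op m \<psi>, mult_op m w - (\<Sum>i\<in>UNIV. 2 *\<^sub>R mult_op (cpd i m) (G $ i) + mult_op (cpd i (cpd i m)) \<psi>)) \<in> \<Gamma>"
proof (rule graphI[OF H1_mult[OF m(1-3) h]])
  fix \<xi> :: "'n l2" and K assume k: "(\<xi>, K) \<in> H1"
  let ?n = "\<lambda>x. cnj (m x)"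
  have n: "csmooth ?n" "bmult ?n" "\<And>i. bmult (cpd i ?n)"
  proof -
    show "csmooth ?n" by (rule csmooth_cnj[OF m(1)])
    show "bmult ?n" by (rule bmult_cnj[OF m(2)])
    have "cpd i ?n = (\<lambda>x. cnj (cpd i m x))" for i by (rule ext) (rule cpd_cnj[OF m(1)])
    then show "bmult (cpd i ?n)" for i using bmult_cnj[OF m(3)] by simp
  qed
  have cn: "cpd i ?n = (\<lambda>x. cnj (cpd i m x))" for i by (rule ext) (rule cpd_cnj[OF m(1)])
  \<comment> \<open>the equation for \<open>\<psi>\<close>, tested with the conjugate of \<open>m\<close> times \<open>\<xi>\<close>\<close>
  have 1: "(\<Sum>i\<in>UNIV. G $ i \<bullet> mult_op ?n (K $ i) + G $ i \<bullet> mult_op (cpd i ?n) \<xi>) + vroot \<psi> \<bullet> mult_op ?n (vroot \<xi>) = w \<bullet> mult_op ?n \<xi>"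
    using eq[OF H1_mult[OF n k]] H1_in_vdom[OF k]
    by (simp add: inner_vec_def inner_add_right vroot_mult n)
  \<comment> \<open>the gradient of \<open>\<xi>\<close> is moved to \<open>(\<nabla>m) \<psi>\<close>\<close>
  have 2: "mult_op (cpd i m) \<psi> \<bullet> K $ i = - ((mult_op (cpd i m) (G $ i) + mult_op (cpd i (cpd i m)) \<psi>) \<bullet> \<xi>)" for i
    using integration_by_parts[OF k H1_mult[OF csmooth_cpd[OF m(1)] m(3) m(4) h], of i i]
    by (simp add: inner_commute)
  have "(\<chi> i. mult_op m (G $ i) + mult_op (cpd i m) \<psi>) \<bullet> K + vroot (mult_op m \<psi>) \<bullet> vroot \<xi>
     = (\<Sum>i\<in>UNIV. G $ i \<bullet> mult_op ?n (K $ i) + mult_op (cpd i m) \<psi> \<bullet> K $ i) + vroot \<psi> \<bullet> mult_op ?n (vroot \<xi>)"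
    using H1_in_vdom[OF h] by (simp add: inner_vec_def inner_add_left vroot_mult m mult_adjoint[OF m(2)])
  also have "\<dots> = w \<bullet> mult_op ?n \<xi> + (\<Sum>i\<in>UNIV. mult_op (cpd i m) \<psi> \<bullet> K $ i - G $ i \<bullet> mult_op (cpd i ?n) \<xi>)"
    unfolding 1[symmetric] by (simp add: sum.distrib sum_subtractf)
  also have "\<dots> = (mult_op m w - (\<Sum>i\<in>UNIV. 2 *\<^sub>R mult_op (cpd i m) (G $ i) + mult_op (cpd i (cpd i m)) \<psi>)) \<bullet> \<xi>"
    unfolding 2 cn mult_adjoint[OF m(3), symmetric] mult_adjoint[OF m(2), symmetric]
    by (simp add: inner_diff_left inner_sum_left inner_add_left sum_negf sum_subtractf sum.distrib algebra_simps)
  finally show "(\<chi> i. mult_op m (G $ i) + mult_op (cpd i m) \<psi>) \<bullet> K + vroot (mult_op m \<psi>) \<bullet> vroot \<xi>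
     = (mult_op m w - (\<Sum>i\<in>UNIV. 2 *\<^sub>R mult_op (cpd i m) (G $ i) + mult_op (cpd i (cpd i m)) \<psi>)) \<bullet> \<xi>" .
qed

text \<open>
  The function \<open>H (gauss z \<psi>)\<close> when \<open>G\<close> is the gradient of \<open>\<psi>\<close> and \<open>w = H \<psi>\<close>.
\<close>
definition gauss_image :: "complex \<Rightarrow> 'n l2 \<Rightarrow> 'n l2 ^ 'n \<Rightarrow> 'n l2 \<Rightarrow> real^'n \<Rightarrow> complex" where
  "gauss_image z \<psi> G w x = gauss z x * (fn w x + 4 * z * (\<Sum>i\<in>UNIV. of_real (x $ i) * fn (G $ i) x)
      + (2 * of_nat CARD('n) * z - 4 * z\<^sup>2 * of_real (x \<bullet> x)) * fn \<psi> x)"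

lemma gauss_image_eq:
  "gauss_image z \<psi> G w x = gauss z x * fn w x
     - (\<Sum>i\<in>UNIV. 2 *\<^sub>R (cpd i (gauss z) x * fn (G $ i) x) + cpd i (cpd i (gauss z)) x * fn \<psi> x)"
proof -
  have s: "(\<Sum>i\<in>UNIV. of_real (x $ i * x $ i)) = complex_of_real (x \<bullet> x)" by (simp add: inner_vec_def)
  have "(\<Sum>i\<in>UNIV. 2 *\<^sub>R (cpd i (gauss z) x * fn (G $ i) x) + cpd i (cpd i (gauss z)) x * fn \<psi> x)
    = (\<Sum>i\<in>UNIV. (- 4 * z * gauss z x) * (of_real (x $ i) * fn (G $ i) x) + (- 2 * z * gauss z x * fn \<psi> x)
        + (4 * z\<^sup>2 * gauss z x * fn \<psi> x) * of_real (x $ i * x $ i))"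
    by (intro sum.cong refl) (simp add: cpd_gauss cpd2_gauss scaleR_conv_of_real algebra_simps)
  also have "\<dots> = (- 4 * z * gauss z x) * (\<Sum>i\<in>UNIV. of_real (x $ i) * fn (G $ i) x)
     + of_nat CARD('n) * (- 2 * z * gauss z x * fn \<psi> x) + (4 * z\<^sup>2 * gauss z x * fn \<psi> x) * of_real (x \<bullet> x)"
    unfolding sum.distrib sum_distrib_left[symmetric] s by simp
  finally show ?thesis unfolding gauss_image_def by (simp add: algebra_simps)
qed

lemma \<Gamma>_gauss:
  assumes z: "Re z > 0"
    and h: "(\<psi>, G) \<in> H1" and eq: "\<And>\<xi> K. (\<xi>, K) \<in> H1 \<Longrightarrow> G \<bullet> K + vroot \<psi> \<bullet> vroot \<xi> = w \<bullet> \<xi>"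
  shows "L2_function (gauss_image z \<psi> G w)" "(mult_op (gauss z) \<psi>, cls (gauss_image z \<psi> G w)) \<in> \<Gamma>"
proof -
  note b = bmult_gauss[OF z] bmult_cpd_gauss[OF z]
  have L1: "L2_function (\<lambda>x. gauss z x * fn w x)" by (intro L2_bmult b L2_fn)
  have L2: "L2_function (\<lambda>x. cpd i (gauss z) x * fn (G $ i) x)" for i by (intro L2_bmult b L2_fn)
  have L3: "L2_function (\<lambda>x. cpd i (cpd i (gauss z)) x * fn \<psi> x)" for i by (intro L2_bmult b L2_fn)
  have L4: "L2_function (\<lambda>x. 2 *\<^sub>R (cpd i (gauss z) x * fn (G $ i) x) + cpd i (cpd i (gauss z)) x * fn \<psi> x)" for i
    by (intro L2_add L2_scaleR L2 L3)
  have L5: "L2_function (\<lambda>x. \<Sum>i\<in>UNIV. 2 *\<^sub>R (cpd i (gauss z) x * fn (G $ i) x) + cpd i (cpd i (gauss z)) x * fn \<psi> x)"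
    by (rule L2_sum) (rule L4)
  show "L2_function (gauss_image z \<psi> G w)" unfolding gauss_image_eq[abs_def] by (intro L2_diff L1 L5)
  have "cls (gauss_image z \<psi> G w) = mult_op (gauss z) w - (\<Sum>i\<in>UNIV. 2 *\<^sub>R mult_op (cpd i (gauss z)) (G $ i) + mult_op (cpd i (cpd i (gauss z))) \<psi>)"
    unfolding gauss_image_eq[abs_def] cls_diff[OF L1 L5] cls_sum[OF L4] cls_add[OF L2_scaleR[OF L2] L3] cls_scaleR[OF L2] mult_op_def ..
  then show "(mult_op (gauss z) \<psi>, cls (gauss_image z \<psi> G w)) \<in> \<Gamma>"
    using \<Gamma>_mult[OF gauss_csmooth b(1) b(5) b(6) h eq] by simp
qed

section \<open>The given solution as a weak solution\<close>

text \<open>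
  Imaginary parts of the defining identity are obtained by testing with \<open>i \<psi>\<close>.
\<close>
lemma \<Gamma>_schroedinger_operator:
  assumes a: "(\<phi>, w) \<in> \<Gamma>" shows "schroedinger_operator W (fn \<phi>) (fn w)"
proof -
  obtain G where G: "(\<phi>, G) \<in> H1" "\<And>\<psi> K. (\<psi>, K) \<in> H1 \<Longrightarrow> G \<bullet> K + vroot \<phi> \<bullet> vroot \<psi> = w \<bullet> \<psi>"
    using a by (auto elim!: graphE)
  let ?G = "\<lambda>x. \<chi> i. fn (G $ i) x"
  have "schroedinger_form W (fn \<phi>) ?G \<psi> K = L2_inner (fn w) \<psi>" if k: "H1_gradient \<psi> K" for \<psi> K
  proof -
    have L: "L2_function \<psi>" "L2_function (\<lambda>x. K x $ i)" for i using k by (auto simp: H1_gradient_def)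
    define K' where "K' = (\<chi> i. cls (\<lambda>x. K x $ i))"
    have k': "(cls \<psi>, K') \<in> H1" unfolding K'_def by (rule H1_gradient_imp_H1[OF k])
    note vd = H1_in_vdom[OF G(1)] H1_in_vdom[OF k']
    have pot: "L2_inner (\<lambda>x. of_real (inverse_square_potential W x) * fn \<phi> x) \<psi> = L2_inner (fn (vroot \<phi>)) (fn (vroot (cls \<psi>)))"
      unfolding L2_inner_def
    proof (rule integral_cong_AE)
      have 1: "(\<lambda>x. fn (vroot \<phi>) x * cnj (fn (vroot (cls \<psi>)) x)) \<in> borel_measurable lebesgue"
        by (intro borel_measurable_integrable L2_prod_integrable L2_fn)
      then show "(\<lambda>x. fn (vroot \<phi>) x * cnj (fn (vroot (cls \<psi>)) x)) \<in> borel_measurable lebesgue" .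
      have ae: "AE x in lebesgue. of_real (inverse_square_potential W x) * fn \<phi> x * cnj (\<psi> x) = fn (vroot \<phi>) x * cnj (fn (vroot (cls \<psi>)) x)"
        using vroot_AE[OF vd(1)] vroot_AE[OF vd(2)] fn_cls[OF L(1)]
      proof eventually_elim
        case (elim x)
        have "complex_of_real (sqrt (V x)) * of_real (sqrt (V x)) = of_real (V x)"
          by (simp add: of_real_mult[symmetric] V_nonneg del: of_real_mult)
        then show ?case using elim by (simp add: V_def[symmetric] mult_ac)
      qed
      then show "AE x in lebesgue. of_real (inverse_square_potential W x) * fn \<phi> x * cnj (\<psi> x) = fn (vroot \<phi>) x * cnj (fn (vroot (cls \<psi>)) x)" .
      show "(\<lambda>x. of_real (inverse_square_potential W x) * fn \<phi> x * cnj (\<psi> x)) \<in> borel_measurable lebesgue"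
        by (rule borel_measurable_AE[OF 1]) (use ae in eventually_elim, simp)
    qed
    have re: "Re (schroedinger_form W (fn \<phi>) ?G \<psi> K) = G \<bullet> K' + vroot \<phi> \<bullet> vroot (cls \<psi>)"
      unfolding schroedinger_form_def pot
      by (simp add: L2_inner_Re L inner_vec_def K'_def)
    have im: "Im (schroedinger_form W (fn \<phi>) ?G \<psi> K) = G \<bullet> (\<chi> i. imul (K' $ i)) + vroot \<phi> \<bullet> vroot (imul (cls \<psi>))"
      unfolding schroedinger_form_def pot vroot_imul[OF vd(2)]
      by (simp add: L2_inner_Im L inner_vec_def K'_def)
    show ?thesis
      using G(2)[OF k'] G(2)[OF H1_imul[OF k']] re im
      by (simp add: complex_eq_iff L2_inner_Re L2_inner_Im L)
  qed
  then show ?thesis unfolding schroedinger_operator_def using H1_imp_H1_gradient[OF G(1)] by auto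
qed

lemma solution_weak_solution:
  assumes u: "schroedinger_solution W f u"
  shows "selfadjoint_graph.weak_solution \<Gamma> imul UNIV (\<lambda>t. cls (u t))"
  unfolding selfadjoint_graph.weak_solution_def[OF \<Gamma>_selfadjoint]
proof (intro allI impI ballI)
  fix \<phi> w t assume a: "(\<phi>, w) \<in> \<Gamma>"
  have L: "L2_function (u t)" for t using u by (auto simp: schroedinger_solution_def continuous_into_L2_def)
  obtain d where d: "((\<lambda>s. L2_inner (u s) (fn \<phi>)) has_vector_derivative d) (at t)" "\<i> * d + L2_inner (u t) (fn w) = 0"
    using u \<Gamma>_schroedinger_operator[OF a] unfolding schroedinger_solution_def by blast
  have "d = \<i> * L2_inner (u t) (fn w)"
  proof -
    have "\<i> * (\<i> * d + L2_inner (u t) (fn w)) = 0" using d(2) by simp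
    then show ?thesis by (simp add: distrib_left mult.assoc[symmetric])
  qed
  then have "Re d = - Im (L2_inner (u t) (fn w))" by simp
  also have "\<dots> = imul (cls (u t)) \<bullet> w" by (simp add: L2_inner_Im L imul_anti)
  finally have Re: "Re d = imul (cls (u t)) \<bullet> w" .
  have "((\<lambda>s. Re (L2_inner (u s) (fn \<phi>))) has_vector_derivative Re d) (at t)"
    by (rule bounded_linear.has_vector_derivative[OF bounded_linear_Re d(1)])
  then show "((\<lambda>s. cls (u s) \<bullet> \<phi>) has_real_derivative imul (cls (u t)) \<bullet> w) (at t)"
    by (simp add: has_real_derivative_iff_has_vector_derivative L2_inner_Re L Re)
qed

text \<open>
  Norm continuity provides the local bound that \<open>norm_conserved\<close> asks for.
\<close>
lemma solution_continuous:
  assumes u: "schroedinger_solution W f u"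
  shows "((\<lambda>s. cls (u s)) \<longlongrightarrow> cls (u t)) (at t)"
proof -
  have L: "L2_function (u t)" for t using u by (auto simp: schroedinger_solution_def continuous_into_L2_def)
  have "((\<lambda>s. L2_norm (\<lambda>x. u s x - u t x)) \<longlongrightarrow> 0) (at t)"
    using u by (auto simp: schroedinger_solution_def continuous_into_L2_def)
  moreover have "L2_norm (\<lambda>x. u s x - u t x) = norm (cls (u s) - cls (u t))" for s
    by (simp add: cls_diff[symmetric] L norm_cls_L2_norm L2_diff)
  ultimately have "((\<lambda>s. norm (cls (u s) - cls (u t))) \<longlongrightarrow> 0) (at t)" by simp
  then show ?thesis by (rule LIM_zero_cancel[OF tendsto_norm_zero_cancel])
qed

lemma solution_norm:
  assumes u: "schroedinger_solution W f u"
  shows "norm (cls (u s)) = norm (cls (u t))"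
proof (rule selfadjoint_graph.norm_conserved(2)[OF \<Gamma>_selfadjoint solution_weak_solution[OF u]])
  fix t :: real
  have "\<forall>\<^sub>F s in at t. dist (cls (u s)) (cls (u t)) < 1"
    using solution_continuous[OF u, of t] zero_less_one unfolding tendsto_iff by blast
  then obtain \<delta> where d: "\<delta> > 0" "\<And>s. s \<noteq> t \<Longrightarrow> dist s t < \<delta> \<Longrightarrow> dist (cls (u s)) (cls (u t)) < 1"
    unfolding eventually_at by auto
  have "norm (cls (u s)) \<le> norm (cls (u t)) + 1" if "dist s t < \<delta>" for s
  proof (cases "s = t")
    case False
    then have "norm (cls (u s) - cls (u t)) < 1" using d(2)[OF _ that] by (simp add: dist_norm)
    then show ?thesis using norm_triangle_sub[of "cls (u s)" "cls (u t)"] by linarith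
  qed simp
  then show "\<exists>\<delta>>0. \<exists>K. \<forall>s\<in>UNIV. dist s t < \<delta> \<longrightarrow> norm (cls (u s)) \<le> K"
    using d(1) by blast
qed auto

section \<open>The pseudo-conformal inversion\<close>

lemma gauss_curve_derivative:
  assumes e: "\<epsilon> > 0"
  shows "L2_function (\<lambda>x. - (\<i> / 4) * of_real (x \<bullet> x) * gauss (Complex \<epsilon> (t / 4)) x * fn \<psi> x)"
    "((\<lambda>t. mult_op (gauss (Complex \<epsilon> (t / 4))) \<psi>) has_vector_derivative
      cls (\<lambda>x. - (\<i> / 4) * of_real (x \<bullet> x) * gauss (Complex \<epsilon> (t / 4)) x * fn \<psi> x)) (at t)"
proof -
  let ?F = "\<lambda>t x. gauss (Complex \<epsilon> (t / 4)) x * fn \<psi> x"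
  let ?F' = "\<lambda>t x. - (\<i> / 4) * of_real (x \<bullet> x) * gauss (Complex \<epsilon> (t / 4)) x * fn \<psi> x"
  have Re: "Re (Complex \<epsilon> (s / 4)) > 0" for s using e by simp
  have der: "((\<lambda>s. ?F s x) has_vector_derivative ?F' s x) (at s)" for s x
  proof -
    have eq: "gauss (Complex \<epsilon> (s / 4)) x = exp (- of_real (\<epsilon> * (x \<bullet> x)) - \<i> / 4 * of_real (x \<bullet> x) * of_real s)" for s
      by (simp add: gauss_def Complex_eq algebra_simps)
    have "((\<lambda>w. exp (- of_real (\<epsilon> * (x \<bullet> x)) - \<i> / 4 * of_real (x \<bullet> x) * w) * fn \<psi> x) has_field_derivative
       (exp (- of_real (\<epsilon> * (x \<bullet> x)) - \<i> / 4 * of_real (x \<bullet> x) * of_real s) * - (\<i> / 4 * of_real (x \<bullet> x))) * fn \<psi> x) (at (complex_of_real s))"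
      by (auto intro!: derivative_eq_intros)
    from has_vector_derivative_real_field[OF this] show ?thesis
      by (simp add: eq mult_ac)
  qed
  have L: "L2_function (?F s)" for s by (intro L2_bmult bmult_gauss(1)[OF Re] L2_fn)
  have m: "?F' t \<in> borel_measurable lebesgue"
  proof -
    have "L2_function (\<lambda>x. (of_real (x \<bullet> x) * gauss (Complex \<epsilon> (t / 4)) x) * fn \<psi> x)"
      by (intro L2_bmult bmult_gauss(4)[OF Re] L2_fn)
    from L2_scale[OF this, of "- (\<i> / 4)"] show ?thesis by (simp add: L2_function_def mult_ac)
  qed
  let ?b = "\<lambda>x. 1 / (4 * \<epsilon>) * cmod (fn \<psi> x)"
  have bd: "cmod (?F' s x) \<le> ?b x" for s x
  proof -
    have "cmod (?F' s x) = 1 / 4 * ((x \<bullet> x) * cmod (gauss (Complex \<epsilon> (s / 4)) x)) * cmod (fn \<psi> x)"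
      by (simp only: norm_mult norm_minus_cancel norm_divide norm_of_real abs_of_nonneg[OF inner_ge_zero] norm_ii norm_numeral mult.assoc)
    also have "\<dots> \<le> 1 / 4 * (1 / \<epsilon>) * cmod (fn \<psi> x)"
      using gauss_bounds(2)[OF Re, of x s] by (intro mult_right_mono mult_left_mono) auto
    finally show ?thesis by simp
  qed
  have b: "integrable lebesgue (\<lambda>x. (?b x)\<^sup>2)"
    unfolding power_mult_distrib by (intro integrable_mult_right L2_sq_integrable L2_fn)
  show "L2_function (?F' t)"
    using l2_has_vector_derivative(1)[where F = ?F and F' = ?F' and t = t, OF zero_less_one L m der bd b] .
  show "((\<lambda>t. mult_op (gauss (Complex \<epsilon> (t / 4))) \<psi>) has_vector_derivative cls (?F' t)) (at t)"
    unfolding mult_op_def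
    using l2_has_vector_derivative(2)[where F = ?F and F' = ?F' and t = t, OF zero_less_one L m der bd b] .
qed

text \<open>
  The function \<open>y \<mapsto> t^(n/2) exp (i t |y|\<^sup>2 / 4) U(t, t y)\<close>. The constant \<open>1/4\<close> in the phase is the one for which the
  first-order terms cancel in \<open>pseudo_conformal_derivative\<close>.
\<close>
definition pseudo_conformal :: "(real \<Rightarrow> 'n l2) \<Rightarrow> real \<Rightarrow> 'n l2" where
  "pseudo_conformal U t = mult_op (gauss (Complex 0 (- t / 4))) (aff t 0 (U t))"

lemma bmult_phase: "bmult (gauss (Complex 0 s))"
  by (rule bmultI[OF gauss_measurable, of _ 1]) (simp add: cmod_gauss)

lemma norm_pseudo_conformal: "t > 0 \<Longrightarrow> norm (pseudo_conformal U t) = norm (U t)"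
  unfolding pseudo_conformal_def by (subst norm_mult_unimodular[OF bmult_phase]) (auto simp: cmod_gauss norm_aff)

text \<open>
  All operators of the inversion are moved to the test vector, where phase and Gaussian combine to a single
  Gaussian with parameter \<open>\<epsilon> + i t / 4\<close>.
\<close>
lemma pseudo_conformal_inner_gauss:
  assumes t: "t > 0" and e: "\<epsilon> > 0"
  shows "pseudo_conformal U t \<bullet> mult_op (gauss (of_real \<epsilon>)) \<psi> = U t \<bullet> aff (exp (- ln t)) 0 (mult_op (gauss (Complex \<epsilon> (t / 4))) \<psi>)"
proof -
  have c: "cnj (gauss (Complex 0 (- t / 4)) x) = gauss (Complex 0 (t / 4)) x" for x :: "real^'n"
    by (simp add: gauss_def exp_cnj Complex_eq)
  have p: "gauss (Complex 0 (t / 4)) x * gauss (of_real \<epsilon>) x = gauss (Complex \<epsilon> (t / 4)) x" for x :: "real^'n"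
    by (simp add: gauss_def exp_add[symmetric] Complex_eq algebra_simps)
  have ex: "exp (- ln t) = 1 / t" using t by (simp add: exp_minus inverse_eq_divide)
  have be: "bmult (gauss (of_real \<epsilon>))" using e by (intro bmult_gauss) simp
  show ?thesis
    unfolding pseudo_conformal_def mult_adjoint[OF bmult_phase] c mult_mult[OF bmult_phase be] p aff_inverse[OF t] ex ..
qed

text \<open>
  The moving test vector depends on \<open>t\<close> through the Gaussian parameter \<open>z = \<epsilon> + i t / 4\<close> and through the dilation
  by \<open>1 / t\<close>. Three contributions arise: the equation, which brings \<open>t^(-2) H\<close>; the phase, which brings
  \<open>- (i/4) |x|\<^sup>2\<close>; and the dilation, which brings \<open>- (1/t) (x \<bullet> \<nabla> + n/2)\<close>. Up to the common phase they add up to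
  \<open>- i t^(-2) H (exp (- \<epsilon> |x|\<^sup>2) \<psi>)\<close>.
\<close>
lemma pseudo_conformal_derivative:
  assumes U: "(U \<longlongrightarrow> U t) (at t)" and t: "t > 0" and e: "\<epsilon> > 0"
    and ws: "selfadjoint_graph.weak_solution \<Gamma> imul UNIV U"
    and h: "(\<psi>, G) \<in> H1" and eq: "\<And>\<xi> K. (\<xi>, K) \<in> H1 \<Longrightarrow> G \<bullet> K + vroot \<psi> \<bullet> vroot \<xi> = w \<bullet> \<xi>"
  shows "((\<lambda>s. pseudo_conformal U s \<bullet> mult_op (gauss (of_real \<epsilon>)) \<psi>) has_real_derivative
     (1 / t\<^sup>2) * (imul (pseudo_conformal U t) \<bullet> cls (gauss_image (of_real \<epsilon>) \<psi> G w))) (at t)"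
proof -
  define z where "z = Complex \<epsilon> (t / 4)"
  have z: "Re z > 0" using e by (simp add: z_def)
  note bz = bmult_gauss[OF z]
  define X where "X x = (\<Sum>i\<in>UNIV. of_real (x $ i) * fn (G $ i) x)" for x
  define P where "P s = mult_op (gauss (Complex \<epsilon> (s / 4))) \<psi>" for s
  define p where "p x = - (\<i> / 4) * of_real (x \<bullet> x) * gauss z x * fn \<psi> x" for x
  have Pt: "P t = mult_op (gauss z) \<psi>" by (simp add: P_def z_def)
  have P: "(P has_vector_derivative cls p) (at t)" "L2_function p"
    unfolding P_def[abs_def] p_def[abs_def] z_def using gauss_curve_derivative[OF e] by auto
  \<comment> \<open>\<open>K\<close> is the gradient of \<open>gauss z \<psi>\<close>; \<open>k i\<close> represents \<open>x\<^sub>i K\<^sub>i\<close>, square integrable because of the Gaussian\<close>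
  define K where "K i = mult_op (gauss z) (G $ i) + mult_op (cpd i (gauss z)) \<psi>" for i
  have K: "(P t, \<chi> i. K i) \<in> H1" unfolding Pt K_def by (rule H1_mult[OF gauss_csmooth bz(1) bmult_cpd_gauss(1)[OF z] h])
  define k where "k i x = (of_real (x $ i) * gauss z x) * fn (G $ i) x - 2 * z * ((of_real (x $ i * x $ i) * gauss z x) * fn \<psi> x)" for i x
  have kL: "L2_function (k i)" for i
    unfolding k_def[abs_def] by (intro L2_diff L2_scale L2_bmult bz L2_fn)
  have kK: "AE x in lebesgue. k i x = of_real (x $ i) * fn ((\<chi> i. K i) $ i) x" for i
    using fn_add[of "mult_op (gauss z) (G $ i)" "mult_op (cpd i (gauss z)) \<psi>"] fn_mult[OF bz(1), of "G $ i"]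
      fn_mult[OF bmult_cpd_gauss(1)[OF z], of i \<psi>]
  proof eventually_elim
    case (elim x)
    have "fn ((\<chi> i. K i) $ i) x = gauss z x * fn (G $ i) x + cpd i (gauss z) x * fn \<psi> x"
      using elim by (simp add: K_def)
    then show ?case by (simp only: k_def cpd_gauss) (simp add: algebra_simps)
  qed
  have xKm: "(\<lambda>x. of_real (x $ i) * fn ((\<chi> i. K i) $ i) x) \<in> borel_measurable lebesgue" for i
    by (rule borel_measurable_AE[OF _ kK]) (use kL[of i] in \<open>simp add: L2_function_def\<close>)
  have xKL: "L2_function (\<lambda>x. of_real (x $ i) * fn ((\<chi> i. K i) $ i) x)" for i
    by (rule L2_cong_AE[OF kL xKm kK])
  have xK: "cls (\<lambda>x. of_real (x $ i) * fn ((\<chi> i. K i) $ i) x) = cls (k i)" for i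
    by (rule cls_cong[OF xKL kL]) (use kK[of i] in eventually_elim, simp)
  define A where "A x = gauss z x * (X x - 2 * z * of_real (x \<bullet> x) * fn \<psi> x + of_real (real CARD('n) / 2) * fn \<psi> x)" for x
  have s: "(\<Sum>i\<in>UNIV. of_real (x $ i * x $ i)) = complex_of_real (x \<bullet> x)" for x :: "real^'n" by (simp add: inner_vec_def)
  have gL: "L2_function (\<lambda>x. gauss z x * fn \<psi> x)" by (intro L2_bmult bz L2_fn)
  have Aeq: "A x = (\<Sum>i\<in>UNIV. k i x) + (real CARD('n) / 2) *\<^sub>R (gauss z x * fn \<psi> x)" for x
  proof -
    have "(\<Sum>i\<in>UNIV. k i x) = (\<Sum>i\<in>UNIV. gauss z x * (of_real (x $ i) * fn (G $ i) x) - (2 * z * gauss z x * fn \<psi> x) * of_real (x $ i * x $ i))"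
      by (intro sum.cong refl) (simp add: k_def algebra_simps)
    also have "\<dots> = gauss z x * X x - (2 * z * gauss z x * fn \<psi> x) * of_real (x \<bullet> x)"
      unfolding sum_subtractf sum_distrib_left[symmetric] s X_def ..
    finally show ?thesis by (simp add: A_def scaleR_conv_of_real algebra_simps)
  qed
  have AL: "L2_function A" unfolding Aeq[abs_def] by (intro L2_add L2_sum kL L2_scaleR gL)
  have Acls: "(\<Sum>i\<in>UNIV. cls (\<lambda>x. of_real (x $ i) * fn ((\<chi> i. K i) $ i) x)) + (real CARD('n) / 2) *\<^sub>R P t = cls A"
    unfolding xK Aeq[abs_def] cls_add[OF L2_sum[OF kL] L2_scaleR[OF gL]] cls_sum[OF kL] cls_scaleR[OF gL] Pt mult_op_def ..
  have T: "((\<lambda>s. aff (exp s) 0 (P t)) has_vector_derivative aff (exp (- ln t)) 0 (cls A)) (at (- ln t))"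
    using H1_dilation_derivative[OF K xKL, of "- ln t"] unfolding Acls .
  have \<sigma>: "((\<lambda>t. - ln t) has_real_derivative - (1 / t)) (at t)"
    using t by (auto intro!: derivative_eq_intros)
  let ?T = "aff (1 / t) 0"
  have ex: "exp (- ln t) = 1 / t" using t by (simp add: exp_minus inverse_eq_divide)
  have t': "1 / t > 0" using t by simp
  \<comment> \<open>\<open>- ln t\<close> is the group parameter of the dilation by \<open>1 / t\<close>\<close>
  have \<Phi>: "((\<lambda>s. aff (exp (- ln s)) 0 (P s)) has_vector_derivative (- (1 / t)) *\<^sub>R ?T (cls A) + ?T (cls p)) (at t)"
    using isometry_group.moving_vector_derivative[OF dilation_group P(1) T \<sigma>] unfolding ex .
  have Hc: "(P t, cls (gauss_image z \<psi> G w)) \<in> \<Gamma>" and hL: "L2_function (gauss_image z \<psi> G w)"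
    unfolding Pt using \<Gamma>_gauss[OF z h eq] by auto
  have "(aff (exp (- ln t)) 0 (P t), (1 / t)\<^sup>2 *\<^sub>R ?T (cls (gauss_image z \<psi> G w))) \<in> \<Gamma>"
    using \<Gamma>_dilation[OF t' Hc] unfolding ex .
  then have du: "((\<lambda>s. U s \<bullet> aff (exp (- ln t)) 0 (P t)) has_real_derivative imul (U t) \<bullet> ((1 / t)\<^sup>2 *\<^sub>R ?T (cls (gauss_image z \<psi> G w)))) (at t)"
    using ws unfolding selfadjoint_graph.weak_solution_def[OF \<Gamma>_selfadjoint] by blast
  have D: "((\<lambda>s. U s \<bullet> aff (exp (- ln s)) 0 (P s)) has_real_derivative
     imul (U t) \<bullet> ((1 / t)\<^sup>2 *\<^sub>R ?T (cls (gauss_image z \<psi> G w))) + U t \<bullet> ((- (1 / t)) *\<^sub>R ?T (cls A) + ?T (cls p))) (at t)"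
    by (rule inner_moving_derivative[OF U du \<Phi>])
  \<comment> \<open>with \<open>z = \<epsilon> + i t / 4\<close> every term cancels except those of \<open>gauss_image \<epsilon>\<close>\<close>
  define E where "E = (gauss (Complex 0 (t / 4)) :: real^'n \<Rightarrow> complex)"
  define he where "he = gauss_image (of_real \<epsilon>) \<psi> G w"
  have heL: "L2_function he" unfolding he_def using e by (intro \<Gamma>_gauss(1)[OF _ h eq]) auto
  have EheL: "L2_function (\<lambda>x. E x * he x)" unfolding E_def by (intro L2_bmult bmult_phase heL)
  have pointwise: "(1 / t)\<^sup>2 *\<^sub>R (\<i> * gauss_image z \<psi> G w x) - ((- (1 / t)) *\<^sub>R A x + p x) = (1 / t)\<^sup>2 *\<^sub>R (\<i> * (E x * he x))" for x
  proof -
    have g: "gauss z x = E x * gauss (of_real \<epsilon>) x"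
      by (simp add: gauss_def E_def z_def exp_add[symmetric] Complex_eq algebra_simps)
    have zz: "z = of_real \<epsilon> + \<i> * of_real t / 4" by (simp add: z_def Complex_eq)
    have t0: "complex_of_real t \<noteq> 0" using t by simp
    show ?thesis
      unfolding gauss_image_def he_def A_def p_def g X_def[symmetric] scaleR_conv_of_real
      unfolding zz using t0
      by (simp add: field_simps power2_eq_square)
  qed
  have iU: "imul (U t) \<bullet> a = - (U t \<bullet> imul a)" for a by (rule imul_anti)
  have "imul (U t) \<bullet> ((1 / t)\<^sup>2 *\<^sub>R ?T (cls (gauss_image z \<psi> G w))) + U t \<bullet> ((- (1 / t)) *\<^sub>R ?T (cls A) + ?T (cls p))
    = - (U t \<bullet> ?T ((1 / t)\<^sup>2 *\<^sub>R imul (cls (gauss_image z \<psi> G w)) - ((- (1 / t)) *\<^sub>R cls A + cls p)))"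
    unfolding linear_diff[OF aff_linear[OF t']] linear_add[OF aff_linear[OF t']] linear_scale[OF aff_linear[OF t']]
      iU linear_scale[OF imul_linear] aff_imul[OF t', symmetric] inner_diff_right by simp
  also have "(1 / t)\<^sup>2 *\<^sub>R imul (cls (gauss_image z \<psi> G w)) - ((- (1 / t)) *\<^sub>R cls A + cls p) = (1 / t)\<^sup>2 *\<^sub>R imul (mult_op E (cls he))"
  proof -
    have "(1 / t)\<^sup>2 *\<^sub>R imul (cls (gauss_image z \<psi> G w)) - ((- (1 / t)) *\<^sub>R cls A + cls p)
      = cls (\<lambda>x. (1 / t)\<^sup>2 *\<^sub>R (\<i> * gauss_image z \<psi> G w x) - ((- (1 / t)) *\<^sub>R A x + p x))"
      by (simp only: imul_cls[OF hL] cls_scaleR[OF L2_scale[OF hL]] cls_scaleR[OF AL] cls_add[OF L2_scaleR[OF AL] P(2)]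
          cls_diff[OF L2_scaleR[OF L2_scale[OF hL]] L2_add[OF L2_scaleR[OF AL] P(2)]])
    also have "\<dots> = (1 / t)\<^sup>2 *\<^sub>R imul (mult_op E (cls he))"
      unfolding pointwise mult_cls[OF bmult_phase heL, folded E_def] imul_cls[OF EheL] cls_scaleR[OF L2_scale[OF EheL]]
      by (simp add: E_def mult_cls[OF bmult_phase heL] imul_cls[OF EheL[unfolded E_def]] cls_scaleR[OF L2_scale[OF EheL[unfolded E_def]]])
    finally show ?thesis .
  qed
  also have "- (U t \<bullet> ?T ((1 / t)\<^sup>2 *\<^sub>R imul (mult_op E (cls he)))) = (1 / t\<^sup>2) * (imul (pseudo_conformal U t) \<bullet> cls he)"
  proof -
    have c: "cnj (gauss (Complex 0 (- t / 4)) x) = E x" for x :: "real^'n"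
      by (simp add: gauss_def exp_cnj Complex_eq E_def)
    have "imul (pseudo_conformal U t) \<bullet> cls he = - (aff t 0 (U t) \<bullet> mult_op E (imul (cls he)))"
      unfolding pseudo_conformal_def imul_anti mult_adjoint[OF bmult_phase] c by simp
    also have "\<dots> = - (U t \<bullet> ?T (imul (mult_op E (cls he))))"
      unfolding aff_inverse[OF t] by (simp add: imul_mult E_def bmult_phase)
    finally show ?thesis
      by (simp add: linear_scale[OF aff_linear[OF t', of 0]] power_divide)
  qed
  finally have val: "imul (U t) \<bullet> ((1 / t)\<^sup>2 *\<^sub>R ?T (cls (gauss_image z \<psi> G w))) + U t \<bullet> ((- (1 / t)) *\<^sub>R ?T (cls A) + ?T (cls p))
    = (1 / t\<^sup>2) * (imul (pseudo_conformal U t) \<bullet> cls he)" .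
  have "((\<lambda>s. pseudo_conformal U s \<bullet> mult_op (gauss (of_real \<epsilon>)) \<psi>) has_real_derivative (1 / t\<^sup>2) * (imul (pseudo_conformal U t) \<bullet> cls he)) (at t)"
    by (rule has_field_derivative_transform_within_open[OF D[unfolded val], of "{0<..}"])
      (use t in \<open>auto simp: pseudo_conformal_inner_gauss[OF _ e] P_def\<close>)
  then show ?thesis by (simp add: he_def)
qed

text \<open>
  Vectors \<open>exp (- \<epsilon> |x|\<^sup>2) \<psi>\<close> form a core of \<open>H\<close>. The terms with \<open>\<epsilon> x\<close> and \<open>\<epsilon>\<^sup>2 |x|\<^sup>2\<close> tend to \<open>0\<close> pointwise and stay
  bounded on account of the Gaussian factor.
\<close>
lemma gauss_regularization:
  fixes \<psi> w :: "'n l2" and G :: "'n l2 ^ 'n"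
  defines "e \<equiv> \<lambda>k::nat. inverse (real (Suc k))"
  assumes hL: "\<And>k. L2_function (gauss_image (of_real (e k)) \<psi> G w)"
  shows "(\<lambda>k. mult_op (gauss (of_real (e k))) \<psi>) \<longlonglongrightarrow> \<psi>"
    and "(\<lambda>k. cls (gauss_image (of_real (e k)) \<psi> G w)) \<longlonglongrightarrow> w"
proof -
  have e0: "e k > 0" "e k \<le> 1" for k by (auto simp: e_def inverse_le_1_iff)
  have Re: "Re (complex_of_real (e k)) > 0" for k using e0(1)[of k] by simp
  have e_lim: "e \<longlonglongrightarrow> 0" unfolding e_def by (rule LIMSEQ_inverse_real_of_nat)
  have ce_lim: "(\<lambda>k. complex_of_real (e k)) \<longlonglongrightarrow> 0" using tendsto_of_real[OF e_lim, where 'a = complex] by simp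
  have g_lim: "(\<lambda>k. gauss (of_real (e k)) x) \<longlonglongrightarrow> 1" for x :: "real^'n"
  proof -
    have "(\<lambda>k. exp (- (complex_of_real (e k) * of_real (x \<bullet> x)))) \<longlonglongrightarrow> exp (- (0 * of_real (x \<bullet> x)))"
      by (intro tendsto_exp tendsto_minus tendsto_mult ce_lim tendsto_const)
    then show ?thesis by (simp add: gauss_def)
  qed
  have g1: "cmod (gauss (of_real (e k)) x) \<le> 1" for k and x :: "real^'n" by (rule gauss_bounds(1)[OF Re])
  show "(\<lambda>k. mult_op (gauss (of_real (e k))) \<psi>) \<longlonglongrightarrow> \<psi>"
  proof -
    have "(\<lambda>k. cls (\<lambda>x. gauss (of_real (e k)) x * fn \<psi> x)) \<longlonglongrightarrow> cls (fn \<psi>)"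
    proof (rule l2_tendsto_dominated(2)[where b = "\<lambda>x. cmod (fn \<psi> x)"])
      show "L2_function (\<lambda>x. gauss (of_real (e k)) x * fn \<psi> x)" for k
        by (intro L2_bmult bmult_gauss(1)[OF Re] L2_fn)
      show "fn \<psi> \<in> borel_measurable lebesgue" using L2_fn[of \<psi>] by (simp add: L2_function_def)
      show "integrable lebesgue (\<lambda>x. (cmod (fn \<psi> x))\<^sup>2)" by (rule L2_sq_integrable[OF L2_fn])
      show "AE x in lebesgue. cmod (gauss (of_real (e k)) x * fn \<psi> x) \<le> cmod (fn \<psi> x)" for k
        using g1 by (intro AE_I2) (simp add: norm_mult mult_left_le_one_le)
      show "AE x in lebesgue. (\<lambda>k. gauss (of_real (e k)) x * fn \<psi> x) \<longlonglongrightarrow> fn \<psi> x"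
        using tendsto_mult[OF g_lim tendsto_const] by (intro AE_I2) fastforce
    qed
    then show ?thesis by (simp add: mult_op_def)
  qed
  show "(\<lambda>k. cls (gauss_image (of_real (e k)) \<psi> G w)) \<longlonglongrightarrow> w"
  proof -
    define N where "N = real CARD('n)"
    define B where "B x = cmod (fn w x) + 8 * (\<Sum>i\<in>UNIV. cmod (fn (G $ i) x)) + (2 * N + 4) * cmod (fn \<psi> x)" for x
    have BL: "L2_function (\<lambda>x. of_real (B x))"
    proof -
      have "L2_function (\<lambda>x. of_real (cmod (fn w x)) + of_real 8 * (\<Sum>i\<in>UNIV. of_real (cmod (fn (G $ i) x))) + of_real (2 * N + 4) * of_real (cmod (fn \<psi> x)))"
        by (intro L2_add L2_scale L2_sum L2_cmod L2_fn)
      then show ?thesis by (simp add: B_def)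
    qed
    have B2: "integrable lebesgue (\<lambda>x. (B x)\<^sup>2)" using L2_sq_integrable[OF BL] by simp
    have "(\<lambda>k. cls (gauss_image (of_real (e k)) \<psi> G w)) \<longlonglongrightarrow> cls (fn w)"
    proof (rule l2_tendsto_dominated(2)[OF hL _ B2])
      show "fn w \<in> borel_measurable lebesgue" using L2_fn[of w] by (simp add: L2_function_def)
      show "AE x in lebesgue. cmod (gauss_image (of_real (e k)) \<psi> G w x) \<le> B x" for k
      proof (intro AE_I2)
        fix x :: "real^'n"
        let ?g = "cmod (gauss (of_real (e k)) x)"
        have gi: "e k * (\<bar>x $ i\<bar> * ?g) \<le> 2" for i
        proof -
          have "e k * (\<bar>x $ i\<bar> * ?g) \<le> e k * (1 + 1 / e k)"
            using gauss_bounds(3)[OF Re, where x = x and i = i] e0(1)[of k] by (intro mult_left_mono) auto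
          also have "\<dots> = e k + 1" using e0(1)[of k] by (simp add: distrib_left)
          finally show ?thesis using e0(2)[of k] by linarith
        qed
        have gq: "e k * ((x \<bullet> x) * ?g) \<le> 1"
        proof -
          have "e k * ((x \<bullet> x) * ?g) \<le> e k * (1 / e k)"
            using gauss_bounds(2)[OF Re, where x = x] e0(1)[of k] by (intro mult_left_mono) auto
          then show ?thesis using e0(1)[of k] by simp
        qed
        have eq: "gauss_image (of_real (e k)) \<psi> G w x = gauss (of_real (e k)) x * fn w x
          + 4 * (\<Sum>i\<in>UNIV. (of_real (e k * x $ i) * gauss (of_real (e k)) x) * fn (G $ i) x)
          + (of_real (2 * N * e k) * gauss (of_real (e k)) x - of_real (4 * (e k)\<^sup>2 * (x \<bullet> x)) * gauss (of_real (e k)) x) * fn \<psi> x"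
          unfolding gauss_image_def N_def by (simp add: algebra_simps sum_distrib_left)
        have t1: "cmod (gauss (of_real (e k)) x * fn w x) \<le> cmod (fn w x)"
          using g1 by (simp add: norm_mult mult_left_le_one_le)
        have t2: "cmod (4 * (\<Sum>i\<in>UNIV. (of_real (e k * x $ i) * gauss (of_real (e k)) x) * fn (G $ i) x)) \<le> 8 * (\<Sum>i\<in>UNIV. cmod (fn (G $ i) x))"
        proof -
          have "cmod (\<Sum>i\<in>UNIV. (of_real (e k * x $ i) * gauss (of_real (e k)) x) * fn (G $ i) x) \<le> (\<Sum>i\<in>UNIV. 2 * cmod (fn (G $ i) x))"
          proof (rule sum_norm_le)
            fix i
            have "cmod ((of_real (e k * x $ i) * gauss (of_real (e k)) x) * fn (G $ i) x) = e k * (\<bar>x $ i\<bar> * ?g) * cmod (fn (G $ i) x)"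
              using e0(1)[of k] by (simp only: norm_mult norm_of_real abs_mult abs_of_pos mult.assoc)
            also have "\<dots> \<le> 2 * cmod (fn (G $ i) x)" by (intro mult_right_mono gi) simp
            finally show "cmod ((of_real (e k * x $ i) * gauss (of_real (e k)) x) * fn (G $ i) x) \<le> 2 * cmod (fn (G $ i) x)" .
          qed
          then show ?thesis by (simp add: norm_mult sum_distrib_left[symmetric])
        qed
        have t3: "cmod ((of_real (2 * N * e k) * gauss (of_real (e k)) x - of_real (4 * (e k)\<^sup>2 * (x \<bullet> x)) * gauss (of_real (e k)) x) * fn \<psi> x)
          \<le> (2 * N + 4) * cmod (fn \<psi> x)"
          unfolding norm_mult[of _ "fn \<psi> x"]
        proof (intro mult_right_mono)
          have a: "cmod (of_real (2 * N * e k) * gauss (of_real (e k)) x) \<le> 2 * N"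
          proof -
            have "cmod (of_real (2 * N * e k) * gauss (of_real (e k)) x) = 2 * N * (e k * ?g)"
              using e0(1)[of k] by (simp add: norm_mult N_def)
            also have "\<dots> \<le> 2 * N * (1 * 1)" using e0[of k] g1[of k x] by (intro mult_left_mono mult_mono) (auto simp: N_def)
            finally show ?thesis by simp
          qed
          have b: "cmod (of_real (4 * (e k)\<^sup>2 * (x \<bullet> x)) * gauss (of_real (e k)) x) \<le> 4"
          proof -
            have "cmod (of_real (4 * (e k)\<^sup>2 * (x \<bullet> x)) * gauss (of_real (e k)) x) = 4 * (e k * (e k * ((x \<bullet> x) * ?g)))"
              by (simp only: norm_mult norm_of_real power2_eq_square abs_mult abs_of_nonneg[OF inner_ge_zero] abs_of_pos[OF e0(1)] abs_numeral mult.assoc)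
            also have "\<dots> \<le> 4 * (1 * 1)"
              using e0[of k] gq by (intro mult_left_mono mult_mono mult_nonneg_nonneg) auto
            finally show ?thesis by simp
          qed
          show "cmod (of_real (2 * N * e k) * gauss (of_real (e k)) x - of_real (4 * (e k)\<^sup>2 * (x \<bullet> x)) * gauss (of_real (e k)) x) \<le> 2 * N + 4"
            by (rule order_trans[OF norm_triangle_ineq4 add_mono[OF a b]])
        qed simp
        show "cmod (gauss_image (of_real (e k)) \<psi> G w x) \<le> B x"
          unfolding eq B_def by (intro order_trans[OF norm_triangle_ineq] add_mono t1 t2 t3)
      qed
      show "AE x in lebesgue. (\<lambda>k. gauss_image (of_real (e k)) \<psi> G w x) \<longlonglongrightarrow> fn w x"
      proof (intro AE_I2)
        fix x :: "real^'n"
        have "(\<lambda>k. gauss_image (of_real (e k)) \<psi> G w x) \<longlonglongrightarrow> 1 * (fn w x + 4 * 0 * (\<Sum>i\<in>UNIV. of_real (x $ i) * fn (G $ i) x)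
           + (2 * of_nat CARD('n) * 0 - 4 * 0\<^sup>2 * of_real (x \<bullet> x)) * fn \<psi> x)"
          unfolding gauss_image_def by (intro tendsto_intros g_lim ce_lim)
        then show "(\<lambda>k. gauss_image (of_real (e k)) \<psi> G w x) \<longlonglongrightarrow> fn w x" by simp
      qed
    qed
    then show ?thesis by simp
  qed
qed

text \<open>
  The inversion \<open>\<tau> = 1 / t\<close> reverses time, which replaces \<open>imul\<close> by its negative.
\<close>
lemma negative_selfadjoint: "selfadjoint_graph \<Gamma> (\<lambda>a. - imul a)"
proof -
  interpret s: selfadjoint_graph \<Gamma> imul by (rule \<Gamma>_selfadjoint)
  show ?thesis
  proof (rule selfadjoint_graph.intro)
    show "linear (\<lambda>a. - imul a :: 'n l2)" by (rule linear_compose_neg[OF imul_linear])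
    show "norm (- imul x) = norm x" for x :: "'n l2" by (simp add: imul_norm)
    show "(- imul x) \<bullet> y = - (x \<bullet> - imul y)" for x y :: "'n l2" by (simp add: imul_anti)
    show "subspace \<Gamma>" by (rule s.sub)
    show "(- imul \<phi>, - imul w) \<in> \<Gamma>" if "(\<phi>, w) \<in> \<Gamma>" for \<phi> w
      using subspace_neg[OF s.sub s.J_graph[OF that]] by simp
    show "w \<bullet> \<phi>' = \<phi> \<bullet> w'" if "(\<phi>, w) \<in> \<Gamma>" "(\<phi>', w') \<in> \<Gamma>" for \<phi> w \<phi>' w' by (rule s.sym[OF that])
    show "0 \<le> w \<bullet> \<phi>" if "(\<phi>, w) \<in> \<Gamma>" for \<phi> w by (rule s.nonneg[OF that])
    show "w = 0" if "(0, w) \<in> \<Gamma>" for w by (rule s.single[OF that])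
    show "\<exists>\<phi> w. (\<phi>, w) \<in> \<Gamma> \<and> \<phi> + \<epsilon> *\<^sub>R w = g" if "\<epsilon> > 0" for \<epsilon> g by (rule s.onto[OF that])
  qed
qed

text \<open>
  For regularized test vectors the factor \<open>t^(-2)\<close> of \<open>pseudo_conformal_derivative\<close> is absorbed by
  \<open>d\<tau> = - t^(-2) dt\<close>. Their derivatives converge uniformly in \<open>\<tau>\<close>, because the norm of the solution
  is constant, so the equation passes to the limit.
\<close>
lemma pseudo_conformal_weak_solution:
  assumes U: "\<And>t. (U \<longlongrightarrow> U t) (at t)" and nU: "\<And>t. norm (U t) = M"
    and ws: "selfadjoint_graph.weak_solution \<Gamma> imul UNIV U"
  shows "selfadjoint_graph.weak_solution \<Gamma> (\<lambda>a. - imul a) {0<..} (\<lambda>\<tau>. pseudo_conformal U (1 / \<tau>))"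
  unfolding selfadjoint_graph.weak_solution_def[OF negative_selfadjoint]
proof (intro allI impI ballI)
  fix \<psi> w and \<tau> :: real assume a: "(\<psi>, w) \<in> \<Gamma>" and \<tau>: "\<tau> \<in> {0<..}"
  let ?v = "\<lambda>\<tau>. pseudo_conformal U (1 / \<tau>)"
  obtain G where G: "(\<psi>, G) \<in> H1" "\<And>\<xi> K. (\<xi>, K) \<in> H1 \<Longrightarrow> G \<bullet> K + vroot \<psi> \<bullet> vroot \<xi> = w \<bullet> \<xi>"
    using a by (auto elim!: graphE)
  define e where "e k = inverse (real (Suc k))" for k
  have e0: "e k > 0" for k by (simp add: e_def)
  define p where "p k = mult_op (gauss (of_real (e k))) \<psi>" for k
  define h where "h k = cls (gauss_image (of_real (e k)) \<psi> G w)" for k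
  have hL: "L2_function (gauss_image (of_real (e k)) \<psi> G w)" for k
    by (rule \<Gamma>_gauss(1)[OF _ G]) (simp add: e0)
  have p_lim: "p \<longlonglongrightarrow> \<psi>" and h_lim: "h \<longlonglongrightarrow> w"
    unfolding p_def[abs_def] h_def[abs_def] e_def
    using gauss_regularization[OF hL[unfolded e_def]] by auto
  have nv: "norm (?v s) = M" if "s > 0" for s using that norm_pseudo_conformal[of "1 / s" U] nU by simp
  have M0: "M \<ge> 0" using nU[of 0] norm_ge_zero[of "U 0"] by simp
  have der: "((\<lambda>s. ?v s \<bullet> p k) has_derivative (\<lambda>y. ((- imul (?v s)) \<bullet> h k) * y)) (at s within {0<..})"
    if s: "s \<in> {0<..}" for k s
  proof -
    have s0: "s > 0" "1 / s > 0" using s by auto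
    have 1: "((\<lambda>r. pseudo_conformal U r \<bullet> p k) has_real_derivative (1 / (1 / s)\<^sup>2) * (imul (?v s) \<bullet> h k)) (at (1 / s))"
      unfolding p_def h_def by (rule pseudo_conformal_derivative[OF U s0(2) e0 ws G])
    have 2: "((\<lambda>s. 1 / s) has_real_derivative - (1 / s\<^sup>2)) (at s)"
      using s0 by (auto intro!: derivative_eq_intros simp: power2_eq_square)
    have "((\<lambda>s. ?v s \<bullet> p k) has_real_derivative (1 / (1 / s)\<^sup>2) * (imul (?v s) \<bullet> h k) * - (1 / s\<^sup>2)) (at s)"
      by (rule DERIV_chain2[OF 1 2])
    moreover have "(1 / (1 / s)\<^sup>2) * (imul (?v s) \<bullet> h k) * - (1 / s\<^sup>2) = (- imul (?v s)) \<bullet> h k"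
      using s0 by (simp add: power_divide)
    ultimately have "((\<lambda>s. ?v s \<bullet> p k) has_real_derivative (- imul (?v s)) \<bullet> h k) (at s)" by simp
    from this[unfolded has_field_derivative_def] show ?thesis by (rule has_derivative_at_withinI)
  qed
  have "\<exists>g. \<forall>s\<in>{0<..}. (\<lambda>k. ?v s \<bullet> p k) \<longlonglongrightarrow> g s \<and>
      (g has_derivative (\<lambda>y. ((- imul (?v s)) \<bullet> w) * y)) (at s within {0<..})"
  proof (rule has_derivative_sequence[where f = "\<lambda>k s. ?v s \<bullet> p k" and ?x0.0 = \<tau> and l = "?v \<tau> \<bullet> \<psi>"
        and f' = "\<lambda>k s y. ((- imul (?v s)) \<bullet> h k) * y" and g' = "\<lambda>s y. ((- imul (?v s)) \<bullet> w) * y" and S = "{0<..}"])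
    show "convex {0::real<..}" by simp
    show "((\<lambda>s. ?v s \<bullet> p k) has_derivative (\<lambda>y. ((- imul (?v s)) \<bullet> h k) * y)) (at s within {0<..})"
      if "s \<in> {0<..}" for k s by (rule der[OF that])
    show "\<tau> \<in> {0<..}" by (rule \<tau>)
    show "\<forall>\<^sub>F k in sequentially. \<forall>s\<in>{0<..}. \<forall>y. norm ((- imul (?v s)) \<bullet> h k * y - (- imul (?v s)) \<bullet> w * y) \<le> \<epsilon> * norm y"
      if \<epsilon>: "\<epsilon> > 0" for \<epsilon>
    proof -
      have "\<forall>\<^sub>F k in sequentially. dist (h k) w < \<epsilon> / (M + 1)"
        by (rule tendstoD[OF h_lim]) (use \<epsilon> M0 in simp)
      then show ?thesis
      proof eventually_elim
        case (elim k)
        show ?case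
        proof (intro ballI allI)
          fix s :: real and y :: real assume s: "s \<in> {0<..}"
          have "\<bar>(- imul (?v s)) \<bullet> (h k - w)\<bar> \<le> norm (- imul (?v s)) * norm (h k - w)" by (rule Cauchy_Schwarz_ineq2)
          also have "\<dots> = M * norm (h k - w)" using nv s by (simp add: imul_norm)
          also have "\<dots> \<le> (M + 1) * (\<epsilon> / (M + 1))" using elim M0 by (intro mult_mono) (auto simp: dist_norm)
          also have "\<dots> = \<epsilon>" using M0 by simp
          finally have "\<bar>(- imul (?v s)) \<bullet> (h k - w)\<bar> * \<bar>y\<bar> \<le> \<epsilon> * \<bar>y\<bar>" by (rule mult_right_mono) simp
          then show "norm ((- imul (?v s)) \<bullet> h k * y - (- imul (?v s)) \<bullet> w * y) \<le> \<epsilon> * norm y"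
            unfolding left_diff_distrib[symmetric] inner_diff_right[symmetric] real_norm_def abs_mult .
        qed
      qed
    qed
    show "(\<lambda>k. ?v \<tau> \<bullet> p k) \<longlonglongrightarrow> ?v \<tau> \<bullet> \<psi>" by (intro tendsto_inner tendsto_const p_lim)
  qed
  then obtain g where g: "\<And>s. s \<in> {0<..} \<Longrightarrow> (\<lambda>k. ?v s \<bullet> p k) \<longlonglongrightarrow> g s"
    "\<And>s. s \<in> {0<..} \<Longrightarrow> (g has_derivative (\<lambda>y. ((- imul (?v s)) \<bullet> w) * y)) (at s within {0<..})" by blast
  have gv: "g s = ?v s \<bullet> \<psi>" if "s \<in> {0<..}" for s
    by (rule LIMSEQ_unique[OF g(1)[OF that] tendsto_inner[OF tendsto_const p_lim]])
  have "(g has_real_derivative (- imul (?v \<tau>)) \<bullet> w) (at \<tau>)"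
    using g(2)[OF \<tau>] unfolding at_within_open[OF \<tau> open_greaterThan] has_field_derivative_def .
  then show "((\<lambda>s. ?v s \<bullet> \<psi>) has_real_derivative (- imul (?v \<tau>)) \<bullet> w) (at \<tau>)"
    by (rule has_field_derivative_transform_within_open[of _ _ _ "{0<..}"]) (use \<tau> gv in auto)
qed

section \<open>Concentration at the origin and conclusion\<close>

lemma sqrt_weight_measurable:
  "(\<lambda>x::real^'n. complex_of_real (sqrt (norm x))) \<in> borel_measurable lebesgue"
  "(\<lambda>x::real^'n. complex_of_real (1 / sqrt (norm x))) \<in> borel_measurable lebesgue"
  by (intro measurable_completion; measurable)+

text \<open>
  Split the integrand as \<open>|x|^(1/2) U\<close> times \<open>|x|^(-1/2)\<close> of the test vector and use the Cauchy-Schwarz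
  inequality. Undoing the dilation in the second factor produces \<open>t^(-1) \<integral> |\<phi>|\<^sup>2 / |y|\<close>, which is finite because
  \<open>1 / |y| \<le> 1 + 1 / |y|\<^sup>2\<close> and Hardy's inequality applies.
\<close>
lemma concentration:
  assumes h: "(\<phi>, G) \<in> H1"
  shows "\<exists>C\<ge>0. \<forall>U t. t > 0 \<longrightarrow> integrable lebesgue (\<lambda>x. norm x * (cmod (fn (U t) x))\<^sup>2) \<longrightarrow>
    \<bar>pseudo_conformal U t \<bullet> \<phi>\<bar> \<le> C * sqrt ((LINT x|lebesgue. norm x * (cmod (fn (U t) x))\<^sup>2) / t)"
proof -
  have nz: "AE x in lebesgue. x \<noteq> (0::real^'n)"
    by (rule AE_completion) (rule AE_lborel_singleton)
  have fm: "fn a \<in> borel_measurable lebesgue" for a :: "'n l2" using L2_fn[of a] by (simp add: L2_function_def)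
  define f where "f x = (cmod (fn \<phi> x))\<^sup>2 / norm x" for x
  have nm: "(\<lambda>x::real^'n. norm x) \<in> borel_measurable lebesgue"
    by (intro measurable_completion) measurable
  have f_meas: "f \<in> borel_measurable lebesgue"
    unfolding f_def[abs_def]
    by (rule borel_measurable_divide[OF borel_measurable_integrable[OF L2_sq_integrable[OF L2_fn]] nm])
  have f_int: "integrable lebesgue f"
  proof (rule integrableI_bounded[OF f_meas])
    have "(\<integral>\<^sup>+ x. ennreal (norm (f x)) \<partial>lebesgue) \<le>
       (\<integral>\<^sup>+ x. ennreal ((cmod (fn \<phi> x))\<^sup>2) + ennreal ((cmod (fn \<phi> x))\<^sup>2 / (norm x)\<^sup>2) \<partial>lebesgue)"
    proof (rule nn_integral_mono)
      fix x
      let ?c = "(cmod (fn \<phi> x))\<^sup>2"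
      have "f x \<le> ?c + ?c / (norm x)\<^sup>2"
      proof (cases "norm x = 0")
        case False
        define r where "r = 1 / norm x"
        have r0: "0 \<le> r" by (simp add: r_def)
        have "2 * r \<le> r\<^sup>2 + 1" using sum_squares_bound[of r 1] by simp
        with r0 have "r \<le> 1 + r\<^sup>2" by linarith
        then have "?c * r \<le> ?c * (1 + r\<^sup>2)" by (rule mult_left_mono) simp
        then show ?thesis by (simp add: f_def r_def distrib_left power_divide)
      qed (simp add: f_def)
      moreover have "0 \<le> f x" by (simp add: f_def)
      ultimately show "ennreal (norm (f x)) \<le> ennreal ?c + ennreal (?c / (norm x)\<^sup>2)"
        by (simp add: ennreal_plus[symmetric] ennreal_leI del: ennreal_plus)
    qed
    also have "\<dots> = (\<integral>\<^sup>+ x. ennreal ((cmod (fn \<phi> x))\<^sup>2) \<partial>lebesgue) + (\<integral>\<^sup>+ x. ennreal ((cmod (fn \<phi> x))\<^sup>2 / (norm x)\<^sup>2) \<partial>lebesgue)"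
    proof (rule nn_integral_add)
      have 1: "(\<lambda>x. (cmod (fn \<phi> x))\<^sup>2) \<in> borel_measurable lebesgue" by (rule borel_measurable_integrable[OF L2_sq_integrable[OF L2_fn]])
      then show "(\<lambda>x. ennreal ((cmod (fn \<phi> x))\<^sup>2)) \<in> borel_measurable lebesgue" by simp
      have "(\<lambda>x. (cmod (fn \<phi> x))\<^sup>2 / (norm x)\<^sup>2) \<in> borel_measurable lebesgue"
        by (rule borel_measurable_divide[OF 1 borel_measurable_power[OF nm]])
      then show "(\<lambda>x. ennreal ((cmod (fn \<phi> x))\<^sup>2 / (norm x)\<^sup>2)) \<in> borel_measurable lebesgue" by simp
    qed
    also have "\<dots> < \<infinity>"
    proof -
      have "(\<integral>\<^sup>+ x. ennreal ((cmod (fn \<phi> x))\<^sup>2 / (norm x)\<^sup>2) \<partial>lebesgue) < \<infinity>"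
        by (rule le_less_trans[OF hardy[OF n3 h]]) simp
      then show ?thesis by (simp add: nn_norm_cls[OF L2_fn[of \<phi>]])
    qed
    finally show "(\<integral>\<^sup>+ x. ennreal (norm (f x)) \<partial>lebesgue) < \<infinity>" .
  qed
  define C where "C = sqrt (LINT x|lebesgue. f x)"
  have If0: "0 \<le> (LINT x|lebesgue. f x)" by (rule Bochner_Integration.integral_nonneg) (simp add: f_def)
  have "\<bar>pseudo_conformal U t \<bullet> \<phi>\<bar> \<le> C * sqrt ((LINT x|lebesgue. norm x * (cmod (fn (U t) x))\<^sup>2) / t)"
    if t: "t > 0" and i: "integrable lebesgue (\<lambda>x. norm x * (cmod (fn (U t) x))\<^sup>2)" for U t
  proof -
    let ?N = "LINT x|lebesgue. norm x * (cmod (fn (U t) x))\<^sup>2"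
    have t': "1 / t > 0" using t by simp
    define q where "q = aff (1 / t) 0 (mult_op (\<lambda>x. cnj (gauss (Complex 0 (- t / 4)) x)) \<phi>)"
    have pq: "pseudo_conformal U t \<bullet> \<phi> = U t \<bullet> q"
      unfolding pseudo_conformal_def mult_adjoint[OF bmult_phase] aff_inverse[OF t] q_def ..
    have qa: "AE x in lebesgue. (cmod (fn q x))\<^sup>2 = (1 / t) ^ CARD('n) * (cmod (fn \<phi> (0 + (1 / t) *\<^sub>R x)))\<^sup>2"
      using fn_aff[OF t', of 0 "mult_op (\<lambda>x. cnj (gauss (Complex 0 (- t / 4)) x)) \<phi>"]
        AE_affine[OF t' fn_mult[OF bmult_cnj[OF bmult_phase], of "- t / 4" \<phi>], of 0]
    proof eventually_elim
      case (elim x)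
      have "cmod (gauss (Complex 0 (- t / 4)) y) = 1" for y :: "real^'n" by (simp add: cmod_gauss)
      then show ?case using elim
        by (simp add: q_def affn_def norm_mult power_mult_distrib powr_half_sq[OF t'])
    qed
    define a where "a x = of_real (sqrt (norm x)) * fn (U t) x" for x
    define b where "b x = of_real (1 / sqrt (norm x)) * fn q x" for x
    have a2: "(cmod (a x))\<^sup>2 = norm x * (cmod (fn (U t) x))\<^sup>2" for x
      by (simp add: a_def norm_mult power_mult_distrib)
    have b2: "AE x in lebesgue. (cmod (b x))\<^sup>2 = 1 / t * ((1 / t) ^ CARD('n) * f (0 + (1 / t) *\<^sub>R x))"
      using qa nz
    proof eventually_elim
      case (elim x)
      have "(cmod (b x))\<^sup>2 = (cmod (fn q x))\<^sup>2 / norm x"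
        by (simp add: b_def norm_mult norm_divide power_mult_distrib power_divide)
      then show ?case using t elim by (simp add: f_def)
    qed
    have aL: "L2_function a"
      unfolding L2_function_def a2
      using i borel_measurable_times[OF sqrt_weight_measurable(1) fm[of "U t"]] by (simp add: a_def[abs_def])
    have fi: "integrable lebesgue (\<lambda>x. 1 / t * ((1 / t) ^ CARD('n) * f (0 + (1 / t) *\<^sub>R x)))"
      using integral_affine(2)[OF t' f_meas, of 0] f_int by (intro integrable_mult_right) simp
    have bm: "b \<in> borel_measurable lebesgue"
      unfolding b_def[abs_def] by (rule borel_measurable_times[OF sqrt_weight_measurable(2) fm])
    have bL: "L2_function b"
      by (rule L2_bound[OF bm fi]) (use b2 in eventually_elim, simp)
    have nb: "(norm (cls b))\<^sup>2 = 1 / t * (LINT x|lebesgue. f x)"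
    proof -
      have "(norm (cls b))\<^sup>2 = (LINT x|lebesgue. 1 / t * ((1 / t) ^ CARD('n) * f (0 + (1 / t) *\<^sub>R x)))"
        unfolding norm_cls[OF bL]
        by (rule integral_cong_AE[OF borel_measurable_integrable[OF L2_sq_integrable[OF bL]] borel_measurable_integrable[OF fi] b2])
      also have "\<dots> = 1 / t * (LINT x|lebesgue. (1 / t) ^ CARD('n) * f (0 + (1 / t) *\<^sub>R x))"
        by (rule integral_mult_right_zero)
      also have "(LINT x|lebesgue. (1 / t) ^ CARD('n) * f (0 + (1 / t) *\<^sub>R x)) = (LINT x|lebesgue. f x)"
        by (rule integral_affine(1)[OF t' f_meas, symmetric])
      finally show ?thesis .
    qed
    have na: "(norm (cls a))\<^sup>2 = ?N" unfolding norm_cls[OF aL] a2 ..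
    have "U t \<bullet> q = cls a \<bullet> cls b"
      unfolding inner_cls[OF aL bL] inner_fn[of "U t" q]
    proof (rule integral_cong_AE)
      show "AE x in lebesgue. fn (U t) x \<bullet> fn q x = a x \<bullet> b x"
        using nz
      proof eventually_elim
        case (elim x)
        have "a x \<bullet> b x = (sqrt (norm x) *\<^sub>R fn (U t) x) \<bullet> ((1 / sqrt (norm x)) *\<^sub>R fn q x)"
          by (simp only: a_def b_def scaleR_conv_of_real)
        then show ?case using elim by simp
      qed
    qed (auto intro!: borel_measurable_integrable L2_prod_integrable aL bL)
    then have "\<bar>pseudo_conformal U t \<bullet> \<phi>\<bar> \<le> norm (cls a) * norm (cls b)"
      unfolding pq by (simp add: Cauchy_Schwarz_ineq2)
    also have "norm (cls a) = sqrt ?N" unfolding na[symmetric] by simp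
    also have "norm (cls b) = sqrt (1 / t * (LINT x|lebesgue. f x))" unfolding nb[symmetric] by simp
    also have "sqrt ?N * sqrt (1 / t * (LINT x|lebesgue. f x)) = C * sqrt (?N / t)"
      unfolding C_def by (simp add: real_sqrt_mult real_sqrt_divide)
    finally show ?thesis .
  qed
  moreover have "C \<ge> 0" using If0 by (simp add: C_def)
  ultimately show ?thesis by blast
qed

end

theorem theorem1p3:
  fixes W :: "real^'n::finite \<Rightarrow> real"
    and f :: "real^'n \<Rightarrow> complex"
    and u :: "real \<Rightarrow> real^'n \<Rightarrow> complex"
  assumes "CARD('n) \<ge> 3"
    and "W \<in> borel_measurable (completion sphere_measure)"
    and "bounded (W ` sphere 0 1)"
    and "\<And>\<theta>. \<theta> \<in> sphere 0 1 \<Longrightarrow> W \<theta> \<ge> 0"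
    and "L2_function f"
    and "schroedinger_solution W f u"
    and "Liminf at_top (\<lambda>t::real.
           ennreal (1 / t) * (\<integral>\<^sup>+ x. ennreal (norm x * (cmod (u t x))\<^sup>2) \<partial>lebesgue)) = 0"
  shows "\<forall>t. AE x in lebesgue. u t x = 0"
proof -
  interpret potential W by (rule potential.intro[OF assms(1-4)])
  note sol = assms(6)
  define U where "U t = cls (u t)" for t
  have L: "L2_function (u t)" for t using sol by (auto simp: schroedinger_solution_def continuous_into_L2_def)
  define I where "I t = (\<integral>\<^sup>+ x. ennreal (norm x * (cmod (u t x))\<^sup>2) \<partial>lebesgue)" for t
  have I_eq: "I t = (\<integral>\<^sup>+ x. ennreal (norm x * (cmod (fn (U t) x))\<^sup>2) \<partial>lebesgue)" for t
    unfolding I_def by (rule nn_integral_cong_AE) (use fn_cls[OF L[of t]] in \<open>eventually_elim, simp add: U_def\<close>)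
  have "\<exists>t. t \<ge> real (Suc k) \<and> ennreal (1 / t) * I t < ennreal (inverse (real (Suc k)))" for k
  proof (rule ccontr)
    assume "\<not> ?thesis"
    then have "\<forall>\<^sub>F t in at_top. ennreal (inverse (real (Suc k))) \<le> ennreal (1 / t) * I t"
      unfolding eventually_at_top_linorder by (intro exI[of _ "real (Suc k)"]) (auto simp: not_less)
    then have "ennreal (inverse (real (Suc k))) \<le> Liminf at_top (\<lambda>t. ennreal (1 / t) * I t)"
      by (rule Liminf_bounded)
    then have "ennreal (inverse (real (Suc k))) \<le> 0" using assms(7) by (simp add: I_def)
    then show False by (simp add: ennreal_eq_0_iff)
  qed
  then obtain T where T: "\<And>k. T k \<ge> real (Suc k)" "\<And>k. ennreal (1 / T k) * I (T k) < ennreal (inverse (real (Suc k)))"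
    by metis
  have Tpos: "T k > 0" for k using T(1)[of k] by linarith
  have int: "integrable lebesgue (\<lambda>x. norm x * (cmod (fn (U (T k)) x))\<^sup>2)" and
    small: "(LINT x|lebesgue. norm x * (cmod (fn (U (T k)) x))\<^sup>2) / T k \<le> inverse (real (Suc k))" for k
  proof -
    have fin: "I (T k) < \<infinity>"
    proof (rule ccontr)
      assume "\<not> ?thesis"
      then have "I (T k) = \<infinity>" by (simp add: less_top[symmetric])
      then have "ennreal (1 / T k) * I (T k) = \<infinity>" using Tpos[of k] by (simp add: ennreal_mult_top)
      then show False using T(2)[of k] by simp
    qed
    have nm: "(\<lambda>x::real^'n. norm x) \<in> borel_measurable lebesgue"
      by (intro measurable_completion) measurable
    have m: "(\<lambda>x. norm x * (cmod (fn (U (T k)) x))\<^sup>2) \<in> borel_measurable lebesgue"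
      by (rule borel_measurable_times[OF nm borel_measurable_integrable[OF L2_sq_integrable[OF L2_fn]]])
    show i: "integrable lebesgue (\<lambda>x. norm x * (cmod (fn (U (T k)) x))\<^sup>2)"
      by (rule integrableI_bounded[OF m]) (use fin in \<open>simp add: I_eq\<close>)
    have "I (T k) = ennreal (LINT x|lebesgue. norm x * (cmod (fn (U (T k)) x))\<^sup>2)"
      unfolding I_eq by (rule nn_integral_eq_integral[OF i]) simp
    then have "ennreal (1 / T k * (LINT x|lebesgue. norm x * (cmod (fn (U (T k)) x))\<^sup>2)) < ennreal (inverse (real (Suc k)))"
      using T(2)[of k] Tpos[of k] by (simp add: ennreal_mult'[symmetric] del: of_nat_Suc)
    then show "(LINT x|lebesgue. norm x * (cmod (fn (U (T k)) x))\<^sup>2) / T k \<le> inverse (real (Suc k))"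
      by (subst (asm) ennreal_less_iff) (use Tpos[of k] in \<open>auto intro!: mult_nonneg_nonneg Bochner_Integration.integral_nonneg\<close>)
  qed
  have ws: "selfadjoint_graph.weak_solution \<Gamma> imul UNIV U"
    using solution_weak_solution[OF sol] unfolding U_def[abs_def] .
  have cU: "(U \<longlongrightarrow> U t) (at t)" for t using solution_continuous[OF sol] unfolding U_def[abs_def] .
  have nU: "norm (U t) = norm (U 0)" for t unfolding U_def by (rule solution_norm[OF sol])
  have "pseudo_conformal U (1 / 1) = 0"
  proof (rule selfadjoint_graph.weak_solution_vanishes[OF negative_selfadjoint pseudo_conformal_weak_solution[OF cU nU ws]])
    show "norm (pseudo_conformal U (1 / t)) \<le> norm (U 0)" if "t > 0" for t
      using norm_pseudo_conformal[of "1 / t" U] nU[of "1 / t"] that by simp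
    show "1 / T k > 0" for k using Tpos by simp
    show "(\<lambda>k. 1 / T k) \<longlonglongrightarrow> 0"
    proof (rule Lim_null_comparison)
      show "\<forall>\<^sub>F k in sequentially. norm (1 / T k) \<le> inverse (real (Suc k))"
        using T(1) Tpos by (intro always_eventually allI) (simp add: inverse_eq_divide frac_le abs_of_pos del: of_nat_Suc)
      show "(\<lambda>k. inverse (real (Suc k))) \<longlonglongrightarrow> 0" by (rule LIMSEQ_inverse_real_of_nat)
    qed
    show "(\<lambda>k. pseudo_conformal U (1 / (1 / T k)) \<bullet> \<phi>) \<longlonglongrightarrow> 0" if a: "(\<phi>, w) \<in> \<Gamma>" for \<phi> w
    proof -
      obtain G where "(\<phi>, G) \<in> H1" using a by (auto elim!: graphE)
      then obtain C where C: "C \<ge> 0" "\<And>U t. t > 0 \<Longrightarrow> integrable lebesgue (\<lambda>x. norm x * (cmod (fn (U t) x))\<^sup>2) \<Longrightarrow>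
        \<bar>pseudo_conformal U t \<bullet> \<phi>\<bar> \<le> C * sqrt ((LINT x|lebesgue. norm x * (cmod (fn (U t) x))\<^sup>2) / t)"
        using concentration by blast
      show ?thesis
      proof (rule Lim_null_comparison)
        show "\<forall>\<^sub>F k in sequentially. norm (pseudo_conformal U (1 / (1 / T k)) \<bullet> \<phi>) \<le> C * sqrt (inverse (real (Suc k)))"
        proof (intro always_eventually allI)
          fix k
          have "\<bar>pseudo_conformal U (T k) \<bullet> \<phi>\<bar> \<le> C * sqrt ((LINT x|lebesgue. norm x * (cmod (fn (U (T k)) x))\<^sup>2) / T k)"
            by (rule C(2)[where U = U and t = "T k", OF Tpos int])
          also have "\<dots> \<le> C * sqrt (inverse (real (Suc k)))"
            by (intro mult_left_mono real_sqrt_le_mono small C)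
          finally show "norm (pseudo_conformal U (1 / (1 / T k)) \<bullet> \<phi>) \<le> C * sqrt (inverse (real (Suc k)))" by simp
        qed
        have "(\<lambda>k. C * sqrt (inverse (real (Suc k)))) \<longlonglongrightarrow> C * sqrt 0"
          by (intro tendsto_mult tendsto_const tendsto_real_sqrt LIMSEQ_inverse_real_of_nat)
        then show "(\<lambda>k. C * sqrt (inverse (real (Suc k)))) \<longlonglongrightarrow> 0" by simp
      qed
    qed
    show "(1::real) > 0" by simp
  qed
  then have "norm (U 1) = 0" using norm_pseudo_conformal[of 1 U] by simp
  then have "U t = 0" for t using nU[of t] nU[of 1] by simp
  then have "cls (u t) = cls (\<lambda>x. 0)" for t by (simp add: U_def cls_zero)
  then show ?thesis using cls_eq_iff[OF L L2_zero] by blast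
qed

end
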